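(* Let $\mathcal N$ be an interval or a circle and let $f:\mathcal N\to\mathcal N$ be a $C^\infty$ map with all critical points non-flat. There exist a neighbourhood $\mathcal F$ of $f$ in $C^\infty(\mathcal N)$ and a function $\rho(\epsilon,N)$ with values in $(0,\infty)$ such that the following holds. Let $g\in\mathcal F$, and let $\{J_k\}_{k=0}^m$ and $\{T_k\}_{k=0}^m$ be chains (for $g$) such that $J_k\subset T_k$ for all $0\le k\le m$. Assume that the intersection multiplicity of $\{T_k\}_{k=0}^m$ is at most $N$ and that $T_m$ contains an $\epsilon$-scaled neighbourhood of $J_m$. Then $T_0$ contains a $\rho(\epsilon,N)$-scaled neighbourhood of $J_0$. Moreover, $\rho(\epsilon,N)$ tends to infinity when $\epsilon$ goes to infinity and $N$ is fixed.
   Context: $C^\infty(\mathcal N)$ is the space of $C^\infty$ maps $\mathcal N\to\mathcal N$ with the $C^\infty$ topology. A critical point $c$ of a $C^\infty$ map $f$ is non-flat if $D^df(c)\neq0$ for some $d\ge2$. A sequence of intervals $\{T_j\}_{j=0}^m$ is a chain for $g$ if $T_j$ is a connected component of $g^{-1}(T_{j+1})$ for each $0\le j<m$. The intersection multiplicity of a finite collection of intervals is the maximal number of intervals in it with a non-empty common intersection. For $I=(a-b,a+b)$ and $\lambda>0$, $\lambda I=(a-\lambda b,a+\lambda b)$; the $\delta$-scaled neighbourhood of $I$ is $(1+2\delta)I$. *)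

theory Defs
  imports "HOL-Analysis.Analysis"
begin

section \<open>Compact one-dimensional manifolds\<close>

text \<open>Both kinds of manifold are realised inside the complex plane, the interval on the real axis
  and the circle as the unit circle. The coordinate is the identity on the interval and the angle
  on the circle; the latter is a global coordinate only up to multiples of \<open>2 * pi\<close>. Since scaled
  neighbourhoods are invariant under affine changes of the coordinate, the total length chosen for
  the circle is irrelevant.\<close>

datatype one_manifold = Interval real real | Circle

fun coord_dom :: "one_manifold \<Rightarrow> real set" where
  "coord_dom (Interval a b) = {a..b}"
| "coord_dom Circle = UNIV"

fun coord_map :: "one_manifold \<Rightarrow> real \<Rightarrow> complex" where
  "coord_map (Interval a b) = complex_of_real"
| "coord_map Circle = cis"

definition points :: "one_manifold \<Rightarrow> complex set" where
  "points M = coord_map M ` coord_dom M"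

lemma points_Interval: "points (Interval a b) = complex_of_real ` {a..b}"
  by (simp add: points_def)

lemma points_Circle: "points Circle = sphere 0 1"
proof -
  have "z \<in> range cis" if "norm z = 1" for z
  proof -
    have "z \<noteq> 0" using that by auto
    hence "z = cis (Arg z)" using that by (simp add: cis_Arg sgn_div_norm)
    thus ?thesis by blast
  qed
  thus ?thesis by (auto simp: points_def)
qed

section \<open>Smooth maps, their topology, and non-flat critical points\<close>

text \<open>Derivatives are taken relative to \<open>X\<close>, hence one-sided at the endpoints of an interval.\<close>

primrec nth_deriv :: "real set \<Rightarrow> nat \<Rightarrow> (real \<Rightarrow> real) \<Rightarrow> real \<Rightarrow> real" where
  "nth_deriv X 0 h = h"
| "nth_deriv X (Suc k) h = (\<lambda>t. vector_derivative (nth_deriv X k h) (at t within X))"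

definition smooth_real :: "real set \<Rightarrow> (real \<Rightarrow> real) \<Rightarrow> bool" where
  "smooth_real X h \<longleftrightarrow> (\<forall>k. nth_deriv X k h differentiable_on X)"

text \<open>\<open>F\<close> is the map \<open>f\<close> written in the coordinate. For the interval it is unique; for the circle
  it is a lift of \<open>f\<close> to the universal cover, unique up to adding a constant multiple of
  \<open>2 * pi\<close>, so that its derivatives are those of \<open>f\<close>.\<close>

definition smooth_lift :: "one_manifold \<Rightarrow> (complex \<Rightarrow> complex) \<Rightarrow> (real \<Rightarrow> real) \<Rightarrow> bool" where
  "smooth_lift M f F \<longleftrightarrow>
     F \<in> coord_dom M \<rightarrow> coord_dom M \<and>
     (\<forall>t\<in>coord_dom M. f (coord_map M t) = coord_map M (F t)) \<and>
     smooth_real (coord_dom M) F"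

definition smooth_self_maps :: "one_manifold \<Rightarrow> (complex \<Rightarrow> complex) set" where
  "smooth_self_maps M = {f. f \<in> points M \<rightarrow> points M \<and> (\<exists>F. smooth_lift M f F)}"

text \<open>Maps are only relevant on \<open>points M\<close>; maps agreeing there belong to the same open sets.
  On the circle, the condition for \<open>j = 0\<close> asks for two lifts that are uniformly close.\<close>

definition smooth_ball ::
  "one_manifold \<Rightarrow> (complex \<Rightarrow> complex) \<Rightarrow> nat \<Rightarrow> real \<Rightarrow> (complex \<Rightarrow> complex) set" where
  "smooth_ball M f k e =
     {g \<in> smooth_self_maps M. \<exists>F G. smooth_lift M f F \<and> smooth_lift M g G \<and>
        (\<forall>j\<le>k. \<forall>t\<in>coord_dom M.
           \<bar>nth_deriv (coord_dom M) j G t - nth_deriv (coord_dom M) j F t\<bar> < e)}"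

definition smooth_topology :: "one_manifold \<Rightarrow> (complex \<Rightarrow> complex) topology" where
  "smooth_topology M =
     topology_generated_by {smooth_ball M f k e | f k e. f \<in> smooth_self_maps M \<and> e > 0}"

lemma topspace_smooth_topology: "topspace (smooth_topology M) = smooth_self_maps M"
proof -
  have "f \<in> smooth_ball M f 0 1" if f: "f \<in> smooth_self_maps M" for f
  proof -
    obtain F where "smooth_lift M f F" using f by (auto simp: smooth_self_maps_def)
    moreover have "\<forall>j\<le>0. \<forall>t\<in>coord_dom M.
        \<bar>nth_deriv (coord_dom M) j F t - nth_deriv (coord_dom M) j F t\<bar> < 1" by simp
    ultimately show ?thesis using f unfolding smooth_ball_def by blast
  qed
  moreover have "smooth_ball M f k e \<subseteq> smooth_self_maps M" for f k e
    by (auto simp: smooth_ball_def)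
  ultimately show ?thesis
    unfolding smooth_topology_def topology_generated_by_topspace
    by (force intro!: zero_less_one)
qed

definition critical_point :: "one_manifold \<Rightarrow> (complex \<Rightarrow> complex) \<Rightarrow> complex \<Rightarrow> bool" where
  "critical_point M f c \<longleftrightarrow>
     (\<exists>F t. smooth_lift M f F \<and> t \<in> coord_dom M \<and> c = coord_map M t \<and>
        nth_deriv (coord_dom M) 1 F t = 0)"

definition non_flat :: "one_manifold \<Rightarrow> (complex \<Rightarrow> complex) \<Rightarrow> complex \<Rightarrow> bool" where
  "non_flat M f c \<longleftrightarrow>
     (\<exists>F t d. smooth_lift M f F \<and> t \<in> coord_dom M \<and> c = coord_map M t \<and>
        d \<ge> 2 \<and> nth_deriv (coord_dom M) d F t \<noteq> 0)"

section \<open>Intervals, chains and scaled neighbourhoods\<close>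

text \<open>\<open>A\<close> is a coordinate representation of the open interval \<open>I\<close> of \<open>M\<close>. Openness is relative to
  the manifold, so an interval may contain an endpoint of \<open>Interval a b\<close>. On the circle,
  injectivity bounds the length of \<open>A\<close> by \<open>2 * pi\<close>; the intervals are the proper open arcs, and
  \<open>A\<close> is unique up to translation by multiples of \<open>2 * pi\<close>.\<close>

definition interval_coord :: "one_manifold \<Rightarrow> real set \<Rightarrow> complex set \<Rightarrow> bool" where
  "interval_coord M A I \<longleftrightarrow>
     A \<noteq> {} \<and> is_interval A \<and> openin (top_of_set (coord_dom M)) A \<and>
     inj_on (coord_map M) A \<and> I = coord_map M ` A"

definition interval_in :: "one_manifold \<Rightarrow> complex set \<Rightarrow> bool" where
  "interval_in M I \<longleftrightarrow> (\<exists>A. interval_coord M A I)"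

definition scale_interval :: "real \<Rightarrow> real set \<Rightarrow> real set" where
  "scale_interval l A =
     (let a = (Inf A + Sup A) / 2; b = (Sup A - Inf A) / 2 in {a - l * b <..< a + l * b})"

text \<open>The neighbourhood is taken in \<open>M\<close>: on an interval, points outside it are discarded; on the
  circle, a neighbourhood whose coordinate length exceeds \<open>2 * pi\<close> is the whole circle. The union
  is over the essentially unique coordinate representation of \<open>I\<close> and thus makes no real choice.\<close>

definition scaled_nbhd :: "one_manifold \<Rightarrow> real \<Rightarrow> complex set \<Rightarrow> complex set" where
  "scaled_nbhd M \<delta> I =
     (\<Union>A \<in> {A. interval_coord M A I}.
        coord_map M ` (scale_interval (1 + 2 * \<delta>) A \<inter> coord_dom M))"

definition interval_chain ::
  "one_manifold \<Rightarrow> (complex \<Rightarrow> complex) \<Rightarrow> nat \<Rightarrow> (nat \<Rightarrow> complex set) \<Rightarrow> bool" where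
  "interval_chain M g m T \<longleftrightarrow>
     (\<forall>j\<le>m. interval_in M (T j)) \<and>
     (\<forall>j<m. T j \<in> components (points M \<inter> g -` T (Suc j)))"

text \<open>Intervals are counted as members of the family, i.e. with repetition. The empty set of
  indices contributes the value \<open>0\<close>.\<close>

definition intersection_multiplicity :: "nat \<Rightarrow> (nat \<Rightarrow> 'a set) \<Rightarrow> nat" where
  "intersection_multiplicity m T =
     Max {card K | K. K \<subseteq> {0..m} \<and> (\<Inter>k\<in>K. T k) \<noteq> {}}"

end

theory Submission
  imports Defs
begin

text \<open>
  Let \<open>u\<close> be the derivative of a map \<open>g\<close> close to \<open>f\<close>, and let \<open>J\<close> have left and right neighbours
  \<open>L\<close> and \<open>R\<close> in \<open>T\<close>. The logarithm of the cross ratio of \<open>J\<close> and \<open>T\<close> is the integral of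
  \<open>dx dy / (x - y)^2\<close> over \<open>L \<times> R\<close>. It is large exactly when \<open>L\<close> and \<open>R\<close> are both long compared to
  \<open>J\<close>, and it is positive exactly when both are nonempty. A diffeomorphism \<open>g\<close> multiplies it at
  most by the supremum of \<open>u x * u y * (x - y)^2 / (g x - g y)^2\<close>, that is, of the squared quotient
  of the geometric mean of \<open>u\<close> at \<open>x\<close> and \<open>y\<close> by its average between them
  (\<open>cross_log_distortion\<close>). So space is pulled back along a chain as long as the product of these
  factors stays bounded.

  A factor cannot exceed \<open>1\<close> where \<open>log \<bar>u\<bar>\<close> is concave, and where \<open>log \<bar>u\<bar>\<close> is monotone it is at
  most the exponential of the variation of \<open>log \<bar>u\<bar>\<close>. The total variation is bounded where
  \<open>log \<bar>u\<bar>\<close> is also convex: there the logarithmic derivative is largest at one end of the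
  piece, and a Markov inequality bounds it by a constant over the length. Away from critical points,
  \<open>log \<bar>u\<bar>\<close> is Lipschitz. Hence on each such piece the logarithms of the factors of a family of
  intervals of multiplicity at most \<open>N\<close> have a sum of order \<open>N\<close>
  (\<open>distortion_bound_lipschitz\<close>, \<open>distortion_bound_concave\<close>, \<open>distortion_bound_convex\<close>,
  \<open>distortion_sum\<close>).

  The number of pieces is bounded uniformly in \<open>g\<close>. Convexity of \<open>log \<bar>u\<bar>\<close> is the sign of
  \<open>u * u'' - u'^2\<close>. At a critical point of \<open>f\<close> where \<open>u\<close> vanishes to order \<open>n\<close>, the derivative of
  order \<open>2 * n - 2\<close> of this function is nonzero (\<open>log_convexity_nonzero\<close>), and it stays so for \<open>g\<close>
  near \<open>f\<close> on a whole neighbourhood; Rolle's theorem then bounds the number of zeros. By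
  compactness there is a finite set \<open>Z\<close>, of bounded size, that cuts the manifold into pieces
  of the above kinds (\<open>uniform_control\<close>). This covers all perturbations of a degenerate critical
  point at once, also those whose Schwarzian derivative is somewhere positive.

  At most \<open>N * card Z\<close> intervals of the chain meet \<open>Z\<close>. A single step with such an interval, which
  may contain critical points, keeps a definite amount of space: on an interval of length \<open>l\<close>
  where \<open>g\<close> oscillates by \<open>w\<close>, all derivatives obey Markov bounds \<open>C * w / l ^ j\<close>, so outside it \<open>g\<close> moves at most polynomially fast in units of \<open>w\<close> and \<open>l\<close>
  (\<open>polynomial_growth\<close>, \<open>one_step_space\<close>). The chain thus splits into a bounded number of
  diffeomorphic runs (\<open>diffeo_run\<close>) separated by single steps, and \<open>\<rho>\<close> is an iterate of the loss
  of one run or step (\<open>real_chain_space\<close>). The result is transferred to the manifold by lifting the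
  chains to the coordinate line (\<open>lifted_chain\<close>).
\<close>

section \<open>Derivative sequences\<close>

text \<open>The derivatives of a function are carried as a sequence. This lets the same lemmas serve
  the function itself, its higher derivatives (the shifted sequence) and the expression
  \<open>u * u'' - u'^2\<close>; derivatives within \<open>X\<close> cover the endpoints of an interval.\<close>

definition deriv_seq :: "real set \<Rightarrow> (nat \<Rightarrow> real \<Rightarrow> real) \<Rightarrow> bool" where
  "deriv_seq X D \<longleftrightarrow> (\<forall>k. \<forall>t\<in>X. (D k has_real_derivative D (Suc k) t) (at t within X))"

lemma deriv_seqD: "deriv_seq X D \<Longrightarrow> t \<in> X \<Longrightarrow> (D k has_real_derivative D (Suc k) t) (at t within X)"
  by (simp add: deriv_seq_def)

lemma deriv_seq_subset: "deriv_seq X D \<Longrightarrow> Y \<subseteq> X \<Longrightarrow> deriv_seq Y D"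
  unfolding deriv_seq_def by (meson has_field_derivative_subset subsetD)

lemma deriv_seq_continuous: "deriv_seq X D \<Longrightarrow> continuous_on X (D k)"
  unfolding deriv_seq_def by (meson DERIV_continuous_on)

lemma deriv_seq_tail: "deriv_seq X D \<Longrightarrow> deriv_seq X (\<lambda>k. D (k + j))"
  unfolding deriv_seq_def by auto

lemma deriv_seq_mvt:
  assumes "deriv_seq X D" "x < y" "{x..y} \<subseteq> X"
  obtains z where "x < z" "z < y" "D k y - D k x = (y - x) * D (Suc k) z"
proof -
  have *: "\<And>z. x \<le> z \<Longrightarrow> z \<le> y \<Longrightarrow> (D k has_derivative (*) (D (Suc k) z)) (at z within {x..y})"
    using deriv_seqD[OF deriv_seq_subset[OF assms(1,3)]]
    by (auto simp: has_field_derivative_def)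
  from mvt_simple[OF assms(2) *] obtain z where "z \<in> {x<..<y}" "D k y - D k x = D (Suc k) z * (y - x)"
    by auto
  with that show ?thesis by (auto simp: mult.commute)
qed

lemma deriv_seq_lipschitz:
  assumes D: "deriv_seq X D" and "closed_segment x y \<subseteq> X" and le: "\<And>z. z \<in> closed_segment x y \<Longrightarrow> \<bar>D (Suc k) z\<bar> \<le> K"
  shows "\<bar>D k y - D k x\<bar> \<le> K * \<bar>y - x\<bar>"
proof -
  have *: "\<bar>D k y - D k x\<bar> \<le> K * \<bar>y - x\<bar>"
    if xy: "x < y" and sub: "{x..y} \<subseteq> X" and b: "\<And>z. z \<in> {x..y} \<Longrightarrow> \<bar>D (Suc k) z\<bar> \<le> K" for x y
  proof -
    obtain z where "x < z" "z < y" "D k y - D k x = (y - x) * D (Suc k) z"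
      using deriv_seq_mvt[OF D xy sub] by blast
    then show ?thesis using b[of z] xy
      by (simp add: abs_mult mult.commute mult_left_mono)
  qed
  consider "x < y" | "x = y" | "y < x" by linarith
  then show ?thesis
  proof cases
    case 1 then show ?thesis using *[of x y] assms by (simp add: closed_segment_eq_real_ivl)
  next
    case 2 then show ?thesis by simp
  next
    case 3 then show ?thesis using *[of y x] assms
      by (simp add: closed_segment_eq_real_ivl abs_minus_commute)
  qed
qed

lemma deriv_seq_diff:
  assumes "deriv_seq X D" "deriv_seq X E"
  shows "deriv_seq X (\<lambda>k t. D k t - E k t)"
  using assms unfolding deriv_seq_def by (auto intro!: DERIV_diff)

definition leibniz :: "(nat \<Rightarrow> real \<Rightarrow> real) \<Rightarrow> (nat \<Rightarrow> real \<Rightarrow> real) \<Rightarrow> nat \<Rightarrow> real \<Rightarrow> real" where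
  "leibniz P Q k t = (\<Sum>i\<le>k. real (k choose i) * P i t * Q (k - i) t)"

lemma leibniz_sum:
  fixes P Q :: "nat \<Rightarrow> real"
  shows "(\<Sum>i\<le>k. real (k choose i) * (P (Suc i) * Q (k - i) + P i * Q (Suc (k - i)))) =
    (\<Sum>i\<le>Suc k. real (Suc k choose i) * P i * Q (Suc k - i))"
proof -
  have A: "(\<Sum>i\<le>Suc k. real (Suc k choose i) * P i * Q (Suc k - i)) =
     P 0 * Q (Suc k) + (\<Sum>i\<le>k. real (Suc k choose Suc i) * P (Suc i) * Q (k - i))"
    by (subst sum.atMost_Suc_shift) simp
  have "(\<Sum>i\<le>k. real (k choose i) * P i * Q (Suc (k - i))) = (\<Sum>i\<le>k. real (k choose i) * P i * Q (Suc k - i))"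
    by (intro sum.cong) (auto simp: Suc_diff_le)
  also have "\<dots> = (\<Sum>i\<le>Suc k. real (k choose i) * P i * Q (Suc k - i))"
    by (simp add: binomial_eq_0)
  also have "\<dots> = P 0 * Q (Suc k) + (\<Sum>i\<le>k. real (k choose Suc i) * P (Suc i) * Q (k - i))"
    by (subst sum.atMost_Suc_shift) simp
  finally have B: "(\<Sum>i\<le>k. real (k choose i) * P i * Q (Suc (k - i))) =
      P 0 * Q (Suc k) + (\<Sum>i\<le>k. real (k choose Suc i) * P (Suc i) * Q (k - i))" .
  show ?thesis unfolding A
    using B by (simp add: algebra_simps sum.distrib)
qed

lemma deriv_seq_leibniz:
  assumes "deriv_seq X P" "deriv_seq X Q"
  shows "deriv_seq X (leibniz P Q)"
  unfolding deriv_seq_def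
proof (intro allI ballI)
  fix k t assume t: "t \<in> X"
  have "((\<lambda>t. \<Sum>i\<le>k. real (k choose i) * (P i t * Q (k - i) t)) has_real_derivative
     (\<Sum>i\<le>k. real (k choose i) * (P (Suc i) t * Q (k - i) t + P i t * Q (Suc (k - i)) t))) (at t within X)"
  proof (intro DERIV_sum DERIV_cmult)
    fix i
    show "((\<lambda>t. P i t * Q (k - i) t) has_real_derivative
        P (Suc i) t * Q (k - i) t + P i t * Q (Suc (k - i)) t) (at t within X)"
      using DERIV_mult[OF deriv_seqD[OF assms(1) t, of i] deriv_seqD[OF assms(2) t, of "k - i"]]
      by (simp only: mult.commute[of "Q (Suc (k - i)) t"])
  qed
  then show "(leibniz P Q k has_real_derivative leibniz P Q (Suc k) t) (at t within X)"
    using leibniz_sum[where P="\<lambda>i. P i t" and Q="\<lambda>i. Q i t" and k=k]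
    by (simp add: leibniz_def[abs_def] mult.assoc)
qed

section \<open>Counting zeros\<close>

text \<open>Induction on \<open>S\<close> by adding a new maximum \<open>b\<close>: Rolle's theorem gives a zero between the old
  maximum and \<open>b\<close>. The bound by \<open>Max S\<close> keeps it apart from the zeros found before.\<close>

lemma rolle_interlace:
  assumes D: "deriv_seq V D" and V: "is_interval V" and fin: "finite S"
  shows "S \<noteq> {} \<longrightarrow> S \<subseteq> V \<longrightarrow> (\<forall>s\<in>S. D k s = 0) \<longrightarrow>
    (\<exists>S'\<subseteq>V. finite S' \<and> (\<forall>s\<in>S'. D (Suc k) s = 0 \<and> s < Max S) \<and> card S \<le> Suc (card S'))"
  using fin
proof (rule finite_linorder_max_induct)
  fix b S
  assume fS: "finite S" and less: "\<forall>a\<in>S. a < b" and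
    IH: "S \<noteq> {} \<longrightarrow> S \<subseteq> V \<longrightarrow> (\<forall>s\<in>S. D k s = 0) \<longrightarrow>
    (\<exists>S'\<subseteq>V. finite S' \<and> (\<forall>s\<in>S'. D (Suc k) s = 0 \<and> s < Max S) \<and> card S \<le> Suc (card S'))"
  show "insert b S \<noteq> {} \<longrightarrow> insert b S \<subseteq> V \<longrightarrow> (\<forall>s\<in>insert b S. D k s = 0) \<longrightarrow>
    (\<exists>S'\<subseteq>V. finite S' \<and> (\<forall>s\<in>S'. D (Suc k) s = 0 \<and> s < Max (insert b S)) \<and>
      card (insert b S) \<le> Suc (card S'))"
  proof (intro impI)
    assume SV: "insert b S \<subseteq> V" and zero: "\<forall>s\<in>insert b S. D k s = 0"
    show "\<exists>S'\<subseteq>V. finite S' \<and> (\<forall>s\<in>S'. D (Suc k) s = 0 \<and> s < Max (insert b S)) \<and>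
      card (insert b S) \<le> Suc (card S')"
    proof (cases "S = {}")
      case True
      have "card (insert b S) \<le> Suc (card {})" by (simp only: True card.empty) simp
      then show ?thesis by blast
    next
      case False
      obtain S' where S': "S' \<subseteq> V" "finite S'" "\<And>s. s \<in> S' \<Longrightarrow> D (Suc k) s = 0"
        "\<And>s. s \<in> S' \<Longrightarrow> s < Max S" "card S \<le> Suc (card S')"
      proof -
        have "\<exists>S'\<subseteq>V. finite S' \<and> (\<forall>s\<in>S'. D (Suc k) s = 0 \<and> s < Max S) \<and> card S \<le> Suc (card S')"
          by (rule IH[rule_format, OF False]) (use SV zero in simp_all)
        then show ?thesis using that by blast
      qed
      have m: "Max S \<in> S" "Max S < b"
        using Max_in[OF fS False] less by blast+
      have sub: "{Max S..b} \<subseteq> V"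
      proof
        fix x assume x: "x \<in> {Max S..b}"
        have "Max S \<in> V" "b \<in> V" using m SV by auto
        with V x show "x \<in> V" unfolding is_interval_1 by (meson atLeastAtMost_iff)
      qed
      obtain z where z: "Max S < z" "z < b" "D k b - D k (Max S) = (b - Max S) * D (Suc k) z"
        using deriv_seq_mvt[OF D m(2) sub] by blast
      have "D k b = 0" "D k (Max S) = 0" using zero m by auto
      with z m have z0: "D (Suc k) z = 0" by simp
      have zV: "z \<in> V" using z sub by auto
      have "z \<notin> S'" using S'(4)[of z] z by auto
      have Mb: "Max (insert b S) = b" using fS less by (intro Max_eqI) (auto intro: less_imp_le)
      have "b \<notin> S" using less by auto
      show ?thesis
        unfolding Mb
      proof (intro exI[of _ "insert z S'"] conjI ballI)
        show "insert z S' \<subseteq> V" "finite (insert z S')" using S' zV by auto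
        show "card (insert b S) \<le> Suc (card (insert z S'))"
          using S' \<open>z \<notin> S'\<close> \<open>b \<notin> S\<close> fS by simp
        fix s assume s: "s \<in> insert z S'"
        then show "D (Suc k) s = 0" using S'(3) z0 by auto
        show "s < b" using s S'(4)[of s] z m by force
      qed
    qed
  qed
qed simp

text \<open>Each differentiation loses at most one zero, and after \<open>k\<close> of them there is none left.\<close>

lemma card_zeros_le:
  assumes D: "deriv_seq V D" and V: "is_interval V" and nz: "\<And>t. t \<in> V \<Longrightarrow> D (j + k) t \<noteq> 0"
  shows "finite {t\<in>V. D j t = 0} \<and> card {t\<in>V. D j t = 0} \<le> k"
proof -
  have *: "card S \<le> k" if "finite S" "S \<subseteq> V" "\<And>s. s \<in> S \<Longrightarrow> D j s = 0" for S
    using that nz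
  proof (induction k arbitrary: j S)
    case 0
    then have "S = {}" by (auto dest: "0.prems"(4))
    then show ?case by simp
  next
    case (Suc k)
    show ?case
    proof (cases "S = {}")
      case False
      from rolle_interlace[OF D V Suc.prems(1), of j] False Suc.prems(2,3)
      obtain S' where S': "S' \<subseteq> V" "finite S'" "\<And>s. s \<in> S' \<Longrightarrow> D (Suc j) s = 0" "card S \<le> Suc (card S')"
        by blast
      from Suc.IH[OF S'(2,1,3)] Suc.prems(4) S'(4) show ?thesis by simp
    qed simp
  qed
  have fin: "finite {t\<in>V. D j t = 0}"
  proof (rule ccontr)
    assume "infinite {t\<in>V. D j t = 0}"
    then obtain S where "finite S" "card S = Suc k" "S \<subseteq> {t\<in>V. D j t = 0}"
      using infinite_arbitrarily_large by blast
    then have "card S \<le> k" by (intro *) blast+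
    with \<open>card S = Suc k\<close> show False by simp
  qed
  then show ?thesis by (intro conjI *) blast+
qed

section \<open>Oscillation and a Markov inequality\<close>

definition osc_le :: "(real \<Rightarrow> real) \<Rightarrow> real set \<Rightarrow> real \<Rightarrow> bool" where
  "osc_le g J c \<longleftrightarrow> (\<forall>s\<in>J. \<forall>t\<in>J. \<bar>g s - g t\<bar> \<le> c)"

text \<open>Downward induction on the order: if \<open>\<bar>D (Suc j)\<bar> \<ge> m\<close> on an interval, then \<open>D j\<close> is monotone with
  slope at least \<open>m\<close>, so it is large on the first or on the last quarter.\<close>

lemma osc_ge_of_deriv_ge:
  assumes "j \<ge> 1"
  shows "\<exists>c>0. \<forall>D p q m \<omega>. deriv_seq {p..q} D \<longrightarrow> p < q \<longrightarrow> m \<ge> 0 \<longrightarrow> (\<forall>t\<in>{p..q}. \<bar>D j t\<bar> \<ge> m) \<longrightarrow>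
    osc_le (D 0) {p..q} \<omega> \<longrightarrow> c * m * (q - p) ^ j \<le> \<omega>"
  using assms
proof (induction j rule: nat_induct_at_least)
  case base
  show ?case
  proof (rule exI[of _ 1], intro conjI allI impI)
    fix D :: "nat \<Rightarrow> real \<Rightarrow> real" and p q m \<omega> :: real
    assume D: "deriv_seq {p..q} D" and pq: "p < q" and m: "m \<ge> 0" "\<forall>t\<in>{p..q}. \<bar>D 1 t\<bar> \<ge> m" and o: "osc_le (D 0) {p..q} \<omega>"
    obtain z where z: "p < z" "z < q" "D 0 q - D 0 p = (q - p) * D (Suc 0) z"
      using deriv_seq_mvt[OF D pq order.refl] by blast
    have "m * (q - p) \<le> \<bar>D 0 q - D 0 p\<bar>"
      using z m(2) pq by (simp add: abs_mult mult.commute)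
    also have "\<dots> \<le> \<omega>" using o pq by (auto simp: osc_le_def)
    finally show "1 * m * (q - p) ^ 1 \<le> \<omega>" by simp
  qed simp
next
  case (Suc j)
  then obtain c where c: "c > 0" and IH: "\<And>D p q m \<omega>. deriv_seq {p..q} D \<Longrightarrow> p < q \<Longrightarrow> m \<ge> 0 \<Longrightarrow> (\<forall>t\<in>{p..q}. \<bar>D j t\<bar> \<ge> m) \<Longrightarrow>
    osc_le (D 0) {p..q} \<omega> \<Longrightarrow> c * m * (q - p) ^ j \<le> \<omega>" by blast
  show ?case
  proof (rule exI[of _ "c * (1/4) ^ Suc j"], intro conjI allI impI)
    fix D :: "nat \<Rightarrow> real \<Rightarrow> real" and p q m \<omega> :: real
    assume D: "deriv_seq {p..q} D" and pq: "p < q" and m: "m \<ge> 0" "\<forall>t\<in>{p..q}. \<bar>D (Suc j) t\<bar> \<ge> m" and o: "osc_le (D 0) {p..q} \<omega>"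
    define l where "l = (q - p) / 4"
    have l: "l > 0" "p + l \<le> q" "p + l < q - l" using pq by (auto simp: l_def field_simps)
    have "\<exists>p' q'. p \<le> p' \<and> p' < q' \<and> q' \<le> q \<and> q' - p' = l \<and> (\<forall>t\<in>{p'..q'}. \<bar>D j t\<bar> \<ge> m * l)"
    proof -
      \<comment> \<open>a function whose derivative is at least \<open>m\<close> in absolute value separates the outer quarters\<close>
      have sep: "\<bar>D j t - D j s\<bar> \<ge> m * (t - s)" if s: "s \<in> {p..q}" and t: "t \<in> {p..q}" and st: "s < t" for s t
      proof -
        have "{s..t} \<subseteq> {p..q}" using s t by auto
        from deriv_seq_mvt[OF D st this] obtain z where z: "s < z" "z < t" "D j t - D j s = (t - s) * D (Suc j) z"
          by blast
        then have "\<bar>D (Suc j) z\<bar> \<ge> m" using m s t by simp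
        then show ?thesis using st z by (simp add: abs_mult mult.commute)
      qed
      show ?thesis
      proof (rule ccontr)
        assume neg: "\<not> ?thesis"
        have "\<not> (\<forall>t\<in>{p..p+l}. \<bar>D j t\<bar> \<ge> m * l)"
        proof
          assume "\<forall>t\<in>{p..p+l}. \<bar>D j t\<bar> \<ge> m * l"
          with l show False
            by - (rule notE[OF neg], rule exI[of _ p], rule exI[of _ "p + l"], simp)
        qed
        then obtain s where s: "s \<in> {p..p+l}" "\<bar>D j s\<bar> < m * l" by force
        have "\<not> (\<forall>t\<in>{q-l..q}. \<bar>D j t\<bar> \<ge> m * l)"
        proof
          assume "\<forall>t\<in>{q-l..q}. \<bar>D j t\<bar> \<ge> m * l"
          with l show False
            by - (rule notE[OF neg], rule exI[of _ "q - l"], rule exI[of _ q], simp)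
        qed
        then obtain t where "t \<in> {q-l..q}" "\<bar>D j t\<bar> < m * l" by force
        with s have st: "s \<in> {p..p+l}" "t \<in> {q-l..q}" "\<bar>D j s\<bar> < m * l" "\<bar>D j t\<bar> < m * l"
          by auto
        then have "m * (t - s) \<le> \<bar>D j t - D j s\<bar>" using l by (intro sep) auto
        also have "\<dots> < m * (2 * l)" using st by linarith
        finally have "m * (t - s) < m * (2 * l)" .
        moreover have "2 * l \<le> t - s" using st by (auto simp: l_def field_simps)
        ultimately show False using m(1) by (meson mult_left_mono not_le)
      qed
    qed
    then obtain p' q' where pq': "p \<le> p'" "p' < q'" "q' \<le> q" "q' - p' = l" "\<forall>t\<in>{p'..q'}. \<bar>D j t\<bar> \<ge> m * l" by blast
    have "c * (m * l) * (q' - p') ^ j \<le> \<omega>"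
    proof (rule IH)
      show "deriv_seq {p'..q'} D" using deriv_seq_subset[OF D] pq' by auto
      show "osc_le (D 0) {p'..q'} \<omega>" using o pq' by (auto simp: osc_le_def)
    qed (use pq' m l in auto)
    moreover have "c * (1/4) ^ Suc j * m * (q - p) ^ Suc j = c * (m * l) * (q' - p') ^ j"
    proof -
      have "(1/4) ^ Suc j * (q - p) ^ Suc j = l ^ Suc j"
        by (simp only: power_mult_distrib[symmetric]) (simp add: l_def)
      then have "c * m * ((1/4) ^ Suc j * (q - p) ^ Suc j) = c * m * l ^ Suc j" by (rule arg_cong)
      then show ?thesis unfolding pq'(4) by (simp only: power_Suc mult_ac)
    qed
    ultimately show "c * (1/4) ^ Suc j * m * (q - p) ^ Suc j \<le> \<omega>" by (simp only:)
  qed (use c in auto)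
qed

text \<open>If \<open>\<bar>D j t\<bar>\<close> is large compared to the bound for the next derivative, then \<open>\<bar>D j\<bar>\<close> stays above half
  of this value on half of the interval, which forces a large oscillation.\<close>

lemma markov_step:
  assumes "j \<ge> 1" "C > 0"
  shows "\<exists>C'>0. \<forall>D x y \<omega>. deriv_seq {x..y} D \<longrightarrow> x < y \<longrightarrow> osc_le (D 0) {x..y} \<omega> \<longrightarrow>
    (\<forall>t\<in>{x..y}. \<bar>D (Suc j) t\<bar> * (y - x) ^ Suc j \<le> C * \<omega>) \<longrightarrow>
    (\<forall>t\<in>{x..y}. \<bar>D j t\<bar> * (y - x) ^ j \<le> C' * \<omega>)"
proof -
  from osc_ge_of_deriv_ge[OF assms(1)] obtain c where c: "c > 0" and L1: "\<And>D p q m \<omega>. deriv_seq {p..q} D \<Longrightarrow> p < q \<Longrightarrow> m \<ge> 0 \<Longrightarrow> (\<forall>t\<in>{p..q}. \<bar>D j t\<bar> \<ge> m) \<Longrightarrow>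
    osc_le (D 0) {p..q} \<omega> \<Longrightarrow> c * m * (q - p) ^ j \<le> \<omega>" by blast
  show ?thesis
  proof (rule exI[of _ "C + 2 * 2 ^ j / c"], intro conjI allI impI ballI)
    show "C + 2 * 2 ^ j / c > 0" using assms c by (simp add: add_pos_pos)
    fix D :: "nat \<Rightarrow> real \<Rightarrow> real" and x y \<omega> t :: real
    assume D: "deriv_seq {x..y} D" and xy: "x < y" and o: "osc_le (D 0) {x..y} \<omega>"
      and up: "\<forall>t\<in>{x..y}. \<bar>D (Suc j) t\<bar> * (y - x) ^ Suc j \<le> C * \<omega>" and t: "t \<in> {x..y}"
    define l where "l = y - x"
    have l: "l > 0" using xy by (simp add: l_def)
    have o0: "\<omega> \<ge> 0" using o xy by (force simp: osc_le_def)
    show "\<bar>D j t\<bar> * (y - x) ^ j \<le> (C + 2 * 2 ^ j / c) * \<omega>"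
    proof (cases "\<bar>D j t\<bar> * l ^ j \<le> C * \<omega>")
      case True
      have "0 \<le> 2 * 2 ^ j / c * \<omega>" using c o0 by simp
      with True show ?thesis by (simp add: l_def distrib_right)
    next
      case False
      define m where "m = \<bar>D j t\<bar> / 2"
      obtain p q where pq: "x \<le> p" "p < q" "q \<le> y" "q - p = l / 2" "t \<in> {p..q}"
      proof (cases "t \<le> x + l / 2")
        case True then show ?thesis using that[of x "x + l/2"] t l by (simp add: l_def field_simps)
      next
        case False then show ?thesis using that[of "y - l/2" y] t l by (simp add: l_def field_simps)
      qed
      have "c * m * (q - p) ^ j \<le> \<omega>"
      proof (rule L1)
        show "deriv_seq {p..q} D" using deriv_seq_subset[OF D] pq by auto
        show "osc_le (D 0) {p..q} \<omega>" using o pq by (auto simp: osc_le_def)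
        show "\<forall>s\<in>{p..q}. m \<le> \<bar>D j s\<bar>"
        proof
          fix s assume s: "s \<in> {p..q}"
          have sub: "closed_segment t s \<subseteq> {x..y}"
            using s pq by (auto simp: closed_segment_eq_real_ivl)
          have "\<bar>D j s - D j t\<bar> \<le> (C * \<omega> / l ^ Suc j) * \<bar>s - t\<bar>"
          proof (rule deriv_seq_lipschitz[OF D sub])
            fix z assume "z \<in> closed_segment t s"
            then have "\<bar>D (Suc j) z\<bar> * l ^ Suc j \<le> C * \<omega>" using up sub unfolding l_def by blast
            then show "\<bar>D (Suc j) z\<bar> \<le> C * \<omega> / l ^ Suc j"
              using l by (simp add: pos_le_divide_eq del: power_Suc)
          qed
          also have "\<dots> \<le> (C * \<omega> / l ^ Suc j) * (l / 2)"
          proof (rule mult_left_mono)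
            have "\<bar>s - t\<bar> \<le> q - p" using s pq(5) by auto
            then show "\<bar>s - t\<bar> \<le> l / 2" using pq(4) by simp
          qed (use o0 assms l in auto)
          also have "\<dots> = (C * \<omega>) / l ^ j / 2" using l by simp
          also have "\<dots> \<le> \<bar>D j t\<bar> / 2"
          proof -
            have "C * \<omega> \<le> \<bar>D j t\<bar> * l ^ j" using False by linarith
            moreover have "l ^ j > 0" using l by simp
            ultimately have "C * \<omega> / l ^ j \<le> \<bar>D j t\<bar>" by (simp only: pos_divide_le_eq)
            then show ?thesis by (rule divide_right_mono) simp
          qed
          finally show "m \<le> \<bar>D j s\<bar>" unfolding m_def by linarith
        qed
      qed (use pq m_def in auto)
      then have "c * (\<bar>D j t\<bar> * l ^ j) / (2 * 2 ^ j) \<le> \<omega>"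
        by (simp add: pq(4) m_def power_divide mult.assoc)
      then have "\<bar>D j t\<bar> * l ^ j \<le> 2 * 2 ^ j / c * \<omega>"
        using c by (simp add: pos_divide_le_eq pos_le_divide_eq mult_ac)
      moreover have "0 \<le> C * \<omega>" using o0 assms by simp
      ultimately show ?thesis by (simp add: l_def distrib_right)
    qed
  qed
qed

text \<open>Markov's inequality, for functions that resemble polynomials of degree \<open>d\<close> in that their
  derivative of order \<open>d\<close> is no larger than the oscillation permits.\<close>

lemma markov:
  assumes "K > 0"
  shows "\<exists>C>0. \<forall>D x y \<omega>. deriv_seq {x..y} D \<longrightarrow> x < y \<longrightarrow> osc_le (D 0) {x..y} \<omega> \<longrightarrow>
    (\<forall>t\<in>{x..y}. \<bar>D d t\<bar> * (y - x) ^ d \<le> K * \<omega>) \<longrightarrow>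
    (\<forall>j\<in>{1..d}. \<forall>t\<in>{x..y}. \<bar>D j t\<bar> * (y - x) ^ j \<le> C * \<omega>)"
  using assms
proof (induction d arbitrary: K)
  case 0
  show ?case by (intro exI[of _ 1]) simp
next
  case (Suc d)
  show ?case
  proof (cases "d = 0")
    case True
    then have "{1..Suc d} = {Suc d}" by auto
    then show ?thesis using Suc.prems by (intro exI[of _ K]) simp
  next
    case False
    then have "d \<ge> 1" by simp
    from markov_step[OF this Suc.prems] obtain C' where C': "C' > 0" and step: "\<And>D x y \<omega>. deriv_seq {x..y} D \<Longrightarrow> x < y \<Longrightarrow> osc_le (D 0) {x..y} \<omega> \<Longrightarrow>
    (\<forall>t\<in>{x..y}. \<bar>D (Suc d) t\<bar> * (y - x) ^ Suc d \<le> K * \<omega>) \<Longrightarrow>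
    (\<forall>t\<in>{x..y}. \<bar>D d t\<bar> * (y - x) ^ d \<le> C' * \<omega>)" by blast
    from Suc.IH[OF C'] obtain C where C: "C > 0" and IH: "\<And>D x y \<omega>. deriv_seq {x..y} D \<Longrightarrow> x < y \<Longrightarrow> osc_le (D 0) {x..y} \<omega> \<Longrightarrow>
    (\<forall>t\<in>{x..y}. \<bar>D d t\<bar> * (y - x) ^ d \<le> C' * \<omega>) \<Longrightarrow>
    (\<forall>j\<in>{1..d}. \<forall>t\<in>{x..y}. \<bar>D j t\<bar> * (y - x) ^ j \<le> C * \<omega>)" by blast
    show ?thesis
    proof (rule exI[of _ "C + K"], intro conjI allI impI)
      show "C + K > 0" using C Suc.prems by simp
      fix D :: "nat \<Rightarrow> real \<Rightarrow> real" and x y \<omega> :: real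
      assume D: "deriv_seq {x..y} D" and xy: "x < y" and o: "osc_le (D 0) {x..y} \<omega>"
        and up: "\<forall>t\<in>{x..y}. \<bar>D (Suc d) t\<bar> * (y - x) ^ Suc d \<le> K * \<omega>"
      have o0: "\<omega> \<ge> 0" using o xy by (force simp: osc_le_def)
      have pos: "0 \<le> C * \<omega>" "0 \<le> K * \<omega>" using C Suc.prems o0 by auto
      have IH': "\<forall>j\<in>{1..d}. \<forall>t\<in>{x..y}. \<bar>D j t\<bar> * (y - x) ^ j \<le> C * \<omega>"
        by (rule IH[OF D xy o step[OF D xy o up]])
      show "\<forall>j\<in>{1..Suc d}. \<forall>t\<in>{x..y}. \<bar>D j t\<bar> * (y - x) ^ j \<le> (C + K) * \<omega>"
      proof (intro ballI)
        fix j t assume j: "j \<in> {1..Suc d}" and t: "t \<in> {x..y}"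
        show "\<bar>D j t\<bar> * (y - x) ^ j \<le> (C + K) * \<omega>"
        proof (cases "j = Suc d")
          case True
          with up t have "\<bar>D j t\<bar> * (y - x) ^ j \<le> K * \<omega>" by blast
          then show ?thesis using pos by (simp add: distrib_right)
        next
          case False
          then have "j \<in> {1..d}" using j by auto
          with IH' t have "\<bar>D j t\<bar> * (y - x) ^ j \<le> C * \<omega>" by blast
          then show ?thesis using pos by (simp add: distrib_right)
        qed
      qed
    qed
  qed
qed

section \<open>Distortion on pieces where the logarithmic derivative is tame\<close>

(* Indices of derivatives stay numerals, so that 1, 2 and 3 are not rewritten to successors. *)
declare One_nat_def [simp del] One_nat_def [symmetric, simp]

lemma interval_mvt:
  fixes g :: "real \<Rightarrow> real"
  assumes "x < y" "\<And>t. t \<in> {x..y} \<Longrightarrow> (g has_real_derivative g' t) (at t within {x..y})"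
  obtains z where "x < z" "z < y" "g y - g x = (y - x) * g' z"
proof -
  have *: "\<And>z. x \<le> z \<Longrightarrow> z \<le> y \<Longrightarrow> (g has_derivative (*) (g' z)) (at z within {x..y})"
    using assms(2) by (simp add: has_field_derivative_def)
  from mvt_simple[OF assms(1) *] obtain z where z: "z \<in> {x<..<y}" "g y - g x = g' z * (y - x)"
    by blast
  show ?thesis by (rule that[of z]) (use z in \<open>simp_all add: mult.commute\<close>)
qed

lemma interval_Icc_subset: "is_interval E \<Longrightarrow> x \<in> E \<Longrightarrow> y \<in> E \<Longrightarrow> {x..y::real} \<subseteq> E"
  unfolding is_interval_1 by (meson atLeastAtMost_iff subsetI)

lemma deriv_seq_at:
  assumes "deriv_seq X D" "{x..y} \<subseteq> X" "x < z" "z < y"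
  shows "(D k has_real_derivative D (Suc k) z) (at z)"
proof -
  have "(D k has_real_derivative D (Suc k) z) (at z within {x..y})"
    using deriv_seqD[OF deriv_seq_subset[OF assms(1,2)], of z] assms(3,4) by simp
  then show ?thesis using at_within_Icc_at[OF assms(3,4)] by simp
qed

lemma deriv_ln_abs:
  assumes D: "deriv_seq E D" "t \<in> E" and nz: "\<And>s. s \<in> E \<Longrightarrow> D k s \<noteq> 0"
  shows "((\<lambda>t. ln \<bar>D k t\<bar>) has_real_derivative D (Suc k) t / D k t) (at t within E)"
proof -
  have "(D k t)\<^sup>2 > 0" using nz[OF D(2)] by simp
  then have "((\<lambda>t. ln ((D k t)\<^sup>2) / 2) has_real_derivative D (Suc k) t / D k t) (at t within E)"
    using nz[OF D(2)]
    by (auto intro!: derivative_eq_intros deriv_seqD[OF D] simp: power2_eq_square)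
  moreover have "ln ((D k t)\<^sup>2) / 2 = ln \<bar>D k t\<bar>" if "t \<in> E" for t
  proof -
    have "ln ((D k t)\<^sup>2) = ln (\<bar>D k t\<bar> ^ 2)" by simp
    also have "\<dots> = 2 * ln \<bar>D k t\<bar>" using nz[OF that] ln_realpow[of "\<bar>D k t\<bar>" 2] by simp
    finally show ?thesis by simp
  qed
  ultimately show ?thesis
    by (rule has_field_derivative_transform_within[OF _ zero_less_one D(2)])
qed

text \<open>The quotient of the two sides without the exponential is the factor by which \<open>g\<close> changes the
  kernel \<open>dx dy / (x - y)^2\<close>. Bounding its logarithm by increments of one monotone function makes the
  bounds for disjoint intervals add up to at most \<open>C\<close>.\<close>

definition distortion_bound :: "(nat \<Rightarrow> real \<Rightarrow> real) \<Rightarrow> real set \<Rightarrow> real \<Rightarrow> bool" where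
  "distortion_bound D E C \<longleftrightarrow>
    (\<exists>\<psi>. mono_on E \<psi> \<and> (\<forall>t\<in>E. 0 \<le> \<psi> t \<and> \<psi> t \<le> C) \<and>
      (\<forall>x\<in>E. \<forall>y\<in>E. x < y \<longrightarrow>
        \<bar>D 1 x * D 1 y\<bar> * (y - x)\<^sup>2 \<le> exp (\<psi> y - \<psi> x) * (D 0 y - D 0 x)\<^sup>2))"

lemma normalize_mono:
  fixes \<theta> :: "real \<Rightarrow> real"
  assumes "mono_on E \<theta>" "\<And>x y. x \<in> E \<Longrightarrow> y \<in> E \<Longrightarrow> x < y \<Longrightarrow> \<theta> y - \<theta> x \<le> C" "C \<ge> 0"
  shows "\<exists>\<psi>. mono_on E \<psi> \<and> (\<forall>t\<in>E. 0 \<le> \<psi> t \<and> \<psi> t \<le> C) \<and> (\<forall>x y. \<psi> y - \<psi> x = \<theta> y - \<theta> x)"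
proof (cases "E = {}")
  case False
  then obtain e where e: "e \<in> E" by blast
  have le: "\<theta> y - C \<le> \<theta> x" if "x \<in> E" "y \<in> E" for x y
  proof -
    consider "x < y" | "y \<le> x" by linarith
    then show ?thesis
    proof cases
      case 1 then show ?thesis using assms(2)[OF that 1] by linarith
    next
      case 2 then show ?thesis using mono_onD[OF assms(1) that(2,1) 2] assms(3) by linarith
    qed
  qed
  have bb: "bdd_below (\<theta> ` E)" using le[OF _ e] by (intro bdd_belowI2[where m = "\<theta> e - C"])
  show ?thesis
  proof (rule exI[of _ "\<lambda>t. \<theta> t - Inf (\<theta> ` E)"], intro conjI ballI)
    show "mono_on E (\<lambda>t. \<theta> t - Inf (\<theta> ` E))"
      using assms(1) unfolding mono_on_def by auto
    fix t assume t: "t \<in> E"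
    show "0 \<le> \<theta> t - Inf (\<theta> ` E)" using cINF_lower[OF bb t] by linarith
    have "\<theta> t - C \<le> Inf (\<theta> ` E)" by (rule cINF_greatest[OF False]) (rule le[OF _ t])
    then show "\<theta> t - Inf (\<theta> ` E) \<le> C" by linarith
  qed simp
qed (auto simp: mono_on_def)

lemma distortion_boundI:
  assumes "mono_on E \<theta>" "\<And>x y. x \<in> E \<Longrightarrow> y \<in> E \<Longrightarrow> x < y \<Longrightarrow> \<theta> y - \<theta> x \<le> C" "C \<ge> 0"
    "\<And>x y. x \<in> E \<Longrightarrow> y \<in> E \<Longrightarrow> x < y \<Longrightarrow>
      \<bar>D 1 x * D 1 y\<bar> * (y - x)\<^sup>2 \<le> exp (\<theta> y - \<theta> x) * (D 0 y - D 0 x)\<^sup>2"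
  shows "distortion_bound D E C"
proof -
  from normalize_mono[OF assms(1-3)] obtain \<psi> where
    \<psi>: "mono_on E \<psi>" "\<forall>t\<in>E. 0 \<le> \<psi> t \<and> \<psi> t \<le> C" "\<And>x y. \<psi> y - \<psi> x = \<theta> y - \<theta> x" by blast
  show ?thesis unfolding distortion_bound_def
    by (rule exI[of _ \<psi>]) (use \<psi> assms(4) in simp)
qed

lemma sq_increment_ge:
  assumes D: "deriv_seq E D" "{x..y} \<subseteq> E" "x < y" and m: "m \<ge> 0" "\<And>z. z \<in> {x..y} \<Longrightarrow> m \<le> \<bar>D 1 z\<bar>"
  shows "m\<^sup>2 * (y - x)\<^sup>2 \<le> (D 0 y - D 0 x)\<^sup>2"
proof -
  obtain z where z: "x < z" "z < y" "D 0 y - D 0 x = (y - x) * D (Suc 0) z"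
    using deriv_seq_mvt[OF D(1,3,2)] by blast
  have "m\<^sup>2 \<le> (D 1 z)\<^sup>2" using m(1) m(2)[of z] z(1,2) by (simp add: abs_le_square_iff[symmetric])
  then have "m\<^sup>2 * (y - x)\<^sup>2 \<le> (D 1 z)\<^sup>2 * (y - x)\<^sup>2" by (rule mult_right_mono) simp
  then show ?thesis unfolding z(3) power_mult_distrib by (simp add: mult.commute)
qed

lemma log_deriv_deriv:
  assumes D: "deriv_seq E D" "t \<in> E" and nz: "\<And>s. s \<in> E \<Longrightarrow> D 1 s \<noteq> 0"
  shows "((\<lambda>t. D 2 t / D 1 t) has_real_derivative (D 1 t * D 3 t - (D 2 t)\<^sup>2) / (D 1 t)\<^sup>2) (at t within E)"
proof -
  have "((\<lambda>t. D (Suc 1) t / D 1 t) has_real_derivative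
     (D (Suc (Suc 1)) t * D 1 t - D (Suc 1) t * D (Suc 1) t) / (D 1 t * D 1 t)) (at t within E)"
    by (rule DERIV_divide[OF deriv_seqD[OF D] deriv_seqD[OF D] nz[OF D(2)]])
  then show ?thesis
    by (simp add: power2_eq_square mult.commute)
qed

lemma log_mvt:
  assumes D: "deriv_seq E D" and E: "is_interval E" and nz: "\<And>s. s \<in> E \<Longrightarrow> D 1 s \<noteq> 0"
    and st: "s \<in> E" "t \<in> E" "s < t"
  shows "\<exists>z. s < z \<and> z < t \<and> ln \<bar>D 1 t\<bar> - ln \<bar>D 1 s\<bar> = (t - s) * (D 2 z / D 1 z)"
proof -
  have sub: "{s..t} \<subseteq> E" by (rule interval_Icc_subset[OF E st(1,2)])
  have "((\<lambda>t. ln \<bar>D 1 t\<bar>) has_real_derivative D 2 z / D 1 z) (at z within {s..t})" if "z \<in> {s..t}" for z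
    using deriv_ln_abs[OF deriv_seq_subset[OF D sub] that, of 1] nz subsetD[OF sub] by simp
  then show ?thesis by (rule interval_mvt[OF st(3)]) auto
qed

lemma log_deriv_mvt:
  assumes D: "deriv_seq E D" and E: "is_interval E" and nz: "\<And>s. s \<in> E \<Longrightarrow> D 1 s \<noteq> 0"
    and st: "s \<in> E" "t \<in> E" "s < t"
  shows "\<exists>z. s < z \<and> z < t \<and> D 2 t / D 1 t - D 2 s / D 1 s = (t - s) * ((D 1 z * D 3 z - (D 2 z)\<^sup>2) / (D 1 z)\<^sup>2)"
proof -
  have sub: "{s..t} \<subseteq> E" by (rule interval_Icc_subset[OF E st(1,2)])
  have "((\<lambda>t. D 2 t / D 1 t) has_real_derivative (D 1 z * D 3 z - (D 2 z)\<^sup>2) / (D 1 z)\<^sup>2) (at z within {s..t})"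
    if "z \<in> {s..t}" for z
    using log_deriv_deriv[OF deriv_seq_subset[OF D sub] that] nz subsetD[OF sub] by simp
  then show ?thesis by (rule interval_mvt[OF st(3)]) auto
qed

text \<open>If \<open>log \<bar>D 1\<bar>\<close> is Lipschitz, the values of \<open>D 1\<close> at \<open>x\<close> and \<open>y\<close> are comparable to all values in
  between, up to the exponential of \<open>C * (y - x)\<close>.\<close>

lemma distortion_bound_lipschitz:
  assumes D: "deriv_seq E D" and E: "is_interval E" "E \<subseteq> {lo..hi}" and nz: "\<And>s. s \<in> E \<Longrightarrow> D 1 s \<noteq> 0"
    and L: "C \<ge> 0" "\<And>t. t \<in> E \<Longrightarrow> \<bar>D 2 t\<bar> \<le> C * \<bar>D 1 t\<bar>" and lohi: "lo \<le> hi"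
  shows "distortion_bound D E (2 * C * (hi - lo))"
proof (rule distortion_boundI[where \<theta> = "\<lambda>t. 2 * C * t"])
  show "mono_on E (\<lambda>t. 2 * C * t)" using L(1) by (intro mono_onI) (simp add: mult_left_mono)
  show "0 \<le> 2 * C * (hi - lo)" using L(1) lohi by simp
  fix x y assume xy: "x \<in> E" "y \<in> E" "x < y"
  have "y - x \<le> hi - lo" using subsetD[OF E(2) xy(1)] subsetD[OF E(2) xy(2)] by simp
  then have "2 * C * (y - x) \<le> 2 * C * (hi - lo)" using L(1) by (intro mult_left_mono) auto
  then show "2 * C * y - 2 * C * x \<le> 2 * C * (hi - lo)" by (simp add: algebra_simps)
  have sub: "{x..y} \<subseteq> E" by (rule interval_Icc_subset[OF E(1) xy(1,2)])
  have phi: "\<bar>ln \<bar>D 1 t\<bar> - ln \<bar>D 1 s\<bar>\<bar> \<le> C * (y - x)" if st: "s \<in> {x..y}" "t \<in> {x..y}" "s < t" for s t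
  proof -
    have stE: "s \<in> E" "t \<in> E" using st sub by auto
    obtain z where z: "s < z" "z < t" "ln \<bar>D 1 t\<bar> - ln \<bar>D 1 s\<bar> = (t - s) * (D 2 z / D 1 z)"
      using log_mvt[OF D E(1) nz stE st(3)] by blast
    have zE: "z \<in> E" using interval_Icc_subset[OF E(1) stE] z by auto
    have "\<bar>D 2 z / D 1 z\<bar> \<le> C"
      using L(2)[OF zE] nz[OF zE] by (simp add: pos_divide_le_eq)
    then have "(t - s) * \<bar>D 2 z / D 1 z\<bar> \<le> (y - x) * C"
      using st L(1) by (intro mult_mono) auto
    then show ?thesis unfolding z(3) using st(3) by (simp add: abs_mult mult.commute)
  qed
  have phi': "\<bar>ln \<bar>D 1 t\<bar> - ln \<bar>D 1 s\<bar>\<bar> \<le> C * (y - x)" if "s \<in> {x..y}" "t \<in> {x..y}" for s t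
  proof (cases s t rule: linorder_cases)
    case less then show ?thesis using phi[OF that] by simp
  next
    case equal then show ?thesis using L(1) xy(3) by simp
  next
    case greater then show ?thesis using phi[OF that(2,1)] by (simp add: abs_minus_commute)
  qed
  define m where "m = sqrt \<bar>D 1 x * D 1 y\<bar> * exp (- (C * (y - x)))"
  have pos: "\<bar>D 1 s\<bar> > 0" if "s \<in> {x..y}" for s using nz sub that by auto
  have xin: "x \<in> {x..y}" and yin: "y \<in> {x..y}" using xy(3) by auto
  have "m\<^sup>2 * (y - x)\<^sup>2 \<le> (D 0 y - D 0 x)\<^sup>2"
  proof (rule sq_increment_ge[OF D sub xy(3)])
    show "m \<ge> 0" by (simp add: m_def)
    fix z assume z: "z \<in> {x..y}"
    have "ln \<bar>D 1 x\<bar> - C * (y - x) \<le> ln \<bar>D 1 z\<bar>" "ln \<bar>D 1 y\<bar> - C * (y - x) \<le> ln \<bar>D 1 z\<bar>"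
      using phi'[OF z xin] phi'[OF z yin] by linarith+
    then have "(ln \<bar>D 1 x\<bar> + ln \<bar>D 1 y\<bar>) / 2 - C * (y - x) \<le> ln \<bar>D 1 z\<bar>"
      by (simp add: field_simps)
    moreover have "ln m = (ln \<bar>D 1 x\<bar> + ln \<bar>D 1 y\<bar>) / 2 - C * (y - x)"
      using pos[OF xin] pos[OF yin] unfolding m_def
      by (simp add: ln_mult ln_sqrt abs_mult)
    ultimately have "ln m \<le> ln \<bar>D 1 z\<bar>" by simp
    moreover have "m > 0" using pos[OF xin] pos[OF yin] by (simp add: m_def)
    ultimately show "m \<le> \<bar>D 1 z\<bar>" using pos[OF z] by simp
  qed
  moreover have "m\<^sup>2 = \<bar>D 1 x * D 1 y\<bar> * exp (- (2 * C * (y - x)))"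
    unfolding m_def power_mult_distrib by (simp add: exp_double[symmetric] mult_ac)
  ultimately have le: "exp (- (2 * C * (y - x))) * (\<bar>D 1 x * D 1 y\<bar> * (y - x)\<^sup>2) \<le> (D 0 y - D 0 x)\<^sup>2"
    by (simp add: mult_ac)
  define e where "e = exp (2 * C * y - 2 * C * x)"
  have e: "exp (- (2 * C * (y - x))) = inverse e" "e > 0"
    by (simp_all add: e_def exp_minus[symmetric] algebra_simps)
  from le show "\<bar>D 1 x * D 1 y\<bar> * (y - x)\<^sup>2 \<le> exp (2 * C * y - 2 * C * x) * (D 0 y - D 0 x)\<^sup>2"
    unfolding e(1) e_def[symmetric] using e(2)
    by (simp add: inverse_eq_divide pos_divide_le_eq mult_ac)
qed

text \<open>If \<open>log \<bar>D 1\<bar>\<close> is concave, then \<open>\<bar>D 1 z\<bar> * \<bar>D 1 (x + y - z)\<bar> \<ge> \<bar>D 1 x * D 1 y\<bar>\<close>. By the inequality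
  of the arithmetic and geometric mean, averaging over \<open>z\<close> shows that the mean of \<open>\<bar>D 1\<bar>\<close> on \<open>{x..y}\<close> is
  at least the geometric mean of its values at the ends. Reflection about the midpoint turns the
  average into the monotonicity of a single function \<open>H\<close>.\<close>

lemma distortion_bound_concave:
  assumes D: "deriv_seq E D" and E: "is_interval E" and nz: "\<And>s. s \<in> E \<Longrightarrow> D 1 s \<noteq> 0"
    and conc: "\<And>t. t \<in> E \<Longrightarrow> D 1 t * D 3 t - (D 2 t)\<^sup>2 \<le> 0"
  shows "distortion_bound D E 0"
proof (rule distortion_boundI[where \<theta> = "\<lambda>t. 0"])
  fix x y assume xy: "x \<in> E" "y \<in> E" "x < y"
  have sub: "{x..y} \<subseteq> E" by (rule interval_Icc_subset[OF E xy(1,2)])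
  define \<phi> v where "\<phi> = (\<lambda>t. ln \<bar>D 1 t\<bar>)" and "v = (\<lambda>t. D 2 t / D 1 t)"
  have anti: "v t \<le> v s" if st: "s \<in> {x..y}" "t \<in> {x..y}" and lt: "s < t" for s t
  proof -
    have stE: "s \<in> E" "t \<in> E" using st  sub by auto
    obtain z where z: "s < z" "z < t" "v t - v s = (t - s) * ((D 1 z * D 3 z - (D 2 z)\<^sup>2) / (D 1 z)\<^sup>2)"
      unfolding v_def using log_deriv_mvt[OF D E nz stE lt] by blast
    have "z \<in> E" using interval_Icc_subset[OF E stE] z by auto
    then have "(D 1 z * D 3 z - (D 2 z)\<^sup>2) / (D 1 z)\<^sup>2 \<le> 0"
      using conc by (simp add: divide_nonpos_nonneg)
    then have "(t - s) * ((D 1 z * D 3 z - (D 2 z)\<^sup>2) / (D 1 z)\<^sup>2) \<le> 0"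
      using lt by (intro mult_nonneg_nonpos) auto
    then show ?thesis using z(3) by linarith
  qed
  have mvt: "\<exists>z. s < z \<and> z < t \<and> \<phi> t - \<phi> s = (t - s) * v z"
    if st: "s \<in> {x..y}" "t \<in> {x..y}" and lt: "s < t" for s t
  proof -
    have stE: "s \<in> E" "t \<in> E" using st  sub by auto
    from log_mvt[OF D E nz stE lt] show ?thesis by (simp add: v_def \<phi>_def)
  qed
  have half: "\<phi> x + \<phi> y \<le> \<phi> z + \<phi> (x + y - z)" if z: "x < z" "z \<le> x + y - z" for z
  proof -
    have in1: "x \<in> {x..y}" "z \<in> {x..y}" "x + y - z \<in> {x..y}" "y \<in> {x..y}" using z xy(3) by auto
    obtain a where a: "x < a" "a < z" "\<phi> z - \<phi> x = (z - x) * v a" using mvt[OF in1(1,2) z(1)] by blast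
    obtain b where b: "x + y - z < b" "b < y" "\<phi> y - \<phi> (x + y - z) = (y - (x + y - z)) * v b"
      using mvt[OF in1(3,4)] z(1) by auto
    have "v b \<le> v a" using a b z by (intro anti) auto
    then have "(z - x) * v b \<le> (z - x) * v a" using z(1) by (intro mult_left_mono) auto
    then show ?thesis using a(3) b(3) by simp
  qed
  have pair: "\<phi> x + \<phi> y \<le> \<phi> z + \<phi> (x + y - z)" if z: "x < z" "z < y" for z
    using half[of z] half[of "x + y - z"] z by (cases "z \<le> x + y - z") (auto simp: add.commute)
  have pos: "\<bar>D 1 s\<bar> > 0" if "s \<in> {x..y}" for s using nz sub that by auto
  define s where "s = sqrt \<bar>D 1 x * D 1 y\<bar>"
  have sum_ge: "2 * s \<le> \<bar>D 1 z\<bar> + \<bar>D 1 (x + y - z)\<bar>" if z: "x < z" "z < y" for z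
  proof -
    have p: "\<bar>D 1 x\<bar> > 0" "\<bar>D 1 y\<bar> > 0" "\<bar>D 1 z\<bar> > 0" "\<bar>D 1 (x + y - z)\<bar> > 0" using pos z xy(3) by auto
    have "ln (\<bar>D 1 x\<bar> * \<bar>D 1 y\<bar>) \<le> ln (\<bar>D 1 z\<bar> * \<bar>D 1 (x + y - z)\<bar>)"
      using pair[OF z] p by (simp add: ln_mult \<phi>_def)
    moreover have "0 < \<bar>D 1 x\<bar> * \<bar>D 1 y\<bar>" "0 < \<bar>D 1 z\<bar> * \<bar>D 1 (x + y - z)\<bar>"
      using p by (simp_all del: zero_less_abs_iff)
    ultimately have "\<bar>D 1 x\<bar> * \<bar>D 1 y\<bar> \<le> \<bar>D 1 z\<bar> * \<bar>D 1 (x + y - z)\<bar>" using ln_le_cancel_iff by blast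
    then have "s \<le> sqrt (\<bar>D 1 z\<bar> * \<bar>D 1 (x + y - z)\<bar>)" by (simp add: s_def abs_mult)
    also have "\<dots> \<le> (\<bar>D 1 z\<bar> + \<bar>D 1 (x + y - z)\<bar>) / 2" by (rule arith_geo_mean_sqrt) auto
    finally show ?thesis by simp
  qed
  have cont: "continuous_on {x..y} (D k)" for k
    using deriv_seq_continuous[OF deriv_seq_subset[OF D sub]] .
  have sgn: "(\<forall>t\<in>{x..y}. D 1 t > 0) \<or> (\<forall>t\<in>{x..y}. D 1 t < 0)"
  proof (rule ccontr)
    assume "\<not> ?thesis"
    then obtain a b where ab: "a \<in> {x..y}" "b \<in> {x..y}" "D 1 a \<le> 0" "0 \<le> D 1 b" by (auto simp: not_less)
    have "connected (D 1 ` {x..y})" by (rule connected_continuous_image[OF cont connected_Icc])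
    then have "0 \<in> D 1 ` {x..y}" using ab unfolding connected_iff_interval by blast
    then show False using nz sub by force
  qed
  define c where "c = (if D 1 x > 0 then 1 else -1 :: real)"
  have c: "\<bar>D 1 t\<bar> = c * D 1 t" if "t \<in> {x..y}" for t
  proof -
    have "x \<in> {x..y}" using xy(3) by simp
    from sgn show ?thesis
    proof
      assume "\<forall>t\<in>{x..y}. D 1 t > 0"
      with that \<open>x \<in> {x..y}\<close> have "D 1 t > 0" "D 1 x > 0" by blast+
      then show ?thesis by (simp add: c_def)
    next
      assume "\<forall>t\<in>{x..y}. D 1 t < 0"
      with that \<open>x \<in> {x..y}\<close> have "D 1 t < 0" "D 1 x < 0" by blast+
      then show ?thesis by (simp add: c_def)
    qed
  qed
  define H where "H = (\<lambda>z. c * (D 0 z - D 0 (x + y - z)) - 2 * s * z)"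
  have dH: "(H has_real_derivative \<bar>D 1 z\<bar> + \<bar>D 1 (x + y - z)\<bar> - 2 * s) (at z)" if z: "x < z" "z < y" for z
  proof -
    have d1: "(D 0 has_real_derivative D 1 z) (at z)" using deriv_seq_at[OF D sub z, of 0] by simp
    have "(D 0 has_real_derivative D 1 (x + y - z)) (at (x + y - z))"
      using deriv_seq_at[OF D sub, of "x + y - z" 0] z by simp
    moreover have "((\<lambda>z. x + y - z) has_real_derivative - 1) (at z)" by (auto intro!: derivative_eq_intros)
    ultimately have d2: "((\<lambda>z. D 0 (x + y - z)) has_real_derivative D 1 (x + y - z) * - 1) (at z)"
      by (rule DERIV_chain2)
    have "(H has_real_derivative c * (D 1 z - D 1 (x + y - z) * - 1) - 2 * s * 1) (at z)"
      unfolding H_def by (intro DERIV_diff DERIV_cmult d1 d2 DERIV_ident)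
    moreover have "z \<in> {x..y}" "x + y - z \<in> {x..y}" using z by auto
    then have "c * (D 1 z - D 1 (x + y - z) * - 1) - 2 * s * 1 = \<bar>D 1 z\<bar> + \<bar>D 1 (x + y - z)\<bar> - 2 * s"
      by (simp only: c) (simp add: distrib_left)
    ultimately show ?thesis by simp
  qed
  have "H x \<le> H y"
  proof (rule DERIV_nonneg_imp_increasing_open[of x y H])
    show "x \<le> y" using xy(3) by simp
    fix z assume z: "x < z" "z < y"
    from dH[OF z] sum_ge[OF z] show "\<exists>d. (H has_real_derivative d) (at z) \<and> d \<ge> 0" by fastforce
  next
    show "continuous_on {x..y} H"
      unfolding H_def
      by (intro continuous_intros cont continuous_on_compose2[OF cont[of 0], of _ "\<lambda>z. x + y - z"]) auto
  qed
  then have "s * (y - x) \<le> c * (D 0 y - D 0 x)" by (simp add: H_def algebra_simps)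
  moreover have "0 \<le> s * (y - x)" using xy(3) by (simp add: s_def)
  ultimately have "(s * (y - x))\<^sup>2 \<le> (c * (D 0 y - D 0 x))\<^sup>2" by (intro power_mono)
  moreover have "c\<^sup>2 = 1" by (simp add: c_def)
  moreover have "s\<^sup>2 = \<bar>D 1 x * D 1 y\<bar>" by (simp add: s_def)
  ultimately show "\<bar>D 1 x * D 1 y\<bar> * (y - x)\<^sup>2 \<le> exp (0 - 0) * (D 0 y - D 0 x)\<^sup>2"
    by (simp add: power_mult_distrib)
qed (auto simp: mono_on_def)

text \<open>Here \<open>\<phi> = log \<bar>D 1\<bar>\<close> is convex and monotone. Its variation over \<open>{x..y}\<close> is at most \<open>y - x\<close> times
  the slope at the end where \<open>\<bar>D 1\<bar>\<close> is largest. At this end the oscillation is at most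
  \<open>\<bar>D 1\<bar> * (y - x)\<close>, so the Markov bound for \<open>D 2\<close> shows that the slope is at most \<open>C / (y - x)\<close>. Thus
  \<open>\<phi>\<close> or \<open>- \<phi>\<close> has variation at most \<open>C\<close> on the whole piece.\<close>

lemma distortion_bound_convex:
  assumes D: "deriv_seq E D" and E: "is_interval E" and nz: "\<And>s. s \<in> E \<Longrightarrow> D 1 s \<noteq> 0" "\<And>s. s \<in> E \<Longrightarrow> D 2 s \<noteq> 0"
    and conv: "\<And>t. t \<in> E \<Longrightarrow> D 1 t * D 3 t - (D 2 t)\<^sup>2 \<ge> 0"
    and C: "C \<ge> 0" and markov: "\<And>x y \<omega> t. x < y \<Longrightarrow> {x..y} \<subseteq> E \<Longrightarrow> osc_le (D 0) {x..y} \<omega> \<Longrightarrow> t \<in> {x..y} \<Longrightarrow>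
       \<bar>D 2 t\<bar> * (y - x)\<^sup>2 \<le> C * \<omega>"
  shows "distortion_bound D E C"
proof -
  define \<phi> v where "\<phi> = (\<lambda>t. ln \<bar>D 1 t\<bar>)" and "v = (\<lambda>t. D 2 t / D 1 t)"
  have mono: "v s \<le> v t" if st: "s \<in> E" "t \<in> E" and lt: "s < t" for s t
  proof -
    have stE: "s \<in> E" "t \<in> E" using st by auto
    obtain z where z: "s < z" "z < t" "v t - v s = (t - s) * ((D 1 z * D 3 z - (D 2 z)\<^sup>2) / (D 1 z)\<^sup>2)"
      unfolding v_def using log_deriv_mvt[OF D E nz(1) stE lt] by blast
    have "z \<in> E" using interval_Icc_subset[OF E stE] z by auto
    then have "(D 1 z * D 3 z - (D 2 z)\<^sup>2) / (D 1 z)\<^sup>2 \<ge> 0" using conv by simp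
    then have "(t - s) * ((D 1 z * D 3 z - (D 2 z)\<^sup>2) / (D 1 z)\<^sup>2) \<ge> 0"
      using lt by (intro mult_nonneg_nonneg) auto
    then show ?thesis using z(3) by linarith
  qed
  have mvt: "\<exists>z. s < z \<and> z < t \<and> \<phi> t - \<phi> s = (t - s) * v z"
    if st: "s \<in> E" "t \<in> E" and lt: "s < t" for s t
  proof -
    have stE: "s \<in> E" "t \<in> E" using st by auto
    from log_mvt[OF D E nz(1) stE lt] show ?thesis by (simp add: v_def \<phi>_def)
  qed
  have v0: "v t \<noteq> 0" if "t \<in> E" for t using nz that by (simp add: v_def)
  have contv: "continuous_on E v"
    unfolding v_def by (intro continuous_intros deriv_seq_continuous[OF D]) (use nz in auto)
  have sgn: "(\<forall>t\<in>E. v t > 0) \<or> (\<forall>t\<in>E. v t < 0)"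
  proof (rule ccontr)
    assume "\<not> ?thesis"
    then obtain a b where ab: "a \<in> E" "b \<in> E" "v a \<le> 0" "0 \<le> v b" by (auto simp: not_less)
    have "connected (v ` E)"
      by (rule connected_continuous_image[OF contv]) (use E in \<open>simp add: is_interval_connected\<close>)
    then have "0 \<in> v ` E" using ab unfolding connected_iff_interval by blast
    then show False using v0 by force
  qed
  have pos: "\<bar>D 1 s\<bar> > 0" if "s \<in> E" for s using nz that by auto
  have exp_phi: "exp (\<phi> s) = \<bar>D 1 s\<bar>" if "s \<in> E" for s using pos[OF that] by (simp add: \<phi>_def)
  \<comment> \<open>the logarithmic derivative at an endpoint where \<open>\<bar>D 1\<bar>\<close> is largest\<close>
  have top: "(y - x) * \<bar>v e\<bar> \<le> C"
    if xy: "x \<in> E" "y \<in> E" "x < y" and e: "e \<in> {x..y}" and max: "\<And>z. z \<in> {x..y} \<Longrightarrow> \<bar>D 1 z\<bar> \<le> \<bar>D 1 e\<bar>" for x y e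
  proof -
    have sub: "{x..y} \<subseteq> E" by (rule interval_Icc_subset[OF E xy(1,2)])
    have "osc_le (D 0) {x..y} (\<bar>D 1 e\<bar> * (y - x))"
      unfolding osc_le_def
    proof (intro ballI)
      fix s t assume st: "s \<in> {x..y}" "t \<in> {x..y}"
      then have seg: "closed_segment t s \<subseteq> {x..y}" by (auto simp: closed_segment_eq_real_ivl)
      have "\<bar>D 0 s - D 0 t\<bar> \<le> \<bar>D 1 e\<bar> * \<bar>s - t\<bar>"
        by (rule deriv_seq_lipschitz[OF deriv_seq_subset[OF D sub] seg]) (use max seg in auto)
      also have "\<dots> \<le> \<bar>D 1 e\<bar> * (y - x)" using st by (intro mult_left_mono) auto
      finally show "\<bar>D 0 s - D 0 t\<bar> \<le> \<bar>D 1 e\<bar> * (y - x)" .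
    qed
    from markov[OF xy(3) sub this e] have "\<bar>D 2 e\<bar> * (y - x) * (y - x) \<le> C * \<bar>D 1 e\<bar> * (y - x)"
      by (simp add: power2_eq_square mult.assoc)
    then have "\<bar>D 2 e\<bar> * (y - x) \<le> C * \<bar>D 1 e\<bar>" using xy(3) by simp
    moreover have "\<bar>D 1 e\<bar> > 0" using pos sub e by auto
    ultimately show ?thesis by (simp add: v_def pos_divide_le_eq mult.commute)
  qed
  obtain \<sigma> :: real where \<sigma>: "\<sigma> = 1 \<or> \<sigma> = - 1" "\<And>t. t \<in> E \<Longrightarrow> \<sigma> * v t > 0"
  proof (cases "\<forall>t\<in>E. v t > 0")
    case True then show ?thesis by (intro that[of 1]) auto
  next
    case False then show ?thesis using sgn by (intro that[of "- 1"]) auto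
  qed
  show ?thesis
  proof (rule distortion_boundI[where \<theta> = "\<lambda>t. \<sigma> * \<phi> t"])
    show inc: "mono_on E (\<lambda>t. \<sigma> * \<phi> t)"
    proof (rule mono_onI)
      fix s t assume st: "s \<in> E" "t \<in> E" and le: "s \<le> t"
      show "\<sigma> * \<phi> s \<le> \<sigma> * \<phi> t"
      proof (cases "s = t")
        case False
        then obtain z where z: "s < z" "z < t" "\<phi> t - \<phi> s = (t - s) * v z" using mvt[OF st] le by auto
        have "z \<in> E" using interval_Icc_subset[OF E st] z by auto
        then have "(t - s) * (\<sigma> * v z) \<ge> 0" using \<sigma>(2) le by (simp add: less_imp_le)
        moreover have "\<sigma> * \<phi> t - \<sigma> * \<phi> s = (t - s) * (\<sigma> * v z)"
          unfolding right_diff_distrib[symmetric] z(3) by simp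
        ultimately show ?thesis by linarith
      qed simp
    qed
    show "0 \<le> C" by (rule C)
    fix x y assume xy: "x \<in> E" "y \<in> E" "x < y"
    have sub: "{x..y} \<subseteq> E" by (rule interval_Icc_subset[OF E xy(1,2)])
    \<comment> \<open>\<open>\<bar>D 1\<bar>\<close> is largest at \<open>e\<close> and smallest at \<open>e'\<close>\<close>
    define e e' where "e = (if \<sigma> = 1 then y else x)" and "e' = (if \<sigma> = 1 then x else y)"
    have e: "e \<in> {x..y}" "e' \<in> {x..y}" "e \<in> E" "e' \<in> E" using xy by (auto simp: e_def e'_def)
    have bounds: "\<bar>D 1 e'\<bar> \<le> \<bar>D 1 z\<bar> \<and> \<bar>D 1 z\<bar> \<le> \<bar>D 1 e\<bar>" if z: "z \<in> {x..y}" for z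
    proof -
      have zE: "z \<in> E" using z sub by blast
      have "\<sigma> * \<phi> x \<le> \<sigma> * \<phi> z" "\<sigma> * \<phi> z \<le> \<sigma> * \<phi> y"
        using mono_onD[OF inc xy(1) zE] mono_onD[OF inc zE xy(2)] z by auto
      then have "\<phi> e' \<le> \<phi> z" "\<phi> z \<le> \<phi> e" using \<sigma>(1) by (auto simp: e_def e'_def)
      then show ?thesis using exp_phi[OF zE] exp_phi[OF e(3)] exp_phi[OF e(4)] by (metis exp_le_cancel_iff)
    qed
    obtain z where z: "x < z" "z < y" "\<phi> y - \<phi> x = (y - x) * v z" using mvt[OF xy] by blast
    have zE: "z \<in> E" using sub z by auto
    have "\<sigma> * v z \<le> \<bar>v e\<bar>"
      using \<sigma>(1) mono[OF zE xy(2) z(2)] mono[OF xy(1) zE z(1)] by (auto simp: e_def)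
    then have "(y - x) * (\<sigma> * v z) \<le> (y - x) * \<bar>v e\<bar>" using xy(3) by (intro mult_left_mono) auto
    also have "\<dots> \<le> C" by (rule top[OF xy e(1)]) (use bounds in blast)
    finally have "\<sigma> * (\<phi> y - \<phi> x) \<le> C" using z(3) by (simp add: mult_ac)
    then show "\<sigma> * \<phi> y - \<sigma> * \<phi> x \<le> C" by (simp add: right_diff_distrib)
    have diff: "\<sigma> * \<phi> y - \<sigma> * \<phi> x = \<phi> e - \<phi> e'" using \<sigma>(1) by (auto simp: e_def e'_def)
    have "\<bar>D 1 e'\<bar>\<^sup>2 * (y - x)\<^sup>2 \<le> (D 0 y - D 0 x)\<^sup>2"
      by (rule sq_increment_ge[OF D sub xy(3)]) (use bounds in auto)
    then have "exp (\<phi> e - \<phi> e') * (\<bar>D 1 e'\<bar>\<^sup>2 * (y - x)\<^sup>2) \<le> exp (\<phi> e - \<phi> e') * (D 0 y - D 0 x)\<^sup>2"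
      by (rule mult_left_mono) simp
    moreover have "exp (\<phi> e - \<phi> e') * (\<bar>D 1 e'\<bar>\<^sup>2 * (y - x)\<^sup>2) = \<bar>D 1 e * D 1 e'\<bar> * (y - x)\<^sup>2"
      unfolding exp_diff exp_phi[OF e(3)] exp_phi[OF e(4)] abs_mult
      using pos[OF e(4)] by (simp add: power2_eq_square divide_simps del: abs_mult_self_eq)
    moreover have "D 1 e * D 1 e' = D 1 x * D 1 y" by (simp add: e_def e'_def)
    ultimately show "\<bar>D 1 x * D 1 y\<bar> * (y - x)\<^sup>2 \<le> exp (\<sigma> * \<phi> y - \<sigma> * \<phi> x) * (D 0 y - D 0 x)\<^sup>2"
      unfolding diff by (simp only:)
  qed
qed

section \<open>Families of intervals of bounded multiplicity\<close>

text \<open>The sum of the increments is the integral over the level \<open>s\<close> of the number of intervals on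
  which \<open>\<psi>\<close> passes \<open>s\<close>. All these intervals contain the first point where \<open>\<psi>\<close> reaches \<open>s\<close>, so there
  are at most \<open>N\<close> of them, also when \<open>\<psi>\<close> has jumps.\<close>

lemma sum_increments_le:
  fixes \<psi> :: "real \<Rightarrow> real"
  assumes K: "finite K" and E: "is_interval E" and \<psi>: "mono_on E \<psi>" "\<And>t. t \<in> E \<Longrightarrow> 0 \<le> \<psi> t \<and> \<psi> t \<le> C"
    and x: "\<And>k. k \<in> K \<Longrightarrow> x k \<in> E \<and> y k \<in> E \<and> x k \<le> y k"
    and N: "\<And>t. card {k\<in>K. x k \<le> t \<and> t \<le> y k} \<le> N" and C: "C \<ge> 0"
  shows "(\<Sum>k\<in>K. \<psi> (y k) - \<psi> (x k)) \<le> N * C"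
proof -
  let ?I = "\<lambda>k. indicat_real {\<psi> (x k)<..<\<psi> (y k)}"
  have le: "\<psi> (x k) \<le> \<psi> (y k)" if "k \<in> K" for k using x[OF that] mono_onD[OF \<psi>(1)] by blast
  have "(\<Sum>k\<in>K. \<psi> (y k) - \<psi> (x k)) = (\<Sum>k\<in>K. LINT s|lborel. ?I k s)"
    by (intro sum.cong refl) (use le in simp)
  also have "\<dots> = (LINT s|lborel. (\<Sum>k\<in>K. ?I k s))"
    by (rule Bochner_Integration.integral_sum[symmetric]) (use le in simp)
  also have "\<dots> \<le> (LINT s|lborel. N * indicat_real {0..C} s)"
  proof (rule integral_mono)
    fix s :: real
    have Ik: "?I k s = (if \<psi> (x k) < s \<and> s < \<psi> (y k) then 1 else 0)" for k by (simp add: indicator_def)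
    have sum: "(\<Sum>k\<in>K. ?I k s) = card {k\<in>K. \<psi> (x k) < s \<and> s < \<psi> (y k)}"
      using K by (simp add: Ik sum.If_cases Int_def)
    show "(\<Sum>k\<in>K. ?I k s) \<le> N * indicat_real {0..C} s"
    proof (cases "{k\<in>K. \<psi> (x k) < s \<and> s < \<psi> (y k)} = {}")
      case True
      then have "card {k\<in>K. \<psi> (x k) < s \<and> s < \<psi> (y k)} = 0" by (simp only: card.empty)
      then show ?thesis unfolding sum by simp
    next
      case False
      then obtain k0 where k0: "k0 \<in> K" "\<psi> (x k0) < s" "s < \<psi> (y k0)" by blast
      have s: "s \<in> {0..C}" using \<psi>(2)[of "x k0"] \<psi>(2)[of "y k0"] x[OF k0(1)] k0 by auto
      \<comment> \<open>the first time at which \<open>\<psi>\<close> reaches the level \<open>s\<close> lies in all these intervals\<close>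
      define A where "A = {t\<in>E. s \<le> \<psi> t}"
      have lower: "x k \<le> t" if "k \<in> K" "\<psi> (x k) < s" "t \<in> A" for k t
      proof (rule ccontr)
        assume "\<not> x k \<le> t"
        then have "\<psi> t \<le> \<psi> (x k)" using mono_onD[OF \<psi>(1), of t "x k"] x[OF that(1)] that(3) by (simp add: A_def)
        then show False using that by (simp add: A_def)
      qed
      have mem: "y k \<in> A" if "k \<in> K" "s < \<psi> (y k)" for k using x[OF that(1)] that(2) by (simp add: A_def)
      have ne: "A \<noteq> {}" using mem[OF k0(1,3)] by blast
      have bdd: "bdd_below A" by (rule bdd_belowI[of _ "x k0"]) (rule lower[OF k0(1,2)])
      have "{k\<in>K. \<psi> (x k) < s \<and> s < \<psi> (y k)} \<subseteq> {k\<in>K. x k \<le> Inf A \<and> Inf A \<le> y k}"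
        using lower mem cInf_greatest[OF ne] cInf_lower[OF _ bdd] by blast
      then have "card {k\<in>K. \<psi> (x k) < s \<and> s < \<psi> (y k)} \<le> card {k\<in>K. x k \<le> Inf A \<and> Inf A \<le> y k}"
        using K by (intro card_mono) auto
      then have "card {k\<in>K. \<psi> (x k) < s \<and> s < \<psi> (y k)} \<le> N" using N[of "Inf A"] by linarith
      then show ?thesis unfolding sum using s by simp
    qed
  qed (use le C in \<open>auto intro!: Bochner_Integration.integrable_sum\<close>)
  also have "\<dots> = N * (LINT s|lborel. indicat_real {0..C} s)" by (rule integral_mult_right_zero)
  also have "\<dots> = N * C" using C by simp
  finally show ?thesis .
qed

definition distortion_at_most :: "(nat \<Rightarrow> real \<Rightarrow> real) \<Rightarrow> real set \<Rightarrow> real \<Rightarrow> bool" where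
  "distortion_at_most D T \<eta> \<longleftrightarrow> (\<forall>x\<in>T. \<forall>y\<in>T. x < y \<longrightarrow>
      \<bar>D 1 x * D 1 y\<bar> * (y - x)\<^sup>2 \<le> exp \<eta> * (D 0 y - D 0 x)\<^sup>2)"

text \<open>The loss \<open>\<eta> k\<close> is the supremum of the increments of \<open>\<psi>\<close> inside \<open>T k\<close>. It need not be attained; a
  pair of points that realises half of it gives a closed subinterval to which
  \<open>sum_increments_le\<close> applies, whence the factor \<open>2\<close>.\<close>

lemma distortion_sum_on_piece:
  assumes K: "finite K" and E: "is_interval E" and dist: "distortion_bound D E C" and C: "C \<ge> 0"
    and T: "\<And>k. k \<in> K \<Longrightarrow> T k \<noteq> {} \<and> is_interval (T k) \<and> T k \<subseteq> E"
    and N: "\<And>t. card {k\<in>K. t \<in> T k} \<le> N"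
  shows "\<exists>\<eta>. (\<forall>k\<in>K. 0 \<le> \<eta> k \<and> distortion_at_most D (T k) (\<eta> k)) \<and> sum \<eta> K \<le> 2 * N * C"
proof -
  obtain \<psi> where mono: "mono_on E \<psi>" and \<psi>: "\<And>t. t \<in> E \<Longrightarrow> 0 \<le> \<psi> t \<and> \<psi> t \<le> C"
    and le: "\<And>x y. x \<in> E \<Longrightarrow> y \<in> E \<Longrightarrow> x < y \<Longrightarrow>
      \<bar>D 1 x * D 1 y\<bar> * (y - x)\<^sup>2 \<le> exp (\<psi> y - \<psi> x) * (D 0 y - D 0 x)\<^sup>2"
    using dist unfolding distortion_bound_def by blast
  define V where "V k = {\<psi> y - \<psi> x |x y. x \<in> T k \<and> y \<in> T k \<and> x \<le> y}" for k
  define \<eta> where "\<eta> k = Sup (V k)" for k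
  have bdd: "bdd_above (V k)" if "k \<in> K" for k
  proof (rule bdd_aboveI[of _ C])
    fix a assume "a \<in> V k"
    then obtain x y where "x \<in> T k" "y \<in> T k" "a = \<psi> y - \<psi> x" by (auto simp: V_def)
    moreover have "x \<in> E" "y \<in> E" using T[OF that] \<open>x \<in> T k\<close> \<open>y \<in> T k\<close> by blast+
    ultimately show "a \<le> C" using \<psi>[of x] \<psi>[of y] by linarith
  qed
  have upper: "\<psi> y - \<psi> x \<le> \<eta> k" if "k \<in> K" "x \<in> T k" "y \<in> T k" "x \<le> y" for k x y
    unfolding \<eta>_def by (rule cSup_upper[OF _ bdd[OF that(1)]]) (use that in \<open>auto simp: V_def\<close>)
  have \<eta>0: "0 \<le> \<eta> k" if k: "k \<in> K" for k
  proof -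
    obtain t where "t \<in> T k" using T[OF k] by blast
    from upper[OF k this this] show ?thesis by simp
  qed
  have "\<exists>x y. x \<in> T k \<and> y \<in> T k \<and> x \<le> y \<and> \<eta> k \<le> 2 * (\<psi> y - \<psi> x)" if k: "k \<in> K" for k
  proof (cases "\<eta> k = 0")
    case True
    obtain t where "t \<in> T k" using T[OF k] by blast
    then show ?thesis using True by (intro exI[of _ t]) simp
  next
    case False
    then have "\<eta> k / 2 < Sup (V k)" using \<eta>0[OF k] by (simp add: \<eta>_def)
    moreover have "V k \<noteq> {}" using T[OF k] by (auto simp: V_def)
    ultimately obtain v where "v \<in> V k" "\<eta> k / 2 < v" by (meson less_cSupD)
    then obtain x y where "x \<in> T k" "y \<in> T k" "x \<le> y" "\<eta> k / 2 < \<psi> y - \<psi> x" by (auto simp: V_def)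
    then show ?thesis by (intro exI[of _ x] exI[of _ y]) simp
  qed
  then obtain x y where xy: "\<And>k. k \<in> K \<Longrightarrow> x k \<in> T k \<and> y k \<in> T k \<and> x k \<le> y k \<and> \<eta> k \<le> 2 * (\<psi> (y k) - \<psi> (x k))"
    by metis
  have "(\<Sum>k\<in>K. \<psi> (y k) - \<psi> (x k)) \<le> N * C"
  proof (rule sum_increments_le[OF K E mono \<psi> _ _ C])
    fix k assume "k \<in> K" then show "x k \<in> E \<and> y k \<in> E \<and> x k \<le> y k" using xy T by blast
  next
    fix t
    have "t \<in> T k" if "k \<in> K" "x k \<le> t" "t \<le> y k" for k
    proof -
      have "{x k..y k} \<subseteq> T k" using xy[OF that(1)] T[OF that(1)] by (intro interval_Icc_subset) auto
      then show ?thesis using that by auto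
    qed
    then have "card {k \<in> K. x k \<le> t \<and> t \<le> y k} \<le> card {k\<in>K. t \<in> T k}"
      using K by (intro card_mono) auto
    then show "card {k \<in> K. x k \<le> t \<and> t \<le> y k} \<le> N" using N[of t] by linarith
  qed
  moreover have "sum \<eta> K \<le> 2 * (\<Sum>k\<in>K. \<psi> (y k) - \<psi> (x k))"
    unfolding sum_distrib_left using xy by (intro sum_mono) blast
  ultimately have sum: "sum \<eta> K \<le> 2 * N * C" by simp
  show ?thesis
    unfolding distortion_at_most_def
  proof (intro exI[of _ \<eta>] conjI ballI impI sum)
    fix k a b assume k: "k \<in> K" and a: "a \<in> T k" and b: "b \<in> T k" and ab: "a < b"
    have "\<bar>D 1 a * D 1 b\<bar> * (b - a)\<^sup>2 \<le> exp (\<psi> b - \<psi> a) * (D 0 b - D 0 a)\<^sup>2"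
      using T[OF k] a b by (intro le ab) auto
    also have "\<dots> \<le> exp (\<eta> k) * (D 0 b - D 0 a)\<^sup>2"
      using upper[OF k a b] ab by (intro mult_right_mono) auto
    finally show "\<bar>D 1 a * D 1 b\<bar> * (b - a)\<^sup>2 \<le> exp (\<eta> k) * (D 0 b - D 0 a)\<^sup>2" .
  qed (rule \<eta>0)
qed

text \<open>The pieces are the components of the complement of \<open>Z\<close>, indexed by the set of points of \<open>Z\<close>
  below them; this crude indexing gives the factor \<open>2 ^ card Z\<close>.\<close>

lemma distortion_sum:
  assumes K: "finite K" and Z: "finite Z" and C: "C \<ge> 0"
    and dist: "\<And>E. is_interval E \<Longrightarrow> E \<subseteq> {lo..hi} \<Longrightarrow> E \<inter> Z = {} \<Longrightarrow> distortion_bound D E C"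
    and T: "\<And>k. k \<in> K \<Longrightarrow> T k \<noteq> {} \<and> is_interval (T k) \<and> T k \<subseteq> {lo..hi} \<and> T k \<inter> Z = {}"
    and N: "\<And>t. card {k\<in>K. t \<in> T k} \<le> N"
  shows "\<exists>\<eta>. (\<forall>k\<in>K. 0 \<le> \<eta> k \<and> distortion_at_most D (T k) (\<eta> k)) \<and> sum \<eta> K \<le> 2 ^ card Z * (2 * N * C)"
proof -
  define below where "below t = {z\<in>Z. z < t}" for t :: real
  define piece where "piece S = {t\<in>{lo..hi}. t \<notin> Z \<and> below t = S}" for S
  define cls where "cls k = below (SOME t. t \<in> T k)" for k
  have piece: "is_interval (piece S)" for S
    unfolding is_interval_1
  proof (intro ballI allI impI)
    fix a b t assume ab: "a \<in> piece S" "b \<in> piece S" and t: "a \<le> t \<and> t \<le> b"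
    have "below a \<subseteq> below t" "below t \<subseteq> below b" using t by (auto simp: below_def)
    then have bt: "below t = S" using ab by (auto simp: piece_def)
    have "t \<notin> Z"
    proof
      assume tZ: "t \<in> Z"
      then have "t \<noteq> b" "t \<noteq> a" using ab by (auto simp: piece_def)
      then have "t \<in> below b" "t \<notin> below a" using t tZ by (auto simp: below_def)
      then show False using ab by (auto simp: piece_def)
    qed
    then show "t \<in> piece S" using bt ab t by (auto simp: piece_def)
  qed
  have sub: "T k \<subseteq> piece (cls k)" if k: "k \<in> K" for k
  proof
    fix t assume t: "t \<in> T k"
    define s where "s = (SOME t. t \<in> T k)"
    have s: "s \<in> T k" using t unfolding s_def by (rule someI)
    have notbetween: False if ab: "a \<in> T k" "b \<in> T k" and z: "z \<in> Z" "a \<le> z" "z \<le> b" for a b z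
    proof -
      have "is_interval (T k)" using T[OF k] by blast
      from interval_Icc_subset[OF this ab] z have "z \<in> T k" by auto
      then show False using T[OF k] z(1) by blast
    qed
    have "z < t \<longleftrightarrow> z < s" if "z \<in> Z" for z
      using notbetween[OF t s that] notbetween[OF s t that] by (meson linorder_not_less less_imp_le)
    then have "below t = below s" by (auto simp: below_def)
    then show "t \<in> piece (cls k)" using t T[OF k] by (auto simp: piece_def cls_def s_def)
  qed
  have "\<exists>\<eta>. (\<forall>k\<in>{k\<in>K. cls k = S}. 0 \<le> \<eta> k \<and> distortion_at_most D (T k) (\<eta> k)) \<and> sum \<eta> {k\<in>K. cls k = S} \<le> 2 * N * C" for S
  proof (rule distortion_sum_on_piece[OF _ piece _ C])
    show "distortion_bound D (piece S) C" by (rule dist[OF piece]) (auto simp: piece_def)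
    fix t
    have "card {k \<in> {k \<in> K. cls k = S}. t \<in> T k} \<le> card {k\<in>K. t \<in> T k}" using K by (intro card_mono) auto
    then show "card {k \<in> {k \<in> K. cls k = S}. t \<in> T k} \<le> N" using N[of t] by linarith
  next
    fix k assume k: "k \<in> {k \<in> K. cls k = S}"
    then have kK: "k \<in> K" and "cls k = S" by auto
    with sub[OF kK] T[OF kK] show "T k \<noteq> {} \<and> is_interval (T k) \<and> T k \<subseteq> piece S" by blast
  qed (use K in auto)
  then have "\<forall>S. \<exists>\<eta>. (\<forall>k\<in>{k\<in>K. cls k = S}. 0 \<le> \<eta> k \<and> distortion_at_most D (T k) (\<eta> k)) \<and> sum \<eta> {k\<in>K. cls k = S} \<le> 2 * N * C"
    by blast
  from choice[OF this] obtain \<eta> where A: "\<forall>S. (\<forall>k\<in>{k\<in>K. cls k = S}. 0 \<le> \<eta> S k \<and> distortion_at_most D (T k) (\<eta> S k)) \<and> sum (\<eta> S) {k\<in>K. cls k = S} \<le> 2 * N * C"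
    by (rule exE)
  have \<eta>: "0 \<le> \<eta> (cls k) k \<and> distortion_at_most D (T k) (\<eta> (cls k) k)" if "k \<in> K" for k
    by (rule bspec[OF conjunct1[OF spec[OF A, of "cls k"]]]) (use that in simp)
  have sum: "sum (\<eta> S) {k\<in>K. cls k = S} \<le> 2 * N * C" for S by (rule conjunct2[OF spec[OF A, of S]])
  have "(\<Sum>k\<in>K. \<eta> (cls k) k) = (\<Sum>S\<in>Pow Z. \<Sum>k\<in>{k\<in>K. cls k = S}. \<eta> (cls k) k)"
    by (rule sum.group[symmetric]) (use K Z in \<open>auto simp: cls_def below_def\<close>)
  also have "\<dots> = (\<Sum>S\<in>Pow Z. sum (\<eta> S) {k\<in>K. cls k = S})" by (intro sum.cong) auto
  also have "\<dots> \<le> (\<Sum>S\<in>Pow Z. 2 * N * C)" by (intro sum_mono sum)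
  also have "\<dots> = 2 ^ card Z * (2 * N * C)" using Z by (simp add: card_Pow)
  finally have "(\<Sum>k\<in>K. \<eta> (cls k) k) \<le> 2 ^ card Z * (2 * N * C)" .
  then show ?thesis using \<eta> by (intro exI[of _ "\<lambda>k. \<eta> (cls k) k"]) simp
qed

section \<open>Cross ratios\<close>

text \<open>The integral of \<open>dx dy / (x - y)^2\<close> over \<open>{a..b} \<times> {c..d}\<close>.\<close>

definition cross_log :: "real \<Rightarrow> real \<Rightarrow> real \<Rightarrow> real \<Rightarrow> real" where
  "cross_log a b c d = ln ((c - a) * (d - b) / ((d - a) * (c - b)))"

lemma cross_log_reflect: "cross_log (-d) (-c) (-b) (-a) = cross_log a b c d"
  by (simp add: cross_log_def mult.commute add.commute)

lemma cross_log_expand: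
  assumes "a \<le> b" "b < c" "c \<le> d"
  shows "cross_log a b c d = (ln (d - b) - ln (d - a)) - (ln (c - b) - ln (c - a))"
  using assms by (simp add: cross_log_def ln_div ln_mult)

text \<open>The hypothesis \<open>ker\<close> compares the integrands of the two double integrals. The integrations over
  \<open>x\<close> in \<open>{a..b}\<close> and over \<open>y\<close> in \<open>{c..d}\<close> appear as the monotonicity of \<open>F\<close> and of \<open>G\<close>.\<close>

lemma cross_log_distortion:
  assumes abcd: "a \<le> b" "b < c" "c \<le> d" and cont: "continuous_on {a..d} h"
    and der: "\<And>x. a < x \<Longrightarrow> x < d \<Longrightarrow> (h has_real_derivative u x) (at x)"
    and mono: "\<And>x y. a \<le> x \<Longrightarrow> x < y \<Longrightarrow> y \<le> d \<Longrightarrow> h x < h y"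
    and ker: "\<And>x y. a < x \<Longrightarrow> x < y \<Longrightarrow> y < d \<Longrightarrow> u x * u y * (y - x)\<^sup>2 \<le> q * (h y - h x)\<^sup>2"
  shows "cross_log (h a) (h b) (h c) (h d) \<le> q * cross_log a b c d"
proof -
  have cont': "continuous_on S h" if "S \<subseteq> {a..d}" for S using continuous_on_subset[OF cont that] .
  have inner: "u y * (1 / (h y - h b) - 1 / (h y - h a)) \<le> q * (1 / (y - b) - 1 / (y - a))"
    if y: "b < y" "y < d" for y
  proof -
    define F where "F = (\<lambda>x. q / (y - x) - u y / (h y - h x))"
    have "F a \<le> F b"
    proof (rule DERIV_nonneg_imp_increasing_open[of a b F])
      show "a \<le> b" by (rule abcd(1))
      fix x assume x: "a < x" "x < b"
      have hp: "h y - h x > 0" using mono[of x y] x y by simp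
      have d: "(F has_real_derivative q / (y - x)\<^sup>2 - u x * u y / (h y - h x)\<^sup>2) (at x)"
        unfolding F_def using x y hp der[of x]
        by (auto intro!: derivative_eq_intros simp: power2_eq_square mult.commute)
      have "u x * u y / (h y - h x)\<^sup>2 \<le> q / (y - x)\<^sup>2"
        using ker[of x y] x y hp by (simp add: divide_le_eq le_divide_eq mult.commute)
      with d show "\<exists>d. (F has_real_derivative d) (at x) \<and> d \<ge> 0"
        by (metis diff_ge_0_iff_ge)
    next
      have "h y - h x \<noteq> 0" if "x \<in> {a..b}" for x using mono[of x y] that y by auto
      then show "continuous_on {a..b} F"
        unfolding F_def using y abcd by (intro continuous_intros cont') auto
    qed
    then show ?thesis by (simp add: F_def right_diff_distrib)
  qed
  define G where "G = (\<lambda>y. q * (ln (y - b) - ln (y - a)) - (ln (h y - h b) - ln (h y - h a)))"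
  have "G c \<le> G d"
  proof (rule DERIV_nonneg_imp_increasing_open[of c d G])
    show "c \<le> d" by (rule abcd(3))
    fix y assume y: "c < y" "y < d"
    have hp: "h y - h b > 0" "h y - h a > 0" using mono[of b y] mono[of a y] abcd y by simp_all
    have "(G has_real_derivative q * (1 / (y - b) - 1 / (y - a)) - (u y / (h y - h b) - u y / (h y - h a))) (at y)"
      unfolding G_def using y abcd hp der[of y]
      by (auto intro!: derivative_eq_intros)
    moreover have "u y / (h y - h b) - u y / (h y - h a) \<le> q * (1 / (y - b) - 1 / (y - a))"
      using inner[of y] y abcd by (simp add: right_diff_distrib)
    ultimately show "\<exists>d. (G has_real_derivative d) (at y) \<and> d \<ge> 0"
      by (metis diff_ge_0_iff_ge)
  next
    have "h y - h b > 0 \<and> h y - h a > 0" if "y \<in> {c..d}" for y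
      using mono[of b y] mono[of a y] that abcd by auto
    then show "continuous_on {c..d} G"
      unfolding G_def using abcd by (intro continuous_intros cont') (auto simp: less_imp_neq[THEN not_sym])
  qed
  moreover have "h a \<le> h b" "h b < h c" "h c \<le> h d"
    using mono[of a b] mono[of b c] mono[of c d] abcd by (auto simp: le_less)
  ultimately show ?thesis
    unfolding cross_log_expand[OF abcd] cross_log_expand[OF \<open>h a \<le> h b\<close> \<open>h b < h c\<close> \<open>h c \<le> h d\<close>]
    by (simp add: G_def right_diff_distrib)
qed

text \<open>With \<open>L\<close>, \<open>J\<close>, \<open>R\<close> the lengths of the three intervals, the cross ratio is
  \<open>1 + L * R / (J * (L + J + R))\<close>. The quotient increases with \<open>L\<close> and \<open>R\<close>, and it is at most
  \<open>min L R / J\<close>; this lemma and the next one use these two facts.\<close>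

lemma cross_log_ge:
  assumes "\<epsilon> > 0" "b < c" "\<epsilon> * (c - b) \<le> b - a" "\<epsilon> * (c - b) \<le> d - c"
  shows "ln (1 + \<epsilon>\<^sup>2 / (1 + 2 * \<epsilon>)) \<le> cross_log a b c d"
proof -
  define J L R where "J = c - b" "L = b - a" "R = d - c"
  have J: "J > 0" and L: "\<epsilon> * J \<le> L" and R: "\<epsilon> * J \<le> R" using assms by (auto simp: J_L_R_def)
  have L0: "L > 0" "R > 0" using J L R assms(1) by (metis less_le_trans mult_pos_pos)+
  have "\<epsilon>\<^sup>2 * (J * (L + J + R)) \<le> (1 + 2 * \<epsilon>) * (L * R)"
  proof -
    have a: "\<epsilon> * J * R \<le> L * R" "\<epsilon> * J * L \<le> R * L" "(\<epsilon> * J) * (\<epsilon> * J) \<le> L * R"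
      using L R L0 J assms(1) by (intro mult_mono mult_right_mono; simp)+
    have "\<epsilon>\<^sup>2 * (J * (L + J + R)) = \<epsilon> * (\<epsilon> * J * L) + (\<epsilon> * J) * (\<epsilon> * J) + \<epsilon> * (\<epsilon> * J * R)"
      by (simp add: algebra_simps power2_eq_square)
    also have "\<dots> \<le> \<epsilon> * (R * L) + L * R + \<epsilon> * (L * R)"
      using a assms(1) by (intro add_mono mult_left_mono) auto
    finally show ?thesis by (simp add: algebra_simps)
  qed
  then have "\<epsilon>\<^sup>2 / (1 + 2 * \<epsilon>) \<le> L * R / (J * (L + J + R))"
    using J L0 assms(1) by (simp add: divide_le_eq le_divide_eq mult.commute)
  moreover have "(c - a) * (d - b) / ((d - a) * (c - b)) = 1 + L * R / (J * (L + J + R))"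
  proof -
    have "c - a = L + J" "d - b = J + R" "d - a = L + J + R" "c - b = J" by (auto simp: J_L_R_def)
    moreover have "J * (L + J + R) \<noteq> 0" using J L0 by simp
    ultimately show ?thesis by (simp add: add_divide_eq_iff) (simp add: algebra_simps)?
  qed
  ultimately show ?thesis unfolding cross_log_def using assms(1) by (intro ln_mono) (auto simp: add_pos_nonneg)
qed

lemma space_of_cross_log:
  assumes "a \<le> b" "b < c" "c \<le> d" "ln (1 + r) \<le> cross_log a b c d" "r \<ge> 0"
  shows "r * (c - b) \<le> b - a" "r * (c - b) \<le> d - c"
proof -
  define J L R where "J = c - b" "L = b - a" "R = d - c"
  have J: "J > 0" and L0: "L \<ge> 0" and R0: "R \<ge> 0" using assms by (auto simp: J_L_R_def)
  have q: "(c - a) * (d - b) / ((d - a) * (c - b)) = 1 + L * R / (J * (L + J + R))"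
  proof -
    have "c - a = L + J" "d - b = J + R" "d - a = L + J + R" "c - b = J" by (auto simp: J_L_R_def)
    moreover have "J * (L + J + R) \<noteq> 0" using J L0 R0 by simp
    ultimately show ?thesis by (simp add: add_divide_eq_iff) (simp add: algebra_simps)?
  qed
  have "L * R / (J * (L + J + R)) \<ge> 0" using J L0 R0 by simp
  then have "1 + r \<le> 1 + L * R / (J * (L + J + R))"
    using assms(4,5) unfolding cross_log_def q by (subst (asm) ln_le_cancel_iff) auto
  then have "r * (J * (L + J + R)) \<le> L * R" using J L0 R0 by (simp add: le_divide_eq)
  moreover have "L * R \<le> L * (L + J + R)" "L * R \<le> R * (L + J + R)"
    using J L0 R0 by (simp_all add: algebra_simps)
  ultimately have "r * J * (L + J + R) \<le> L * (L + J + R)" "r * J * (L + J + R) \<le> R * (L + J + R)"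
    by (simp_all add: mult.assoc)
  moreover have "L + J + R > 0" using J L0 R0 by simp
  ultimately have "r * J \<le> L" "r * J \<le> R" by simp_all
  then show "r * (c - b) \<le> b - a" "r * (c - b) \<le> d - c" by (auto simp: J_L_R_def)
qed

section \<open>Uniform control near a map without flat points\<close>

text \<open>The three cases in which the distortion is controlled: \<open>log \<bar>D 1\<bar>\<close> is Lipschitz, concave, or convex
  and monotone.\<close>

definition tame_piece :: "real \<Rightarrow> (nat \<Rightarrow> real \<Rightarrow> real) \<Rightarrow> real set \<Rightarrow> bool" where
  "tame_piece C D E \<longleftrightarrow>
    (\<forall>t\<in>E. \<bar>D 2 t\<bar> \<le> C * \<bar>D 1 t\<bar>) \<or>
    (\<forall>t\<in>E. D 1 t * D 3 t - (D 2 t)\<^sup>2 \<le> 0) \<or>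
    (\<forall>t\<in>E. D 2 t \<noteq> 0 \<and> D 1 t * D 3 t - (D 2 t)\<^sup>2 \<ge> 0)"

text \<open>Order \<open>0\<close> is left out because lifts of a circle map are determined up to a constant only.\<close>

definition close_seq :: "real set \<Rightarrow> nat \<Rightarrow> (nat \<Rightarrow> real \<Rightarrow> real) \<Rightarrow> (nat \<Rightarrow> real \<Rightarrow> real) \<Rightarrow> bool" where
  "close_seq X n D E \<longleftrightarrow> (\<forall>j\<in>{1..n}. \<forall>t\<in>X. \<bar>D j t - E j t\<bar> < 1 / (real n + 1))"

lemma close_seq_mono: "close_seq X n D E \<Longrightarrow> m \<le> n \<Longrightarrow> close_seq X m D E"
  unfolding close_seq_def
proof (intro ballI)
  fix j t assume a: "\<forall>j\<in>{1..n}. \<forall>t\<in>X. \<bar>D j t - E j t\<bar> < 1 / (real n + 1)" and m: "m \<le> n" and j: "j \<in> {1..m}" and t: "t \<in> X"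
  have "\<bar>D j t - E j t\<bar> < 1 / (real n + 1)" using a m j t by auto
  also have "\<dots> \<le> 1 / (real m + 1)" using m by (intro divide_left_mono) auto
  finally show "\<bar>D j t - E j t\<bar> < 1 / (real m + 1)" .
qed

text \<open>A single number \<open>n\<close> serves as exponent, as constant and as bound for the size of \<open>Z\<close>. For
  the finitely many sets of a cover, one large number then replaces all of these.\<close>

definition local_control :: "real set \<Rightarrow> nat \<Rightarrow> (nat \<Rightarrow> real \<Rightarrow> real) \<Rightarrow> bool" where
  "local_control V n D \<longleftrightarrow>
    (\<forall>x y \<omega>. x < y \<longrightarrow> {x..y} \<subseteq> V \<longrightarrow> osc_le (D 0) {x..y} \<omega> \<longrightarrow> (y - x) ^ n \<le> n * \<omega>) \<and>
    (\<exists>Z. finite Z \<and> card Z \<le> n \<and> {t\<in>V. D 1 t = 0} \<subseteq> Z \<and>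
      (\<forall>E. is_interval E \<longrightarrow> E \<subseteq> V \<longrightarrow> E \<inter> Z = {} \<longrightarrow> tame_piece n D E))"

text \<open>The derivatives of \<open>u * u'' - u'^2\<close> for \<open>u = D 1\<close>, whose sign is that of the second derivative of
  \<open>log \<bar>u\<bar>\<close>.\<close>

definition log_convexity :: "(nat \<Rightarrow> real \<Rightarrow> real) \<Rightarrow> nat \<Rightarrow> real \<Rightarrow> real" where
  "log_convexity D k t =
    leibniz (\<lambda>i. D (i + 1)) (\<lambda>i. D (i + 3)) k t - leibniz (\<lambda>i. D (i + 2)) (\<lambda>i. D (i + 2)) k t"

lemma log_convexity_0: "log_convexity D 0 t = D 1 t * D 3 t - (D 2 t)\<^sup>2"
  by (simp add: log_convexity_def leibniz_def power2_eq_square)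

lemma deriv_seq_log_convexity: "deriv_seq X D \<Longrightarrow> deriv_seq X (log_convexity D)"
  unfolding log_convexity_def[abs_def]
  by (intro deriv_seq_diff deriv_seq_leibniz deriv_seq_tail)

text \<open>If \<open>u\<close> begins with \<open>c * x ^ m\<close>, then \<open>u * u'' - u'^2\<close> begins with \<open>- m * c^2 * x ^ (2 * m - 2)\<close>. In each of the two
  Leibniz sums only the summand in which both factors have order \<open>m\<close> survives, and their binomial
  coefficients differ because one of them is the central one.\<close>

lemma log_convexity_nonzero:
  assumes z: "\<And>j. 1 \<le> j \<Longrightarrow> j \<le> m \<Longrightarrow> E j p = 0" and m: "m \<ge> 1" and nz: "E (Suc m) p \<noteq> 0"
  shows "log_convexity E (2 * m - 2) p \<noteq> 0"
proof -
  define K a where "K = 2 * m - 2" and "a = E (Suc m) p"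
  have "leibniz (\<lambda>i. E (i + 1)) (\<lambda>i. E (i + 3)) K p = (\<Sum>i\<le>K. if i = m then real (K choose m) * a\<^sup>2 else 0)"
    unfolding leibniz_def
  proof (rule sum.cong[OF refl])
    fix i assume i: "i \<in> {..K}"
    consider "i < m" | "i = m" | "i > m" by linarith
    then show "real (K choose i) * E (i + 1) p * E (K - i + 3) p = (if i = m then real (K choose m) * a\<^sup>2 else 0)"
    proof cases
      case 1 then show ?thesis using z[of "i + 1"] by simp
    next
      case 2
      then have "K - i + 3 = Suc m" "i + 1 = Suc m" using i m by (auto simp: K_def)
      then show ?thesis using 2 by (simp only: a_def power2_eq_square) simp
    next
      case 3
      then have "1 \<le> K - i + 3" "K - i + 3 \<le> m" using i m by (auto simp: K_def)
      from z[OF this] show ?thesis using 3 by simp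
    qed
  qed
  also have "\<dots> = real (K choose m) * a\<^sup>2" by (simp add: not_le)
  finally have 1: "leibniz (\<lambda>i. E (i + 1)) (\<lambda>i. E (i + 3)) K p = real (K choose m) * a\<^sup>2" .
  have "leibniz (\<lambda>i. E (i + 2)) (\<lambda>i. E (i + 2)) K p = (\<Sum>i\<le>K. if i = m - 1 then real (K choose (m - 1)) * a\<^sup>2 else 0)"
    unfolding leibniz_def
  proof (rule sum.cong[OF refl])
    fix i assume i: "i \<in> {..K}"
    consider "i < m - 1" | "i = m - 1" | "i > m - 1" by linarith
    then show "real (K choose i) * E (i + 2) p * E (K - i + 2) p = (if i = m - 1 then real (K choose (m - 1)) * a\<^sup>2 else 0)"
    proof cases
      case 1 then show ?thesis using z[of "i + 2"] by simp
    next
      case 2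
      then have "K - i + 2 = Suc m" "i + 2 = Suc m" using i m by (auto simp: K_def)
      then show ?thesis using 2 by (simp only: a_def power2_eq_square) simp
    next
      case 3
      then have "1 \<le> K - i + 2" "K - i + 2 \<le> m" using i m by (auto simp: K_def)
      from z[OF this] show ?thesis using 3 by simp
    qed
  qed
  also have "\<dots> = real (K choose (m - 1)) * a\<^sup>2" using m by (simp add: K_def)
  finally have 2: "leibniz (\<lambda>i. E (i + 2)) (\<lambda>i. E (i + 2)) K p = real (K choose (m - 1)) * a\<^sup>2" .
  have "K choose m < K choose (m - 1)"
  proof (cases "m = 1")
    case True then show ?thesis by (simp add: K_def)
  next
    case False
    then show ?thesis using m by (intro binomial_strict_antimono) (auto simp: K_def)
  qed
  then have "real (K choose m) * a\<^sup>2 \<noteq> real (K choose (m - 1)) * a\<^sup>2" using nz by (simp add: a_def)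
  then show ?thesis unfolding log_convexity_def K_def[symmetric] 1 2 by simp
qed

lemma compact_deriv_bound:
  assumes "deriv_seq {lo..hi} E"
  shows "\<exists>B>0. \<forall>j\<le>k. \<forall>t\<in>{lo..hi}. \<bar>E j t\<bar> \<le> B"
proof (induction k)
  case 0
  have "bounded (E 0 ` {lo..hi})"
    by (intro compact_imp_bounded compact_continuous_image deriv_seq_continuous[OF assms] compact_Icc)
  then show ?case by (auto simp: bounded_pos)
next
  case (Suc k)
  then obtain B where B: "B > 0" "\<forall>j\<le>k. \<forall>t\<in>{lo..hi}. \<bar>E j t\<bar> \<le> B" by blast
  have "bounded (E (Suc k) ` {lo..hi})"
    by (intro compact_imp_bounded compact_continuous_image deriv_seq_continuous[OF assms] compact_Icc)
  then obtain B' where B': "B' > 0" "\<forall>t\<in>{lo..hi}. \<bar>E (Suc k) t\<bar> \<le> B'" by (auto simp: bounded_pos)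
  show ?case
  proof (intro exI[of _ "max B B'"] conjI allI impI ballI)
    fix j t assume "j \<le> Suc k" "t \<in> {lo..hi}"
    then show "\<bar>E j t\<bar> \<le> max B B'" using B B' by (cases "j = Suc k") (auto simp: le_max_iff_disj)
  qed (use B(1) in simp)
qed

lemma leibniz_close:
  assumes "\<And>i. i \<le> k \<Longrightarrow> \<bar>P i t - P' i t\<bar> \<le> \<delta>" "\<And>i. i \<le> k \<Longrightarrow> \<bar>Q i t - Q' i t\<bar> \<le> \<delta>"
    "\<And>i. i \<le> k \<Longrightarrow> \<bar>P' i t\<bar> \<le> B" "\<And>i. i \<le> k \<Longrightarrow> \<bar>Q i t\<bar> \<le> B" "\<delta> \<ge> 0"
  shows "\<bar>leibniz P Q k t - leibniz P' Q' k t\<bar> \<le> 2 ^ k * (2 * B * \<delta>)"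
proof -
  have eq: "leibniz P Q k t - leibniz P' Q' k t =
      (\<Sum>i\<le>k. real (k choose i) * ((P i t - P' i t) * Q (k - i) t + P' i t * (Q (k - i) t - Q' (k - i) t)))"
    unfolding leibniz_def sum_subtractf[symmetric] by (intro sum.cong refl) (simp add: algebra_simps)
  have "\<bar>leibniz P Q k t - leibniz P' Q' k t\<bar> \<le>
      (\<Sum>i\<le>k. \<bar>real (k choose i) * ((P i t - P' i t) * Q (k - i) t + P' i t * (Q (k - i) t - Q' (k - i) t))\<bar>)"
    unfolding eq by (rule sum_abs)
  also have "\<dots> \<le> (\<Sum>i\<le>k. real (k choose i) * (2 * B * \<delta>))"
  proof (rule sum_mono)
    fix i assume "i \<in> {..k}"
    then have i: "i \<le> k" "k - i \<le> k" by auto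
    have "\<bar>(P i t - P' i t) * Q (k - i) t\<bar> \<le> \<delta> * B" "\<bar>P' i t * (Q (k - i) t - Q' (k - i) t)\<bar> \<le> B * \<delta>"
      unfolding abs_mult using assms i by (intro mult_mono; force)+
    then have "\<bar>(P i t - P' i t) * Q (k - i) t + P' i t * (Q (k - i) t - Q' (k - i) t)\<bar> \<le> \<delta> * B + B * \<delta>"
      by (intro order_trans[OF abs_triangle_ineq] add_mono)
    also have "\<delta> * B + B * \<delta> = 2 * B * \<delta>" by simp
    finally have "\<bar>(P i t - P' i t) * Q (k - i) t + P' i t * (Q (k - i) t - Q' (k - i) t)\<bar> \<le> 2 * B * \<delta>" .
    then show "\<bar>real (k choose i) * ((P i t - P' i t) * Q (k - i) t + P' i t * (Q (k - i) t - Q' (k - i) t))\<bar> \<le> real (k choose i) * (2 * B * \<delta>)"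
      unfolding abs_mult by (intro mult_mono) auto
  qed
  also have "\<dots> = 2 ^ k * (2 * B * \<delta>)"
    using choose_row_sum[of k] by (simp add: sum_distrib_right[symmetric] of_nat_sum[symmetric] del: of_nat_sum)
  finally show ?thesis .
qed

lemma log_convexity_close:
  assumes E: "deriv_seq {lo..hi} E" and \<kappa>: "\<kappa> > 0"
  shows "\<exists>n. \<forall>D. close_seq {lo..hi} n D E \<longrightarrow> (\<forall>t\<in>{lo..hi}. \<bar>log_convexity D k t - log_convexity E k t\<bar> < \<kappa>)"
proof -
  obtain B where B: "B > 0" "\<And>j t. j \<le> k + 3 \<Longrightarrow> t \<in> {lo..hi} \<Longrightarrow> \<bar>E j t\<bar> \<le> B"
    using compact_deriv_bound[OF E, of "k + 3"] by blast
  define A where "A = 2 * (2 ^ k * (2 * (B + 1)))"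
  have A: "A > 0" using B by (simp add: A_def)
  obtain n0 where n0: "A / \<kappa> < real n0" using reals_Archimedean2 by blast
  define n where "n = n0 + k + 3"
  show ?thesis
  proof (intro exI[of _ n] allI impI ballI)
    fix D t assume cl: "close_seq {lo..hi} n D E" and t: "t \<in> {lo..hi}"
    define \<delta> where "\<delta> = 1 / (real n + 1)"
    have d0: "\<delta> > 0" "\<delta> \<le> 1" by (auto simp: \<delta>_def)
    have d: "\<bar>D j t - E j t\<bar> \<le> \<delta>" if "1 \<le> j" "j \<le> k + 3" for j
      using cl t that unfolding close_seq_def \<delta>_def n_def by (force intro: less_imp_le)
    have bE: "\<bar>E j t\<bar> \<le> B + 1" if "j \<le> k + 3" for j using B(2)[OF that t] by simp
    have bD: "\<bar>D j t\<bar> \<le> B + 1" if "1 \<le> j" "j \<le> k + 3" for j using B(2)[OF that(2) t] d[OF that] d0 by linarith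
    have "\<bar>leibniz (\<lambda>i. D (i + 1)) (\<lambda>i. D (i + 3)) k t - leibniz (\<lambda>i. E (i + 1)) (\<lambda>i. E (i + 3)) k t\<bar> \<le> 2 ^ k * (2 * (B + 1) * \<delta>)"
      by (rule leibniz_close) (use d bE bD d0 in auto)
    moreover have "\<bar>leibniz (\<lambda>i. D (i + 2)) (\<lambda>i. D (i + 2)) k t - leibniz (\<lambda>i. E (i + 2)) (\<lambda>i. E (i + 2)) k t\<bar> \<le> 2 ^ k * (2 * (B + 1) * \<delta>)"
      by (rule leibniz_close) (use d bE bD d0 in auto)
    ultimately have "\<bar>log_convexity D k t - log_convexity E k t\<bar> \<le> A * \<delta>"
      unfolding log_convexity_def A_def by linarith
    also have "\<dots> < \<kappa>"
    proof -
      have "A < \<kappa> * real n0" using n0 \<kappa> by (simp add: pos_divide_less_eq mult.commute)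
      also have "\<dots> \<le> \<kappa> * (real n + 1)" using \<kappa> by (intro mult_left_mono) (auto simp: n_def)
      finally show ?thesis by (simp add: \<delta>_def pos_divide_less_eq)
    qed
    finally show "\<bar>log_convexity D k t - log_convexity E k t\<bar> < \<kappa>" .
  qed
qed

lemma nonzero_nearby:
  fixes h :: "real \<Rightarrow> real"
  assumes "continuous_on X h" "p \<in> X" "h p \<noteq> 0"
  shows "\<exists>r>0. \<forall>t\<in>X \<inter> ball p r. \<bar>h t\<bar> \<ge> \<bar>h p\<bar> / 2"
proof -
  have "\<bar>h p\<bar> / 2 > 0" using assms(3) by auto
  then obtain r where r: "r > 0" "\<And>t. t \<in> X \<Longrightarrow> dist t p < r \<Longrightarrow> dist (h t) (h p) < \<bar>h p\<bar> / 2"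
    using assms(1,2) unfolding continuous_on_iff by metis
  show ?thesis
  proof (intro exI[of _ r] conjI ballI r(1))
    fix t assume "t \<in> X \<inter> ball p r"
    then have "\<bar>h t - h p\<bar> < \<bar>h p\<bar> / 2" using r(2)[of t] by (simp add: dist_real_def abs_minus_commute)
    then show "\<bar>h t\<bar> \<ge> \<bar>h p\<bar> / 2" by linarith
  qed
qed

text \<open>Let \<open>d\<close> be the order of the first nonzero derivative. It stays nonzero near \<open>p\<close> for all \<open>D\<close> near
  \<open>E\<close>, which bounds the oscillation from below. If \<open>d = 1\<close>, then \<open>log \<bar>D 1\<bar>\<close> is Lipschitz. Otherwise
  \<open>Z\<close> consists of the zeros of \<open>D 1\<close>, of \<open>D 2\<close> and of \<open>log_convexity D 0\<close>; their number is bounded since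
  the derivatives of orders \<open>m\<close>, \<open>m - 1\<close> and \<open>K\<close> of these functions do not vanish.\<close>

lemma local_control_near_point:
  assumes E: "deriv_seq {lo..hi} E" and p: "p \<in> {lo..hi}" and ex: "\<exists>d\<ge>1. E d p \<noteq> 0"
  shows "\<exists>r>0. r \<le> 1/2 \<and> (\<exists>n. \<forall>D. deriv_seq {lo..hi} D \<longrightarrow> close_seq {lo..hi} n D E \<longrightarrow>
    local_control ({lo..hi} \<inter> ball p r) n D)"
proof -
  let ?I = "{lo..hi}"
  define d where "d = (LEAST d. d \<ge> 1 \<and> E d p \<noteq> 0)"
  have d: "d \<ge> 1" "E d p \<noteq> 0" using LeastI_ex[of "\<lambda>d. d \<ge> 1 \<and> E d p \<noteq> 0"] ex unfolding d_def by blast+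
  have least: "E j p = 0" if "1 \<le> j" "j < d" for j
    using not_less_Least[of j "\<lambda>d. d \<ge> 1 \<and> E d p \<noteq> 0"] that unfolding d_def by blast
  define \<kappa> where "\<kappa> = \<bar>E d p\<bar> / 4"
  have \<kappa>: "\<kappa> > 0" using d by (simp add: \<kappa>_def)
  obtain r1 where r1: "r1 > 0" "\<And>t. t \<in> ?I \<inter> ball p r1 \<Longrightarrow> 2 * \<kappa> \<le> \<bar>E d t\<bar>"
    using nonzero_nearby[OF deriv_seq_continuous[OF E] p d(2)] by (auto simp: \<kappa>_def)
  obtain c where c: "c > 0" and L1: "\<And>D p q m \<omega>. deriv_seq {p..q} D \<Longrightarrow> p < q \<Longrightarrow> m \<ge> 0 \<Longrightarrow> (\<forall>t\<in>{p..q}. \<bar>D d t\<bar> \<ge> m) \<Longrightarrow>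
    osc_le (D 0) {p..q} \<omega> \<Longrightarrow> c * m * (q - p) ^ d \<le> \<omega>"
    using osc_ge_of_deriv_ge[OF d(1)] by blast
  \<comment> \<open>the lower bound for the oscillation, common to both cases\<close>
  have osc: "(y - x) ^ n \<le> n * \<omega>"
    if n: "1 / (real n + 1) \<le> \<kappa>" "d \<le> n" "1 / (c * \<kappa>) \<le> n" and D: "deriv_seq ?I D" "close_seq ?I n D E"
      and r: "r \<le> r1" "r \<le> 1/2" and xy: "x < y" "{x..y} \<subseteq> ?I \<inter> ball p r" and o: "osc_le (D 0) {x..y} \<omega>"
    for n D r x y \<omega>
  proof -
    have low: "\<kappa> \<le> \<bar>D d t\<bar>" if t: "t \<in> {x..y}" for t
    proof -
      have tI: "t \<in> ?I" "t \<in> ball p r" using t xy by blast+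
      have "\<bar>D d t - E d t\<bar> < 1 / (real n + 1)" using D(2) tI(1) d n unfolding close_seq_def by auto
      moreover have "t \<in> ball p r1" using tI(2) r by auto
      then have "2 * \<kappa> \<le> \<bar>E d t\<bar>" using r1(2) tI(1) by blast
      ultimately show ?thesis using n(1) by linarith
    qed
    have "x \<in> ball p r" "y \<in> ball p r" using xy by (auto simp: subset_eq)
    then have l1: "y - x \<le> 1" using r by (auto simp: dist_real_def)
    have "{x..y} \<subseteq> ?I" using xy by blast
    then have "c * \<kappa> * (y - x) ^ d \<le> \<omega>"
      using L1[OF deriv_seq_subset[OF D(1)] xy(1) less_imp_le[OF \<kappa>] _ o] low by blast
    then have "(y - x) ^ d \<le> 1 / (c * \<kappa>) * \<omega>" using c \<kappa> by (simp add: pos_le_divide_eq mult.commute)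
    moreover have "0 \<le> \<omega>" using o xy(1) by (force simp: osc_le_def)
    then have "1 / (c * \<kappa>) * \<omega> \<le> n * \<omega>" using n(3) by (rule mult_right_mono[rotated])
    moreover have "(y - x) ^ n \<le> (y - x) ^ d" using l1 xy(1) n(2) by (intro power_decreasing) auto
    ultimately show ?thesis by linarith
  qed
  have arch: "\<exists>n. 1 / (real n + 1) \<le> \<kappa> \<and> d \<le> n \<and> 1 / (c * \<kappa>) \<le> n \<and> a \<le> real n \<and> m \<le> n" for a m
  proof -
    obtain n0 where n0: "1 / \<kappa> + 1 / (c * \<kappa>) + \<bar>a\<bar> < real n0" using reals_Archimedean2 by blast
    have p: "1 / \<kappa> > 0" "1 / (c * \<kappa>) > 0" using c \<kappa> by auto
    define n where "n = n0 + d + m"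
    have "1 / \<kappa> \<le> real n + 1"
    proof -
      have "real n0 \<le> real n" by (simp add: n_def)
      then show ?thesis using n0 p abs_ge_zero[of a] by linarith
    qed
    then have "1 / (real n + 1) \<le> \<kappa>" using \<kappa> by (simp add: divide_le_eq mult.commute)
    moreover have "real n0 \<le> real n" "d \<le> n" "m \<le> n" by (simp_all add: n_def)
    moreover have "1 / (c * \<kappa>) \<le> real n" "a \<le> real n"
      using n0 p abs_ge_zero[of a] abs_ge_self[of a] \<open>real n0 \<le> real n\<close> by linarith+
    ultimately show ?thesis by blast
  qed
  show ?thesis
  proof (cases "d = 1")
    case True
    obtain B where B: "B > 0" "\<And>j t. j \<le> 2 \<Longrightarrow> t \<in> ?I \<Longrightarrow> \<bar>E j t\<bar> \<le> B"
      using compact_deriv_bound[OF E, of 2] by blast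
    obtain n where n: "1 / (real n + 1) \<le> \<kappa>" "d \<le> n" "1 / (c * \<kappa>) \<le> n" "(B + 1) / \<kappa> \<le> n" "2 \<le> n"
      using arch by blast
    define r where "r = min r1 (1/2)"
    show ?thesis
    proof (intro exI[of _ r] conjI exI[of _ n] allI impI)
      show "r > 0" "r \<le> 1/2" using r1 by (auto simp: r_def)
      fix D assume D: "deriv_seq ?I D" "close_seq ?I n D E"
      have low: "\<kappa> \<le> \<bar>D 1 t\<bar>" and up: "\<bar>D 2 t\<bar> \<le> B + 1" if t: "t \<in> ?I \<inter> ball p r" for t
      proof -
        have cl: "\<bar>D j t - E j t\<bar> < 1 / (real n + 1)" if "j \<in> {1..2}" for j
          using D(2) t n(5) that unfolding close_seq_def by auto
        have "t \<in> ?I \<inter> ball p r1" using t by (auto simp: r_def)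
        then have "2 * \<kappa> \<le> \<bar>E 1 t\<bar>" using r1(2) True by blast
        then show "\<kappa> \<le> \<bar>D 1 t\<bar>" using cl[of 1] n(1) by simp
        have "1 / (real n + 1) \<le> 1" by simp
        moreover have "\<bar>D 2 t - E 2 t\<bar> < 1 / (real n + 1)" by (rule cl) simp
        moreover have "\<bar>E 2 t\<bar> \<le> B" using B(2)[of 2 t] t by simp
        ultimately show "\<bar>D 2 t\<bar> \<le> B + 1" by linarith
      qed
      show "local_control (?I \<inter> ball p r) n D"
        unfolding local_control_def
      proof (intro conjI allI impI exI[of _ "{}"])
        fix x y \<omega> assume "x < y" "{x..y} \<subseteq> ?I \<inter> ball p r" "osc_le (D 0) {x..y} \<omega>"
        then show "(y - x) ^ n \<le> n * \<omega>" using osc[OF n(1-3) D, of r] by (simp add: r_def)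
      next
        show "{t \<in> ?I \<inter> ball p r. D 1 t = 0} \<subseteq> {}" using low \<kappa> by force
        fix J assume "J \<subseteq> ?I \<inter> ball p r"
        then have "\<bar>D 2 t\<bar> \<le> n * \<bar>D 1 t\<bar>" if "t \<in> J" for t
        proof -
          have t: "t \<in> ?I \<inter> ball p r" using \<open>J \<subseteq> ?I \<inter> ball p r\<close> that by blast
          have "B + 1 \<le> n * \<kappa>" using n(4) \<kappa> by (simp add: pos_divide_le_eq)
          also have "\<dots> \<le> n * \<bar>D 1 t\<bar>" using low[OF t] by (intro mult_left_mono) auto
          finally show ?thesis using up[OF t] by linarith
        qed
        then show "tame_piece n D J" by (simp add: tame_piece_def)
      qed auto
    qed
  next
    case False
    define m where "m = d - 1"
    have m: "m \<ge> 1" "d = Suc m" using d False by (auto simp: m_def)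
    define K where "K = 2 * m - 2"
    have "log_convexity E K p \<noteq> 0"
      unfolding K_def by (rule log_convexity_nonzero[OF _ m(1)]) (use least d m in auto)
    then obtain r2 where r2: "r2 > 0" "\<And>t. t \<in> ?I \<inter> ball p r2 \<Longrightarrow> \<bar>log_convexity E K p\<bar> / 2 \<le> \<bar>log_convexity E K t\<bar>"
      using nonzero_nearby[OF deriv_seq_continuous[OF deriv_seq_log_convexity[OF E]] p, of K] by blast
    have "\<bar>log_convexity E K p\<bar> / 2 > 0" using \<open>log_convexity E K p \<noteq> 0\<close> by simp
    from log_convexity_close[OF E this, of K] obtain n1 where
      n1: "\<And>D t. close_seq ?I n1 D E \<Longrightarrow> t \<in> ?I \<Longrightarrow> \<bar>log_convexity D K t - log_convexity E K t\<bar> < \<bar>log_convexity E K p\<bar> / 2"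
      by blast
    obtain n where n: "1 / (real n + 1) \<le> \<kappa>" "d \<le> n" "1 / (c * \<kappa>) \<le> n" "n1 + 2 * m + K \<le> n"
      using arch[where a=0 and m="n1 + 2 * m + K"] by blast
    define r where "r = min (min r1 r2) (1/2)"
    show ?thesis
    proof (intro exI[of _ r] conjI exI[of _ n] allI impI)
      show "r > 0" "r \<le> 1/2" using r1 r2 by (auto simp: r_def)
      fix D assume D: "deriv_seq ?I D" "close_seq ?I n D E"
      define V where "V = ?I \<inter> ball p r"
      have V: "is_interval V" unfolding V_def by (intro is_interval_Int) (simp_all add: is_interval_ball_real)
      have DV: "deriv_seq V D" using deriv_seq_subset[OF D(1)] by (auto simp: V_def)
      have nzd: "D d t \<noteq> 0" if t: "t \<in> V" for t
      proof -
        have "\<bar>D d t - E d t\<bar> < 1 / (real n + 1)" using D(2) t d n unfolding close_seq_def V_def by auto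
        moreover have "2 * \<kappa> \<le> \<bar>E d t\<bar>" using r1(2) t by (auto simp: V_def r_def)
        ultimately show ?thesis using n(1) \<kappa> by linarith
      qed
      have nzw: "log_convexity D K t \<noteq> 0" if t: "t \<in> V" for t
      proof -
        have "\<bar>log_convexity D K t - log_convexity E K t\<bar> < \<bar>log_convexity E K p\<bar> / 2"
          by (rule n1[OF close_seq_mono[OF D(2)]]) (use n t in \<open>auto simp: V_def\<close>)
        moreover have "\<bar>log_convexity E K p\<bar> / 2 \<le> \<bar>log_convexity E K t\<bar>" using r2(2) t by (auto simp: V_def r_def)
        ultimately show ?thesis by linarith
      qed
      have Z1: "finite {t\<in>V. D 1 t = 0} \<and> card {t\<in>V. D 1 t = 0} \<le> m"
        by (rule card_zeros_le[OF DV V]) (use nzd m(2) in \<open>simp add: plus_1_eq_Suc\<close>)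
      have Z2: "finite {t\<in>V. D 2 t = 0} \<and> card {t\<in>V. D 2 t = 0} \<le> m - 1"
      proof (rule card_zeros_le[OF DV V])
        have "2 + (m - 1) = d" using m by simp
        fix t assume "t \<in> V"
        from nzd[OF this] show "D (2 + (m - 1)) t \<noteq> 0" unfolding \<open>2 + (m - 1) = d\<close> .
      qed
      have Z3: "finite {t\<in>V. log_convexity D 0 t = 0} \<and> card {t\<in>V. log_convexity D 0 t = 0} \<le> K"
        by (rule card_zeros_le[OF deriv_seq_log_convexity[OF DV] V]) (use nzw in simp)
      define Z where "Z = {t\<in>V. D 1 t = 0} \<union> {t\<in>V. D 2 t = 0} \<union> {t\<in>V. log_convexity D 0 t = 0}"
      have "card Z \<le> m + (m - 1) + K"
        unfolding Z_def using Z1 Z2 Z3 by (intro order_trans[OF card_Un_le] add_mono) auto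
      then have Zc: "card Z \<le> n" using n(4) by linarith
      show "local_control (?I \<inter> ball p r) n D"
        unfolding local_control_def V_def[symmetric]
      proof (intro conjI allI impI exI[of _ Z])
        fix x y \<omega> assume "x < y" "{x..y} \<subseteq> V" "osc_le (D 0) {x..y} \<omega>"
        then show "(y - x) ^ n \<le> n * \<omega>" using osc[OF n(1-3) D, of r] by (simp add: r_def V_def)
      next
        show "finite Z" using Z1 Z2 Z3 by (simp add: Z_def)
        show "card Z \<le> n" by (rule Zc)
        show "{t \<in> V. D 1 t = 0} \<subseteq> Z" by (auto simp: Z_def)
        fix J assume J: "is_interval J" "J \<subseteq> V" "J \<inter> Z = {}"
        have nz: "D 2 t \<noteq> 0" "log_convexity D 0 t \<noteq> 0" if "t \<in> J" for t using J that by (auto simp: Z_def)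
        have "(\<forall>t\<in>J. log_convexity D 0 t \<le> 0) \<or> (\<forall>t\<in>J. log_convexity D 0 t \<ge> 0)"
        proof (rule ccontr)
          assume "\<not> ?thesis"
          then obtain a b where ab: "a \<in> J" "b \<in> J" "log_convexity D 0 a \<le> 0" "0 \<le> log_convexity D 0 b"
            by (meson linorder_linear)
          have "connected (log_convexity D 0 ` J)"
            using J continuous_on_subset[OF deriv_seq_continuous[OF deriv_seq_log_convexity[OF DV]] J(2)]
            by (intro connected_continuous_image) (auto simp: is_interval_connected)
          then have "0 \<in> log_convexity D 0 ` J" using ab unfolding connected_iff_interval by blast
          then show False using nz(2) by force
        qed
        then show "tame_piece n D J"
          using nz unfolding tame_piece_def log_convexity_0 by blast
      qed
    qed
  qed
qed

definition piecewise :: "real \<Rightarrow> real \<Rightarrow> nat \<Rightarrow> (real \<Rightarrow> real) \<Rightarrow> (real set \<Rightarrow> bool) \<Rightarrow> bool" where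
  "piecewise lo hi M u P \<longleftrightarrow> (\<exists>Z. finite Z \<and> card Z \<le> M \<and> {lo, hi} \<subseteq> Z \<and> {t\<in>{lo..hi}. u t = 0} \<subseteq> Z \<and>
      (\<forall>J. is_interval J \<longrightarrow> J \<subseteq> {lo..hi} \<longrightarrow> J \<inter> Z = {} \<longrightarrow> P J))"

text \<open>Compactness. The ends of the covering balls are put into \<open>Z\<close>, so that an interval avoiding \<open>Z\<close> lies
  in a single ball. The bound for the oscillation on a long interval comes from its initial part of
  relative length \<open>\<theta>\<close>, which is shorter than a Lebesgue number of the cover.\<close>

lemma uniform_control:
  assumes lohi: "lo < hi" and E: "deriv_seq {lo..hi} E" and ex: "\<forall>p\<in>{lo..hi}. \<exists>d\<ge>1. E d p \<noteq> 0"
  shows "\<exists>n M. \<exists>C>0. n \<ge> 2 \<and> (\<forall>D. deriv_seq {lo..hi} D \<longrightarrow> close_seq {lo..hi} n D E \<longrightarrow>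
    (\<forall>t\<in>{lo..hi}. \<bar>D n t\<bar> \<le> C) \<and>
    (\<forall>x y \<omega>. x < y \<longrightarrow> {x..y} \<subseteq> {lo..hi} \<longrightarrow> osc_le (D 0) {x..y} \<omega> \<longrightarrow> (y - x) ^ n \<le> C * \<omega>) \<and>
    piecewise lo hi M (D 1) (tame_piece C D))"
proof -
  let ?I = "{lo..hi}"
  have "\<forall>p\<in>?I. \<exists>r n. r > 0 \<and> r \<le> 1/2 \<and> (\<forall>D. deriv_seq ?I D \<longrightarrow> close_seq ?I n D E \<longrightarrow> local_control (?I \<inter> ball p r) n D)"
    using local_control_near_point[OF E] ex by blast
  then obtain r n where r: "\<And>p. p \<in> ?I \<Longrightarrow> r p > 0" "\<And>p. p \<in> ?I \<Longrightarrow> r p \<le> 1/2"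
    and lc: "\<And>p D. p \<in> ?I \<Longrightarrow> deriv_seq ?I D \<Longrightarrow> close_seq ?I (n p) D E \<Longrightarrow> local_control (?I \<inter> ball p (r p)) (n p) D"
    by metis
  have cover: "?I \<subseteq> (\<Union>p\<in>?I. ball p (r p))" using r(1) by auto
  obtain P where P: "P \<subseteq> ?I" "finite P" "?I \<subseteq> (\<Union>p\<in>P. ball p (r p))"
    by (rule compactE_image[OF compact_Icc _ cover]) auto
  obtain \<epsilon> where \<epsilon>: "\<epsilon> > 0" "\<And>x. x \<in> ?I \<Longrightarrow> \<exists>G\<in>(\<lambda>p. ball p (r p)) ` P. ball x \<epsilon> \<subseteq> G"
    by (rule Heine_Borel_lemma[OF compact_Icc P(3)]) auto
  define nn where "nn = (\<Sum>p\<in>P. n p) + 2"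
  have nle: "n p \<le> nn" if "p \<in> P" for p using member_le_sum[OF that, of n] P(2) by (simp add: nn_def)
  define \<theta> where "\<theta> = min 1 (\<epsilon> / (2 * (hi - lo)))"
  have \<theta>: "\<theta> > 0" "\<theta> \<le> 1" "\<theta> * (hi - lo) \<le> \<epsilon> / 2"
  proof -
    show "\<theta> > 0" "\<theta> \<le> 1" using \<epsilon>(1) lohi by (auto simp: \<theta>_def)
    have "\<theta> \<le> \<epsilon> / (2 * (hi - lo))" by (simp add: \<theta>_def)
    then have "\<theta> * (hi - lo) \<le> \<epsilon> / (2 * (hi - lo)) * (hi - lo)" using lohi by (intro mult_right_mono) auto
    also have "\<dots> = \<epsilon> / 2" using lohi by (simp add: divide_simps)
    finally show "\<theta> * (hi - lo) \<le> \<epsilon> / 2" .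
  qed
  obtain B where B: "B > 0" "\<And>j t. j \<le> nn \<Longrightarrow> t \<in> ?I \<Longrightarrow> \<bar>E j t\<bar> \<le> B"
    using compact_deriv_bound[OF E, of nn] by blast
  define C where "C = B + 1 + real nn / \<theta> ^ nn + real nn"
  have C: "C > 0" "B + 1 \<le> C" "real nn / \<theta> ^ nn \<le> C" "real nn \<le> C"
    using B(1) \<theta>(1) by (auto simp: C_def add_pos_nonneg intro!: add_increasing)
  define M where "M = card P * nn + 2 * card P + 2"
  show ?thesis
  proof (rule exI[of _ nn], rule exI[of _ M], rule exI[of _ C], intro conjI allI impI C(1) ballI)
    show "nn \<ge> 2" by (simp add: nn_def)
    fix D assume D: "deriv_seq ?I D" "close_seq ?I nn D E"
    have lcD: "local_control (?I \<inter> ball p (r p)) (n p) D" if "p \<in> P" for p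
      using lc[OF _ D(1) close_seq_mono[OF D(2) nle[OF that]]] P(1) that by blast
    {
      fix t assume t: "t \<in> ?I"
      have "\<bar>D nn t - E nn t\<bar> < 1 / (real nn + 1)" using D(2) t unfolding close_seq_def nn_def by auto
      moreover have "1 / (real nn + 1) \<le> 1" by simp
      ultimately show "\<bar>D nn t\<bar> \<le> C" using B(2)[OF order.refl t] C(2) by linarith
    next
      fix x y \<omega> assume xy: "x < y" "{x..y} \<subseteq> ?I" and o: "osc_le (D 0) {x..y} \<omega>"
      have xI: "x \<in> ?I" "y \<in> ?I" using xy by auto
      obtain p where p: "p \<in> P" "ball x \<epsilon> \<subseteq> ball p (r p)" using \<epsilon>(2)[OF xI(1)] by blast
      define y' where "y' = x + \<theta> * (y - x)"
      have "\<theta> * (y - x) \<le> \<theta> * (hi - lo)" using xI \<theta>(1) by (intro mult_left_mono) auto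
      then have y1: "y' - x < \<epsilon>" using \<theta>(3) \<epsilon>(1) by (simp add: y'_def)
      have y2: "x < y'" using \<theta>(1) xy(1) by (simp add: y'_def)
      have "\<theta> * (y - x) \<le> 1 * (y - x)" using \<theta>(2) xy(1) by (intro mult_right_mono) auto
      then have y3: "y' \<le> y" by (simp add: y'_def)
      have "{x..y'} \<subseteq> ball x \<epsilon>" using y1 by (auto simp: dist_real_def)
      then have sub: "{x..y'} \<subseteq> ?I \<inter> ball p (r p)" using p(2) xy y3 by fastforce
      have o': "osc_le (D 0) {x..y'} \<omega>" using o y3 unfolding osc_le_def by auto
      have w0: "\<omega> \<ge> 0" using o xy(1) by (force simp: osc_le_def)
      have "(y' - x) ^ n p \<le> n p * \<omega>"
        using lcD[OF p(1)] y2 sub o' unfolding local_control_def by blast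
      moreover have "p \<in> ?I" using p(1) P(1) by blast
      then have "r p \<le> 1/2" using r(2) by blast
      moreover have "x \<in> ball p (r p)" "y' \<in> ball p (r p)" using sub y2 by (auto simp: subset_eq)
      ultimately have "y' - x \<le> 1" by (simp add: dist_real_def)
      then have "(y' - x) ^ nn \<le> (y' - x) ^ n p" using y2 nle[OF p(1)] by (intro power_decreasing) auto
      also note \<open>(y' - x) ^ n p \<le> n p * \<omega>\<close>
      also have "real (n p) * \<omega> \<le> real nn * \<omega>" using nle[OF p(1)] w0 by (intro mult_right_mono) auto
      finally have "\<theta> ^ nn * (y - x) ^ nn \<le> real nn * \<omega>" by (simp add: y'_def power_mult_distrib)
      then have "(y - x) ^ nn \<le> real nn / \<theta> ^ nn * \<omega>" using \<theta>(1) by (simp add: pos_le_divide_eq mult.commute)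
      also have "\<dots> \<le> C * \<omega>" using C(3) w0 by (rule mult_right_mono)
      finally show "(y - x) ^ nn \<le> C * \<omega>" .
    next
      have "\<forall>p\<in>P. \<exists>Z. finite Z \<and> card Z \<le> n p \<and> {t\<in>?I \<inter> ball p (r p). D 1 t = 0} \<subseteq> Z \<and>
         (\<forall>J. is_interval J \<longrightarrow> J \<subseteq> ?I \<inter> ball p (r p) \<longrightarrow> J \<inter> Z = {} \<longrightarrow> tame_piece (n p) D J)"
        using conjunct2[OF lcD[unfolded local_control_def]] by (intro ballI)
      from bchoice[OF this] obtain Z where Z': "\<forall>p\<in>P. finite (Z p) \<and> card (Z p) \<le> n p \<and> {t\<in>?I \<inter> ball p (r p). D 1 t = 0} \<subseteq> Z p \<and>
         (\<forall>J. is_interval J \<longrightarrow> J \<subseteq> ?I \<inter> ball p (r p) \<longrightarrow> J \<inter> Z p = {} \<longrightarrow> tame_piece (n p) D J)"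
        by (rule exE)
      note Z = bspec[OF Z']
      define ZZ where "ZZ = (\<Union>p\<in>P. Z p) \<union> ((\<lambda>p. p - r p) ` P \<union> (\<lambda>p. p + r p) ` P) \<union> {lo, hi}"
      show "piecewise lo hi M (D 1) (tame_piece C D)"
        unfolding piecewise_def
      proof (intro exI[of _ ZZ] conjI allI impI)
        show "finite ZZ" using Z P(2) by (auto simp: ZZ_def)
        have "card (\<Union>p\<in>P. Z p) \<le> (\<Sum>p\<in>P. card (Z p))" by (rule card_UN_le[OF P(2)])
        also have "\<dots> \<le> (\<Sum>p\<in>P. nn)" using Z nle by (intro sum_mono) (meson order_trans)
        finally have c1: "card (\<Union>p\<in>P. Z p) \<le> card P * nn" by simp
        have c2: "card ((\<lambda>p. p - r p) ` P \<union> (\<lambda>p. p + r p) ` P) \<le> card P + card P"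
          by (intro order_trans[OF card_Un_le] add_mono card_image_le P(2))
        have c3: "card {lo, hi} \<le> 2" by (simp add: card_insert_if)
        have "card ZZ \<le> (card P * nn + (card P + card P)) + 2"
          unfolding ZZ_def by (intro order_trans[OF card_Un_le] add_mono c1 c2 c3)
        then show "card ZZ \<le> M" by (simp add: M_def)
        show "{lo, hi} \<subseteq> ZZ" by (auto simp: ZZ_def)
        show "{t\<in>?I. D 1 t = 0} \<subseteq> ZZ"
        proof
          fix t assume t: "t \<in> {t\<in>?I. D 1 t = 0}"
          then obtain p where p: "p \<in> P" "t \<in> ball p (r p)" using P(3) by blast
          then have "t \<in> Z p" using Z[OF p(1)] t by blast
          then show "t \<in> ZZ" using p(1) by (auto simp: ZZ_def)
        qed
        fix J assume J: "is_interval J" "J \<subseteq> ?I" "J \<inter> ZZ = {}"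
        show "tame_piece C D J"
        proof (cases "J = {}")
          case True then show ?thesis by (simp add: tame_piece_def)
        next
          case False
          then obtain e where e: "e \<in> J" by blast
          then obtain p where p: "p \<in> P" "e \<in> ball p (r p)" using J(2) P(3) by blast
          have nin: "p - r p \<notin> J" "p + r p \<notin> J" using J(3) p(1) by (auto simp: ZZ_def)
          have "J \<subseteq> ball p (r p)"
          proof
            fix t assume t: "t \<in> J"
            show "t \<in> ball p (r p)"
            proof (rule ccontr)
              assume "t \<notin> ball p (r p)"
              then have "t \<le> p - r p \<or> p + r p \<le> t" by (auto simp: dist_real_def)
              then show False
              proof
                assume "t \<le> p - r p"
                moreover have "p - r p \<le> e" using p(2) by (auto simp: dist_real_def)
                ultimately have "p - r p \<in> {t..e}" by simp
                then show False using interval_Icc_subset[OF J(1) t e] nin by blast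
              next
                assume "p + r p \<le> t"
                moreover have "e \<le> p + r p" using p(2) by (auto simp: dist_real_def)
                ultimately have "p + r p \<in> {e..t}" by simp
                then show False using interval_Icc_subset[OF J(1) e t] nin by blast
              qed
            qed
          qed
          moreover have "J \<inter> Z p = {}" using J(3) p(1) by (auto simp: ZZ_def)
          ultimately have tp: "tame_piece (n p) D J" using Z[OF p(1)] J(1,2) by blast
          have "real (n p) * \<bar>D 1 t\<bar> \<le> C * \<bar>D 1 t\<bar>" for t
            using nle[OF p(1)] C(4) by (intro mult_right_mono) auto
          with tp show ?thesis unfolding tame_piece_def by (meson order_trans)
        qed
      qed
    }
  qed
qed

lemma distortion_bound_mono: "distortion_bound D E C \<Longrightarrow> C \<le> C' \<Longrightarrow> distortion_bound D E C'"
  unfolding distortion_bound_def by (meson order_trans)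

text \<open>Here \<open>t\<close> is the distance of \<open>\<tau>\<close> from a point of the interval \<open>{x..y}\<close>, in units of the length of this
  interval, and \<open>\<omega>\<close> bounds the oscillation on it.\<close>

definition growth_bound :: "real \<Rightarrow> real \<Rightarrow> real \<Rightarrow> nat \<Rightarrow> (real \<Rightarrow> real) \<Rightarrow> bool" where
  "growth_bound lo hi C n h \<longleftrightarrow>
    (\<forall>x y \<omega> \<beta> \<tau> t. x < y \<longrightarrow> {x..y} \<subseteq> {lo..hi} \<longrightarrow> osc_le h {x..y} \<omega> \<longrightarrow> \<beta> \<in> {x..y} \<longrightarrow> \<tau> \<in> {lo..hi} \<longrightarrow>
      \<bar>\<tau> - \<beta>\<bar> \<le> t * (y - x) \<longrightarrow> \<bar>h \<tau> - h \<beta>\<bar> \<le> C * (t * (1 + t) ^ n) * \<omega>)"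

text \<open>Taylor expansion at \<open>\<beta>\<close> in the unit of length \<open>l\<close>, with the mean value theorem applied to the
  derivatives from order \<open>n\<close> downwards.\<close>

lemma polynomial_growth:
  assumes D: "deriv_seq X D" and seg: "closed_segment \<beta> \<tau> \<subseteq> X" and l: "l > 0" and t: "\<bar>\<tau> - \<beta>\<bar> \<le> t * l"
    and n: "n \<ge> 1" and A: "\<And>j. 1 \<le> j \<Longrightarrow> j \<le> n \<Longrightarrow> \<bar>D j \<beta>\<bar> * l ^ j \<le> A"
    and top: "\<And>s. s \<in> closed_segment \<beta> \<tau> \<Longrightarrow> \<bar>D n s\<bar> * l ^ n \<le> A"
  shows "\<bar>D 0 \<tau> - D 0 \<beta>\<bar> \<le> real n * A * (t * (1 + t) ^ n)"
proof -
  have A0: "A \<ge> 0" using A[of 1] n l by (meson abs_ge_zero mult_nonneg_nonneg order_trans zero_le_power less_imp_le order.refl)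
  have t0: "t \<ge> 0" using t l by (metis abs_ge_zero less_le_not_le mult_neg_pos not_le order_trans)
  have lip: "\<bar>D j s - D j \<beta>\<bar> \<le> K * (t * l)"
    if s: "s \<in> closed_segment \<beta> \<tau>" and K: "\<And>z. z \<in> closed_segment \<beta> \<tau> \<Longrightarrow> \<bar>D (Suc j) z\<bar> \<le> K" "K \<ge> 0" for j s K
  proof -
    have sub: "closed_segment \<beta> s \<subseteq> closed_segment \<beta> \<tau>" using s by (simp add: closed_segment_subset)
    have "\<bar>D j s - D j \<beta>\<bar> \<le> K * \<bar>s - \<beta>\<bar>"
      by (rule deriv_seq_lipschitz[OF D]) (use sub seg K in auto)
    moreover have "\<bar>s - \<beta>\<bar> \<le> \<bar>\<tau> - \<beta>\<bar>" using s by (auto simp: closed_segment_eq_real_ivl split: if_splits)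
    ultimately show ?thesis using K(2) t by (meson mult_left_mono order_trans)
  qed
  have main: "k < n \<Longrightarrow> \<forall>s\<in>closed_segment \<beta> \<tau>. \<bar>D (n - k) s\<bar> * l ^ (n - k) \<le> real (k + 1) * A * (1 + t) ^ k" for k
  proof (induction k)
    case 0 then show ?case using top by simp
  next
    case (Suc k)
    show ?case
    proof
      fix s assume s: "s \<in> closed_segment \<beta> \<tau>"
      define j where "j = n - Suc k"
      have j: "1 \<le> j" "j \<le> n" "n - k = Suc j" using Suc.prems by (auto simp: j_def)
      define K where "K = real (k + 1) * A * (1 + t) ^ k / l ^ Suc j"
      have K0: "K \<ge> 0" using A0 t0 l by (simp add: K_def)
      have "\<bar>D j s - D j \<beta>\<bar> \<le> K * (t * l)"
      proof (rule lip[OF s _ K0])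
        fix z assume "z \<in> closed_segment \<beta> \<tau>"
        then have "\<bar>D (Suc j) z\<bar> * l ^ Suc j \<le> real (k + 1) * A * (1 + t) ^ k" using Suc j by simp
        then show "\<bar>D (Suc j) z\<bar> \<le> K" using l unfolding K_def by (simp only: pos_le_divide_eq zero_less_power)
      qed
      then have "\<bar>D j s - D j \<beta>\<bar> * l ^ j \<le> K * (t * l) * l ^ j" using l by (intro mult_right_mono) auto
      also have "\<dots> = t * (real (k + 1) * A * (1 + t) ^ k)"
        using l by (simp add: K_def)
      finally have 1: "\<bar>D j s - D j \<beta>\<bar> * l ^ j \<le> t * (real (k + 1) * A * (1 + t) ^ k)" .
      have "\<bar>D j s\<bar> * l ^ j \<le> (\<bar>D j \<beta>\<bar> + \<bar>D j s - D j \<beta>\<bar>) * l ^ j" using l by (intro mult_right_mono) auto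
      also have "\<dots> \<le> A + t * (real (k + 1) * A * (1 + t) ^ k)" using A[OF j(1,2)] 1 by (simp add: distrib_right)
      also have "\<dots> \<le> A * (1 + t) ^ Suc k + t * (real (k + 1) * A * (1 + t) ^ k)"
        using A0 t0 by (intro add_right_mono) (simp add: mult_le_cancel_left1 one_le_power del: power_Suc)
      also have "\<dots> \<le> A * (1 + t) ^ Suc k + (1 + t) * (real (k + 1) * A * (1 + t) ^ k)"
        using A0 t0 by (intro add_left_mono mult_right_mono) auto
      also have "\<dots> = real (Suc k + 1) * A * (1 + t) ^ Suc k" by (simp add: algebra_simps)
      finally show "\<bar>D (n - Suc k) s\<bar> * l ^ (n - Suc k) \<le> real (Suc k + 1) * A * (1 + t) ^ Suc k"
        by (simp add: j_def)
    qed
  qed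
  define K where "K = real n * A * (1 + t) ^ (n - 1) / l"
  have K0: "K \<ge> 0" using A0 t0 l by (simp add: K_def)
  have "\<bar>D 0 \<tau> - D 0 \<beta>\<bar> \<le> K * (t * l)"
  proof (rule lip[OF _ _ K0])
    fix z assume z: "z \<in> closed_segment \<beta> \<tau>"
    have "\<bar>D 1 z\<bar> * l \<le> real n * A * (1 + t) ^ (n - 1)"
      using main[of "n - 1"] z n by simp
    then show "\<bar>D (Suc 0) z\<bar> \<le> K" using l by (simp add: K_def pos_le_divide_eq)
  qed simp
  also have "\<dots> = real n * A * (t * (1 + t) ^ (n - 1))" using l by (simp add: K_def)
  also have "\<dots> \<le> real n * A * (t * (1 + t) ^ n)"
    using A0 t0 n by (intro mult_left_mono power_increasing) auto
  finally show ?thesis .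
qed

text \<open>The lower bound for the oscillation and the upper bound for the derivative of order \<open>n\<close> together
  are the hypothesis of Markov's inequality, on intervals of every length.\<close>

lemma uniform_distortion:
  assumes lohi: "lo < hi" and E: "deriv_seq {lo..hi} E" and ex: "\<forall>p\<in>{lo..hi}. \<exists>d\<ge>1. E d p \<noteq> 0"
  shows "\<exists>n M. \<exists>C>0. \<forall>D. deriv_seq {lo..hi} D \<longrightarrow> close_seq {lo..hi} n D E \<longrightarrow>
    growth_bound lo hi C n (D 0) \<and>
    piecewise lo hi M (D 1) (\<lambda>J. distortion_bound D J C)"
proof -
  let ?I = "{lo..hi}"
  obtain n M C where C: "C > 0" and n: "n \<ge> 2" and ctl: "\<forall>D. deriv_seq ?I D \<longrightarrow> close_seq ?I n D E \<longrightarrow>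
    (\<forall>t\<in>?I. \<bar>D n t\<bar> \<le> C) \<and>
    (\<forall>x y \<omega>. x < y \<longrightarrow> {x..y} \<subseteq> ?I \<longrightarrow> osc_le (D 0) {x..y} \<omega> \<longrightarrow> (y - x) ^ n \<le> C * \<omega>) \<and>
    piecewise lo hi M (D 1) (tame_piece C D)"
    using uniform_control[OF lohi E ex] by (elim exE conjE) (rule that)
  have top: "\<bar>D n t\<bar> \<le> C" if "deriv_seq ?I D" "close_seq ?I n D E" "t \<in> ?I" for D t
    by (rule bspec[OF conjunct1[OF mp[OF mp[OF spec[OF ctl] that(1)] that(2)]] that(3)])
  have osc: "(y - x) ^ n \<le> C * \<omega>"
    if "deriv_seq ?I D" "close_seq ?I n D E" "x < y" "{x..y} \<subseteq> ?I" "osc_le (D 0) {x..y} \<omega>" for D x y \<omega>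
    using conjunct1[OF conjunct2[OF mp[OF mp[OF spec[OF ctl] that(1)] that(2)]]] that(3-5) by simp
  have Z: "piecewise lo hi M (D 1) (tame_piece C D)"
    if "deriv_seq ?I D" "close_seq ?I n D E" for D
    by (rule conjunct2[OF conjunct2[OF mp[OF mp[OF spec[OF ctl] that(1)] that(2)]]])
  have "C * C > 0" using C by simp
  from markov[OF this, of n] obtain A where A: "A > 0" and mk: "\<And>D x y \<omega> j t. deriv_seq {x..y} D \<Longrightarrow> x < y \<Longrightarrow> osc_le (D 0) {x..y} \<omega> \<Longrightarrow>
    (\<forall>t\<in>{x..y}. \<bar>D n t\<bar> * (y - x) ^ n \<le> C * C * \<omega>) \<Longrightarrow> j \<in> {1..n} \<Longrightarrow> t \<in> {x..y} \<Longrightarrow> \<bar>D j t\<bar> * (y - x) ^ j \<le> A * \<omega>"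
    by blast
  define C' where "C' = real n * (A + C * C) + 2 * C * (hi - lo) + A"
  have C': "C' > 0" "real n * (A + C * C) \<le> C'" "2 * C * (hi - lo) \<le> C'" "A \<le> C'"
    using A C lohi by (auto simp: C'_def add_nonneg_pos intro!: add_increasing)
  show ?thesis
  proof (rule exI[of _ n], rule exI[of _ M], rule exI[of _ C'], intro conjI allI impI C'(1))
    fix D assume D: "deriv_seq ?I D" "close_seq ?I n D E"
    have up: "\<bar>D n s\<bar> * (y - x) ^ n \<le> C * C * \<omega>"
      if "x < y" "{x..y} \<subseteq> ?I" "osc_le (D 0) {x..y} \<omega>" "s \<in> ?I" for x y \<omega> s
    proof -
      have "\<bar>D n s\<bar> * (y - x) ^ n \<le> C * (C * \<omega>)"
        using top[OF D that(4)] osc[OF D that(1-3)] that(1) C by (intro mult_mono) auto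
      then show ?thesis by (simp add: mult.assoc)
    qed
    have mkD: "\<bar>D j t\<bar> * (y - x) ^ j \<le> A * \<omega>"
      if "x < y" "{x..y} \<subseteq> ?I" "osc_le (D 0) {x..y} \<omega>" "j \<in> {1..n}" "t \<in> {x..y}" for x y \<omega> j t
      by (rule mk[OF deriv_seq_subset[OF D(1) that(2)] that(1,3) _ that(4,5)]) (use up[OF that(1-3)] that(2) in blast)
    show "growth_bound lo hi C' n (D 0)"
      unfolding growth_bound_def
    proof (intro allI impI)
      fix x y \<omega> \<beta> \<tau> t
      assume xy: "x < y" "{x..y} \<subseteq> ?I" and o: "osc_le (D 0) {x..y} \<omega>" and b: "\<beta> \<in> {x..y}" and tau: "\<tau> \<in> ?I"
        and t: "\<bar>\<tau> - \<beta>\<bar> \<le> t * (y - x)"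
      have w0: "\<omega> \<ge> 0" using o xy(1) by (force simp: osc_le_def)
      have t0: "t \<ge> 0" using t xy(1) by (metis abs_ge_zero diff_gt_0_iff_gt mult_neg_pos not_le order_trans)
      have seg: "closed_segment \<beta> \<tau> \<subseteq> ?I" using b tau xy(2) by (intro closed_segment_subset) auto
      have le: "A * \<omega> \<le> (A + C * C) * \<omega>" "C * C * \<omega> \<le> (A + C * C) * \<omega>" using A C w0 by (auto intro!: mult_right_mono)
      have "\<bar>D 0 \<tau> - D 0 \<beta>\<bar> \<le> real n * ((A + C * C) * \<omega>) * (t * (1 + t) ^ n)"
      proof (rule polynomial_growth[OF D(1) seg _ t])
        show "0 < y - x" "1 \<le> n" using xy n by auto
        fix j assume "1 \<le> j" "j \<le> n"
        then show "\<bar>D j \<beta>\<bar> * (y - x) ^ j \<le> (A + C * C) * \<omega>"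
          using mkD[OF xy o _ b, of j] le(1) by auto
      next
        fix s assume "s \<in> closed_segment \<beta> \<tau>"
        then have "s \<in> ?I" using seg by blast
        from up[OF xy o this] le(2) show "\<bar>D n s\<bar> * (y - x) ^ n \<le> (A + C * C) * \<omega>" by linarith
      qed
      also have "\<dots> = real n * (A + C * C) * (t * (1 + t) ^ n * \<omega>)" by (simp add: mult_ac)
      also have "\<dots> \<le> C' * (t * (1 + t) ^ n * \<omega>)" using C'(2) t0 w0 by (intro mult_right_mono) auto
      finally show "\<bar>D 0 \<tau> - D 0 \<beta>\<bar> \<le> C' * (t * (1 + t) ^ n) * \<omega>" by (simp add: mult.assoc)
    qed
      from Z[OF D] obtain Z where Z: "finite Z" "card Z \<le> M" "{lo, hi} \<subseteq> Z" "{t\<in>?I. D 1 t = 0} \<subseteq> Z"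
        "\<And>J. is_interval J \<Longrightarrow> J \<subseteq> ?I \<Longrightarrow> J \<inter> Z = {} \<Longrightarrow> tame_piece C D J" unfolding piecewise_def by blast
      show "piecewise lo hi M (D 1) (\<lambda>J. distortion_bound D J C')"
        unfolding piecewise_def
      proof (intro exI[of _ Z] conjI allI impI Z(1-4))
        fix J assume J: "is_interval J" "J \<subseteq> ?I" "J \<inter> Z = {}"
        have DJ: "deriv_seq J D" by (rule deriv_seq_subset[OF D(1) J(2)])
        have nz: "D 1 s \<noteq> 0" if "s \<in> J" for s using J Z(4) that by blast
        from Z(5)[OF J] consider "\<forall>t\<in>J. \<bar>D 2 t\<bar> \<le> C * \<bar>D 1 t\<bar>" | "\<forall>t\<in>J. D 1 t * D 3 t - (D 2 t)\<^sup>2 \<le> 0"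
          | "\<forall>t\<in>J. D 2 t \<noteq> 0 \<and> D 1 t * D 3 t - (D 2 t)\<^sup>2 \<ge> 0" unfolding tame_piece_def by blast
        then show "distortion_bound D J C'"
        proof cases
          case 1
          have "distortion_bound D J (2 * C * (hi - lo))"
            by (rule distortion_bound_lipschitz[OF DJ J(1,2) nz]) (use 1 C lohi in auto)
          then show ?thesis by (rule distortion_bound_mono[OF _ C'(3)])
        next
          case 2
          have "distortion_bound D J 0"
            by (rule distortion_bound_concave[OF DJ J(1) nz]) (use 2 in auto)
          then show ?thesis by (rule distortion_bound_mono[OF _ less_imp_le[OF C'(1)]])
        next
          case 3
          have "distortion_bound D J A"
          proof (rule distortion_bound_convex[OF DJ J(1) nz])
            show "0 \<le> A" using A by simp
            fix x y \<omega> t assume xy: "x < y" "{x..y} \<subseteq> J" and o: "osc_le (D 0) {x..y} \<omega>" and t: "t \<in> {x..y}"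
            have "{x..y} \<subseteq> ?I" using xy(2) J(2) by (rule subset_trans)
            from mkD[OF xy(1) this o _ t, of 2] show "\<bar>D 2 t\<bar> * (y - x)\<^sup>2 \<le> A * \<omega>" using n by simp
          qed (use 3 in auto)
          then show ?thesis by (rule distortion_bound_mono[OF _ C'(4)])
        qed
      qed
  qed
qed

section \<open>Pulling back space on the line\<close>

definition rel_interval :: "real set \<Rightarrow> real set \<Rightarrow> real set \<Rightarrow> bool" where
  "rel_interval X I A \<longleftrightarrow> A \<noteq> {} \<and> is_interval A \<and> openin (top_of_set X) A \<and> A \<subseteq> I"

text \<open>On an interval, space is only demanded inside \<open>X\<close>; an interval \<open>A\<close> that contains an endpoint of
  \<open>X\<close> has no neighbour on this side.\<close>

definition has_space :: "real set \<Rightarrow> real \<Rightarrow> real set \<Rightarrow> real set \<Rightarrow> bool" where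
  "has_space X \<delta> B A \<longleftrightarrow> scale_interval (1 + 2 * \<delta>) B \<inter> X \<subseteq> A"

text \<open>The last two conditions express that \<open>A\<close> and \<open>B\<close> are components of preimages: they cannot be
  enlarged beyond a boundary point.\<close>

definition pullback_step :: "real set \<Rightarrow> (real \<Rightarrow> real) \<Rightarrow> real set \<Rightarrow> real set \<Rightarrow> real set \<Rightarrow> real set \<Rightarrow> bool" where
  "pullback_step X h A B A' B' \<longleftrightarrow> h ` A \<subseteq> A' \<and> h ` B \<subseteq> B' \<and>
    (\<forall>t\<in>closure A - A. h t \<in> X - A') \<and> (\<forall>t\<in>closure B - B. h t \<notin> B')"

lemma scale_interval_eq:
  "scale_interval (1 + 2 * \<delta>) B = {Inf B - \<delta> * (Sup B - Inf B) <..< Sup B + \<delta> * (Sup B - Inf B)}"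
proof -
  have "(Inf B + Sup B) / 2 - (1 + 2 * \<delta>) * ((Sup B - Inf B) / 2) = Inf B - \<delta> * (Sup B - Inf B)"
    "(Inf B + Sup B) / 2 + (1 + 2 * \<delta>) * ((Sup B - Inf B) / 2) = Sup B + \<delta> * (Sup B - Inf B)"
    by (simp_all add: field_simps)
  then show ?thesis unfolding scale_interval_def Let_def by simp
qed

lemma has_space_mono:
  assumes "has_space X \<delta> B A" "\<delta>' \<le> \<delta>" "Inf B \<le> Sup B"
  shows "has_space X \<delta>' B A"
proof -
  have "\<delta>' * (Sup B - Inf B) \<le> \<delta> * (Sup B - Inf B)" using assms(2,3) by (intro mult_right_mono) auto
  then have "scale_interval (1 + 2 * \<delta>') B \<subseteq> scale_interval (1 + 2 * \<delta>) B"
    unfolding scale_interval_eq by auto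
  then show ?thesis using assms(1) unfolding has_space_def by blast
qed

lemma boundary_point_between:
  fixes A :: "real set"
  assumes "openin (top_of_set X) A" "closed_segment b s \<subseteq> X" "b \<in> A" "s \<notin> A"
  shows "\<exists>\<tau>\<in>closed_segment b s. \<tau> \<in> closure A - A"
proof (rule ccontr)
  assume neg: "\<not> ?thesis"
  let ?S = "closed_segment b s"
  obtain U where U: "open U" "A = X \<inter> U" using assms(1) by (meson openin_open)
  have 1: "openin (top_of_set ?S) (?S \<inter> A)"
    using U assms(2) by (metis Int_absorb2 inf_assoc openin_open)
  have "?S \<inter> A = ?S \<inter> closure A" using neg closure_subset by blast
  then have 2: "closedin (top_of_set ?S) (?S \<inter> A)" by (metis closed_closure closedin_closed)
  have "connected ?S" by simp
  with 1 2 have "?S \<inter> A = {} \<or> ?S \<inter> A = ?S" unfolding connected_clopen by blast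
  then show False using assms(3,4) by (metis IntD2 IntI disjoint_iff ends_in_segment)
qed

lemma interval_between_Inf_Sup:
  fixes B :: "real set"
  assumes "is_interval B" "Inf B < t" "t < Sup B" "B \<noteq> {}"
  shows "t \<in> B"
proof -
  obtain a where "a \<in> B" "a < t" using cInf_lessD[OF assms(4,2)] by blast
  moreover obtain b where "b \<in> B" "t < b" using less_cSupD[OF assms(4,3)] by blast
  ultimately show ?thesis using assms(1) unfolding is_interval_1 by (meson less_imp_le)
qed

context
  fixes X :: "real set" and lo hi :: real
  assumes X: "is_interval X" and lohi: "lo < hi" "{lo..hi} \<subseteq> X"
begin

lemma rel_interval_bounds:
  assumes A: "rel_interval X {lo..hi} A"
  shows "lo \<le> Inf A" "Inf A < Sup A" "Sup A \<le> hi" "A \<subseteq> {Inf A..Sup A}" "closure A \<subseteq> {lo..hi}"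
    "Inf A \<in> closure A" "Sup A \<in> closure A"
proof -
  have ne: "A \<noteq> {}" and sub: "A \<subseteq> {lo..hi}" and op: "openin (top_of_set X) A" using A by (auto simp: rel_interval_def)
  have bdd: "bdd_below A" "bdd_above A" using sub by (auto intro: bdd_below_mono bdd_above_mono)
  show "lo \<le> Inf A" using ne sub by (intro cInf_greatest) auto
  show "Sup A \<le> hi" using ne sub by (intro cSup_least) auto
  show "A \<subseteq> {Inf A..Sup A}" using bdd by (auto intro: cInf_lower cSup_upper)
  show "closure A \<subseteq> {lo..hi}" using sub by (intro closure_minimal) auto
  show "Inf A \<in> closure A" "Sup A \<in> closure A" using ne bdd by (simp_all add: closure_contains_Inf closure_contains_Sup)
  obtain a where a: "a \<in> A" using ne by blast
  obtain U where U: "open U" "A = X \<inter> U" using op by (meson openin_open)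
  then obtain e where e: "e > 0" "ball a e \<subseteq> U" using a by (meson IntD2 open_contains_ball)
  have "\<exists>a'\<in>A. a' \<noteq> a"
  proof (cases "a < hi")
    case True
    define a' where "a' = a + min (e / 2) (hi - a)"
    have "a' \<in> ball a e" "a' \<in> {lo..hi}" "a' \<noteq> a" using e True a sub by (auto simp: a'_def dist_real_def min_def)
    then show ?thesis using U e lohi(2) by blast
  next
    case False
    then have "a = hi" using a sub by fastforce
    define a' where "a' = a - min (e / 2) (hi - lo)"
    have "a' \<in> ball a e" "a' \<in> {lo..hi}" "a' \<noteq> a" using e lohi(1) \<open>a = hi\<close> by (auto simp: a'_def dist_real_def min_def)
    then show ?thesis using U e lohi(2) by blast
  qed
  then obtain a' where a': "a' \<in> A" "a' \<noteq> a" by blast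
  show "Inf A < Sup A"
    using cInf_lower[OF a bdd(1)] cSup_upper[OF a bdd(2)] cInf_lower[OF a'(1) bdd(1)] cSup_upper[OF a'(1) bdd(2)] a'(2) by linarith
qed

lemma rel_interval_open:
  assumes A: "rel_interval X {lo..hi} A" and nin: "lo \<notin> A" "hi \<notin> A"
  shows "A = {Inf A<..<Sup A}"
proof -
  have sub: "A \<subseteq> {lo..hi}" and int: "is_interval A" "A \<noteq> {}" using A by (auto simp: rel_interval_def)
  obtain U where U: "open U" "A = X \<inter> U" using A by (meson openin_open rel_interval_def)
  have sub2: "A \<subseteq> {lo<..<hi}"
  proof
    fix x assume x: "x \<in> A"
    then have "x \<noteq> lo" "x \<noteq> hi" "lo \<le> x" "x \<le> hi" using nin sub by auto
    then show "x \<in> {lo<..<hi}" by simp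
  qed
  then have "A = {lo<..<hi} \<inter> U" using U(2) lohi(2) by (auto simp: subset_eq)
  then have "open A" using U(1) by (simp add: open_Int)
  note bd = rel_interval_bounds[OF A]
  show ?thesis
  proof (intro equalityI subsetI)
    fix x assume x: "x \<in> A"
    then obtain e where e: "e > 0" "ball x e \<subseteq> A" using \<open>open A\<close> by (meson open_contains_ball)
    have "x - e/2 \<in> A" "x + e/2 \<in> A" using e by (auto intro!: subsetD[OF e(2)] simp: dist_real_def)
    then have "Inf A \<le> x - e/2" "x + e/2 \<le> Sup A" using bd(4) by auto
    then show "x \<in> {Inf A<..<Sup A}" using e(1) by auto
  next
    fix x assume "x \<in> {Inf A<..<Sup A}"
    then show "x \<in> A" using interval_between_Inf_Sup[OF int(1) _ _ int(2)] by simp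
  qed
qed

text \<open>If the space around \<open>B\<close> were too small, a boundary point \<open>\<tau>\<close> of \<open>A\<close> would lie within distance
  \<open>t * l\<close> of \<open>B\<close>, with \<open>l\<close> the length of \<open>B\<close> and \<open>t < \<rho>\<close>. Its image is outside \<open>A'\<close>, so \<open>h\<close> moves by at
  least \<open>\<epsilon>\<close> times the length of \<open>B'\<close> between \<open>B\<close> and \<open>\<tau>\<close>, while the oscillation on \<open>B\<close> is at most this
  length. This contradicts the growth bound.\<close>

lemma one_step_space:
  assumes A: "rel_interval X {lo..hi} A" and B: "rel_interval X {lo..hi} B" "B \<subseteq> A" and B': "rel_interval X {lo..hi} B'"
    and step: "pullback_step X h A B A' B'" and cont: "continuous_on {lo..hi} h"
    and growth: "growth_bound lo hi C n h"
    and space: "has_space X \<epsilon> B' A'" and \<rho>: "\<And>t. t \<ge> 0 \<Longrightarrow> \<epsilon> \<le> C * (t * (1 + t) ^ n) \<Longrightarrow> \<rho> \<le> t"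
  shows "has_space X \<rho> B A"
  unfolding has_space_def
proof (rule subsetI, rule ccontr)
  fix s assume s: "s \<in> scale_interval (1 + 2 * \<rho>) B \<inter> X" and sA: "s \<notin> A"
  note bA = rel_interval_bounds[OF A] and bB = rel_interval_bounds[OF B(1)] and bB' = rel_interval_bounds[OF B']
  define l u \<omega> where "l = Inf B" "u = Sup B" "\<omega> = Sup B' - Inf B'"
  have lu: "l < u" "{l..u} \<subseteq> {lo..hi}" using bB by (auto simp: l_u_\<omega>_def)
  have w: "\<omega> > 0" using bB' by (simp add: l_u_\<omega>_def)
  have Bint: "is_interval B" "B \<noteq> {}" using B(1) by (auto simp: rel_interval_def)
  have inB: "t \<in> B" if "l < t" "t < u" for t
    using interval_between_Inf_Sup[OF Bint(1) _ _ Bint(2)] that by (simp add: l_u_\<omega>_def)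
  \<comment> \<open>\<open>h\<close> maps the closure of \<open>B\<close> into that of \<open>B'\<close>\<close>
  have cl: "{l..u} \<subseteq> closure B"
  proof
    fix t assume t: "t \<in> {l..u}"
    consider "t = l" | "t = u" | "l < t" "t < u" using t by fastforce
    then show "t \<in> closure B"
      using bB(6,7) inB closure_subset[of B] by cases (auto simp: l_u_\<omega>_def)
  qed
  have "h ` closure B \<subseteq> closure (h ` B)"
    by (rule continuous_image_closure_subset[OF continuous_on_subset[OF cont bB(5)]]) simp
  also have "\<dots> \<subseteq> {Inf B'..Sup B'}"
    using step bB'(4) unfolding pullback_step_def by (intro closure_minimal) auto
  finally have img: "h t \<in> {Inf B'..Sup B'}" if "t \<in> {l..u}" for t using cl that by blast
  have osc: "osc_le h {l..u} \<omega>"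
    unfolding osc_le_def
  proof (intro ballI)
    fix s t assume "s \<in> {l..u}" "t \<in> {l..u}"
    from img[OF this(1)] img[OF this(2)] show "\<bar>h s - h t\<bar> \<le> \<omega>" by (auto simp: l_u_\<omega>_def)
  qed
  obtain b where b: "b \<in> B" using Bint by blast
  then have bA': "b \<in> A" "b \<in> X" using B A lohi by (auto simp: rel_interval_def)
  have "closed_segment b s \<subseteq> X" using X bA' s by (simp add: closed_segment_subset is_interval_convex)
  moreover have "openin (top_of_set X) A" using A by (simp add: rel_interval_def)
  ultimately obtain \<tau> where \<tau>: "\<tau> \<in> closed_segment b s" "\<tau> \<in> closure A - A"
    using boundary_point_between[OF _ _ bA'(1) sA] by blast
  have \<tau>I: "\<tau> \<in> {lo..hi}" using \<tau>(2) bA(5) by blast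
  have "h \<tau> \<in> X - A'" using step \<tau>(2) by (auto simp: pullback_step_def)
  then have out: "h \<tau> \<notin> scale_interval (1 + 2 * \<epsilon>) B'" using space unfolding has_space_def by blast
  have \<tau>B: "\<tau> \<notin> B" using \<tau>(2) B(2) by blast
  then have \<tau>b: "\<tau> \<noteq> b" using b by blast
  have lbu: "l \<le> b" "b \<le> u" using bB(4) b by (auto simp: l_u_\<omega>_def)
  have s': "l - \<rho> * (u - l) < s" "s < u + \<rho> * (u - l)" using s by (auto simp: scale_interval_eq l_u_\<omega>_def)
  \<comment> \<open>the endpoint of \<open>B\<close> nearest to \<open>\<tau>\<close>\<close>
  obtain \<beta> where \<beta>: "\<beta> \<in> {l..u}" "\<bar>\<tau> - \<beta>\<bar> < \<rho> * (u - l)"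
  proof (cases "u \<le> \<tau>")
    case True
    then have "\<tau> \<le> s" using \<tau>(1) \<tau>b lbu by (auto simp: closed_segment_eq_real_ivl split: if_splits)
    then show ?thesis using that[of u] s' lu True by simp
  next
    case False
    then have "\<tau> \<le> l" using inB \<tau>B by force
    then have "s \<le> \<tau>" using \<tau>(1) \<tau>b lbu by (auto simp: closed_segment_eq_real_ivl split: if_splits)
    then show ?thesis using that[of l] s' lu \<open>\<tau> \<le> l\<close> by simp
  qed
  define t where "t = \<bar>\<tau> - \<beta>\<bar> / (u - l)"
  have t: "t \<ge> 0" "\<bar>\<tau> - \<beta>\<bar> \<le> t * (u - l)" "t < \<rho>" using lu \<beta>(2) by (auto simp: t_def pos_divide_less_eq)
  have "\<epsilon> * \<omega> \<le> \<bar>h \<tau> - h \<beta>\<bar>"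
    using out img[OF \<beta>(1)] unfolding scale_interval_eq by (auto simp: l_u_\<omega>_def)
  also have "\<dots> \<le> C * (t * (1 + t) ^ n) * \<omega>" using growth lu osc \<beta>(1) \<tau>I t(2) unfolding growth_bound_def by blast
  finally have "\<epsilon> \<le> C * (t * (1 + t) ^ n)" using w by simp
  from \<rho>[OF t(1) this] t(3) show False by simp
qed

lemma interval_eq_Ioo:
  fixes A :: "real set"
  assumes "is_interval A" "{p<..<q} \<subseteq> A" "p < q" "p \<notin> A" "q \<notin> A"
  shows "A = {p<..<q}" "Inf A = p" "Sup A = q"
proof -
  have m: "(p + q) / 2 \<in> A" using assms(2,3) by (auto simp: subset_eq)
  show eq: "A = {p<..<q}"
  proof (intro equalityI subsetI)
    fix x assume x: "x \<in> A"
    show "x \<in> {p<..<q}"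
    proof (rule ccontr)
      assume "x \<notin> {p<..<q}"
      then consider "x \<le> p" | "q \<le> x" by fastforce
      then show False
      proof cases
        case 1
        then have "p \<in> {x..(p + q) / 2}" using assms(3) by simp
        then show False using interval_Icc_subset[OF assms(1) x m] assms(4) by blast
      next
        case 2
        then have "q \<in> {(p + q) / 2..x}" using assms(3) by simp
        then show False using interval_Icc_subset[OF assms(1) m x] assms(5) by blast
      qed
    qed
  qed (use assms(2) in blast)
  show "Inf A = p" "Sup A = q" unfolding eq using assms(3) by simp_all
qed

lemma monotone_image_Ioo:
  fixes h :: "real \<Rightarrow> real"
  assumes "continuous_on {p..q} h" "p < q" "y \<in> {h p<..<h q}"
  shows "\<exists>x\<in>{p<..<q}. h x = y"
proof -
  obtain x where x: "p \<le> x" "x \<le> q" "h x = y" using IVT'[of h p y q] assms by auto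
  then have "x \<noteq> p" "x \<noteq> q" using assms(3) by auto
  then show ?thesis using x by (intro bexI[of _ x]) auto
qed

abbreviation gap_log :: "real set \<Rightarrow> real set \<Rightarrow> real" where
  "gap_log A B \<equiv> cross_log (Inf A) (Inf B) (Sup B) (Sup A)"

text \<open>A monotone map takes the ends of \<open>A\<close> to points outside \<open>A'\<close> and everything in between into \<open>A'\<close>;
  hence it maps \<open>A\<close> onto \<open>A'\<close>, and likewise \<open>B\<close> onto \<open>B'\<close>.\<close>

lemma diffeo_step_increasing:
  assumes A: "rel_interval X {lo..hi} A" and B: "rel_interval X {lo..hi} B" "B \<subseteq> A"
    and A': "is_interval A'" and B': "is_interval B'" and img: "h ` A \<subseteq> A'" "h ` B \<subseteq> B'"
    and bdA: "\<And>t. t \<in> closure A - A \<Longrightarrow> h t \<notin> A'" and bdB: "\<And>t. t \<in> closure B - B \<Longrightarrow> h t \<notin> B'"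
    and cont: "continuous_on {lo..hi} h" and nin: "lo \<notin> A" "hi \<notin> A"
    and der: "\<And>x. x \<in> A \<Longrightarrow> (h has_real_derivative u x) (at x)" and pos: "\<And>x. x \<in> A \<Longrightarrow> u x > 0"
    and ker: "\<And>x y. x \<in> A \<Longrightarrow> y \<in> A \<Longrightarrow> x < y \<Longrightarrow> \<bar>u x * u y\<bar> * (y - x)\<^sup>2 \<le> q * (h y - h x)\<^sup>2"
  shows "gap_log A' B' \<le> q * gap_log A B" "Inf A' = h (Inf A)" "Sup A' = h (Sup A)" "A' = {Inf A'<..<Sup A'}"
proof -
  note bA = rel_interval_bounds[OF A] and bB = rel_interval_bounds[OF B(1)]
  have ninB: "lo \<notin> B" "hi \<notin> B" using nin B(2) by auto
  have memA: "x \<in> A \<longleftrightarrow> Inf A < x \<and> x < Sup A" for x by (subst rel_interval_open[OF A nin]) simp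
  have memB: "x \<in> B \<longleftrightarrow> Inf B < x \<and> x < Sup B" for x by (subst rel_interval_open[OF B(1) ninB]) simp
  have "closure B \<subseteq> {Inf A..Sup A}" using B(2) bA(4) by (intro closure_minimal) auto
  then have le: "Inf A \<le> Inf B" "Sup B \<le> Sup A" using bB(6,7) by auto
  have contA: "continuous_on {Inf A..Sup A} h" by (rule continuous_on_subset[OF cont]) (use bA in auto)
  have mono: "h x < h y" if "Inf A \<le> x" "x < y" "y \<le> Sup A" for x y
  proof (rule DERIV_pos_imp_increasing_open[OF that(2)])
    fix z assume "x < z" "z < y"
    then have "z \<in> A" using that by (simp add: memA)
    then show "\<exists>d. (h has_real_derivative d) (at z) \<and> d > 0" using der pos by blast
  next
    show "continuous_on {x..y} h" by (rule continuous_on_subset[OF contA]) (use that in auto)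
  qed
  have notA: "h (Inf A) \<notin> A'" "h (Sup A) \<notin> A'"
  proof -
    have "Inf A \<in> closure A - A" "Sup A \<in> closure A - A" using bA(6,7) by (simp_all add: memA)
    then show "h (Inf A) \<notin> A'" "h (Sup A) \<notin> A'" by (simp_all add: bdA)
  qed
  have notB: "h (Inf B) \<notin> B'" "h (Sup B) \<notin> B'"
  proof -
    have "Inf B \<in> closure B - B" "Sup B \<in> closure B - B" using bB(6,7) by (simp_all add: memB)
    then show "h (Inf B) \<notin> B'" "h (Sup B) \<notin> B'" by (simp_all add: bdB)
  qed
  have ltA: "h (Inf A) < h (Sup A)" using mono bA(2) by simp
  have ltB: "h (Inf B) < h (Sup B)" using mono bB(2) le by simp
  have "{h (Inf A)<..<h (Sup A)} \<subseteq> h ` A"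
  proof
    fix y assume "y \<in> {h (Inf A)<..<h (Sup A)}"
    from monotone_image_Ioo[OF contA bA(2) this] obtain x where "Inf A < x" "x < Sup A" "h x = y" by auto
    then show "y \<in> h ` A" using memA by blast
  qed
  then have subA: "{h (Inf A)<..<h (Sup A)} \<subseteq> A'" using img by blast
  have contB: "continuous_on {Inf B..Sup B} h" by (rule continuous_on_subset[OF contA]) (use le in auto)
  have "{h (Inf B)<..<h (Sup B)} \<subseteq> h ` B"
  proof
    fix y assume "y \<in> {h (Inf B)<..<h (Sup B)}"
    from monotone_image_Ioo[OF contB bB(2) this] obtain x where "Inf B < x" "x < Sup B" "h x = y" by auto
    then show "y \<in> h ` B" using memB by blast
  qed
  then have subB: "{h (Inf B)<..<h (Sup B)} \<subseteq> B'" using img by blast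
  note eA = interval_eq_Ioo[OF A' subA ltA notA] and eB = interval_eq_Ioo[OF B' subB ltB notB]
  show "Inf A' = h (Inf A)" "Sup A' = h (Sup A)" by (rule eA)+
  show "A' = {Inf A'<..<Sup A'}" using eA by simp
  show "gap_log A' B' \<le> q * gap_log A B"
    unfolding eA(2,3) eB(2,3)
  proof (rule cross_log_distortion[OF le(1) bB(2) le(2) contA])
    fix x assume "Inf A < x" "x < Sup A"
    then show "(h has_real_derivative u x) (at x)" by (intro der) (simp add: memA)
  next
    fix x y assume "Inf A < x" "x < y" "y < Sup A"
    then have "x \<in> A" "y \<in> A" by (simp_all add: memA)
    then show "u x * u y * (y - x)\<^sup>2 \<le> q * (h y - h x)\<^sup>2"
      using ker[of x y] \<open>x < y\<close> pos[of x] pos[of y] by (simp add: abs_mult)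
  qed (rule mono)
qed

lemma Inf_Sup_uminus:
  fixes A :: "real set"
  shows "Inf (uminus ` A) = - Sup A" "Sup (uminus ` A) = - Inf A"
proof -
  show "Inf (uminus ` A) = - Sup A" by (simp add: Inf_real_def image_image)
  then show "Sup (uminus ` A) = - Inf A" by (simp add: Inf_real_def)
qed

lemma diffeo_step:
  assumes A: "rel_interval X {lo..hi} A" and B: "rel_interval X {lo..hi} B" "B \<subseteq> A"
    and A': "is_interval A'" and B': "is_interval B'" and step: "pullback_step X h A B A' B'"
    and cont: "continuous_on {lo..hi} h" and nin: "lo \<notin> A" "hi \<notin> A"
    and der: "\<And>x. x \<in> A \<Longrightarrow> (h has_real_derivative u x) (at x)" and contu: "continuous_on A u"
    and nz: "\<And>x. x \<in> A \<Longrightarrow> u x \<noteq> 0"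
    and ker: "\<And>x y. x \<in> A \<Longrightarrow> y \<in> A \<Longrightarrow> x < y \<Longrightarrow> \<bar>u x * u y\<bar> * (y - x)\<^sup>2 \<le> q * (h y - h x)\<^sup>2"
  shows "gap_log A' B' \<le> q * gap_log A B" "Inf A' \<in> X" "Sup A' \<in> X" "A' = {Inf A'<..<Sup A'}"
proof -
  note bA = rel_interval_bounds[OF A]
  have img: "h ` A \<subseteq> A'" "h ` B \<subseteq> B'" and bdA: "\<And>t. t \<in> closure A - A \<Longrightarrow> h t \<in> X - A'"
    and bdB: "\<And>t. t \<in> closure B - B \<Longrightarrow> h t \<notin> B'"
    using step by (auto simp: pullback_step_def)
  have memA: "x \<in> A \<longleftrightarrow> Inf A < x \<and> x < Sup A" for x by (subst rel_interval_open[OF A nin]) simp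
  have "Inf A \<in> closure A - A" "Sup A \<in> closure A - A" using bA(6,7) by (simp_all add: memA)
  then have hX: "h (Inf A) \<in> X" "h (Sup A) \<in> X" using bdA by blast+
  have sgn: "(\<forall>t\<in>A. u t > 0) \<or> (\<forall>t\<in>A. u t < 0)"
  proof (rule ccontr)
    assume "\<not> ?thesis"
    then obtain a b where ab: "a \<in> A" "b \<in> A" "u a \<le> 0" "0 \<le> u b" by (auto simp: not_less)
    have "connected (u ` A)"
      by (rule connected_continuous_image[OF contu]) (use A in \<open>simp add: is_interval_connected rel_interval_def\<close>)
    then have "0 \<in> u ` A" using ab unfolding connected_iff_interval by blast
    then show False using nz by force
  qed
  then have "gap_log A' B' \<le> q * gap_log A B \<and> Inf A' \<in> X \<and> Sup A' \<in> X \<and> A' = {Inf A'<..<Sup A'}"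
  proof
    assume "\<forall>t\<in>A. u t > 0"
    then have pos: "u t > 0" if "t \<in> A" for t using that by blast
    have bdA': "h t \<notin> A'" if "t \<in> closure A - A" for t using bdA[OF that] by blast
    note * = diffeo_step_increasing[OF A B A' B' img bdA' bdB cont nin der pos ker]
    have "Inf A' \<in> X" "Sup A' \<in> X" using hX *(2,3) by simp_all
    then show ?thesis by (intro conjI *(1) *(4))
  next
    assume neg: "\<forall>t\<in>A. u t < 0"
    \<comment> \<open>a decreasing map is an increasing one followed by a reflection\<close>
    have inj: "inj (uminus :: real \<Rightarrow> real)" by simp
    have bdA': "- h t \<notin> uminus ` A'" if "t \<in> closure A - A" for t
      using bdA[OF that] by (simp add: inj_image_mem_iff[OF inj])
    have bdB': "- h t \<notin> uminus ` B'" if "t \<in> closure B - B" for t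
      using bdB[OF that] by (simp add: inj_image_mem_iff[OF inj])
    have int: "is_interval (uminus ` A')" "is_interval (uminus ` B')"
      using A' B' by simp_all
    have img': "(\<lambda>t. - h t) ` A \<subseteq> uminus ` A'" "(\<lambda>t. - h t) ` B \<subseteq> uminus ` B'" using img by auto
    have der': "((\<lambda>t. - h t) has_real_derivative - u x) (at x)" if "x \<in> A" for x using der[OF that] by (rule DERIV_minus)
    have pos: "- u x > 0" if "x \<in> A" for x using neg that by simp
    have ker': "\<bar>- u x * - u y\<bar> * (y - x)\<^sup>2 \<le> q * (- h y - - h x)\<^sup>2" if "x \<in> A" "y \<in> A" "x < y" for x y
    proof -
      have "(- h y - - h x)\<^sup>2 = (h y - h x)\<^sup>2" by (simp add: power2_commute)
      then show ?thesis using ker[OF that] by simp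
    qed
    have cont': "continuous_on {lo..hi} (\<lambda>t. - h t)" using cont by (rule continuous_on_minus)
    note * = diffeo_step_increasing[OF A B int img' bdA' bdB' cont' nin der' pos ker', unfolded Inf_Sup_uminus]
    have 1: "gap_log A' B' \<le> q * gap_log A B" using *(1) unfolding cross_log_reflect .
    have 2: "Sup A' = h (Inf A)" "Inf A' = h (Sup A)" using *(2,3) by simp_all
    have "x \<in> A' \<longleftrightarrow> Inf A' < x \<and> x < Sup A'" for x
    proof -
      have "x \<in> A' \<longleftrightarrow> - x \<in> uminus ` A'" by (simp add: inj_image_mem_iff[OF inj])
      also have "\<dots> \<longleftrightarrow> Inf A' < x \<and> x < Sup A'" by (subst *(4)) auto
      finally show ?thesis .
    qed
    then have 3: "A' = {Inf A'<..<Sup A'}" by (intro set_eqI) (simp only: greaterThanLessThan_iff)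
    have "Inf A' \<in> X" "Sup A' \<in> X" using hX 2 by simp_all
    then show ?thesis by (intro conjI 1 3)
  qed
  then show "gap_log A' B' \<le> q * gap_log A B" "Inf A' \<in> X" "Sup A' \<in> X" "A' = {Inf A'<..<Sup A'}" by blast+
qed

text \<open>The logarithms of the cross ratios are compared along the run, and space is read off at both
  ends only. The last interval \<open>A k\<close> is open with ends in \<open>X\<close>, being a diffeomorphic image; so the space
  around \<open>B k\<close> is present on both sides even if \<open>X\<close> has endpoints.\<close>

lemma diffeo_run:
  assumes A: "\<And>j. j \<le> k \<Longrightarrow> rel_interval X {lo..hi} (A j)" and B: "\<And>j. j \<le> k \<Longrightarrow> rel_interval X {lo..hi} (B j)"
    and BA: "\<And>j. j \<le> k \<Longrightarrow> B j \<subseteq> A j"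
    and step: "\<And>j. i \<le> j \<Longrightarrow> j < k \<Longrightarrow> gap_log (A (Suc j)) (B (Suc j)) \<le> exp (\<eta> j) * gap_log (A j) (B j) \<and>
      Inf (A (Suc j)) \<in> X \<and> Sup (A (Suc j)) \<in> X \<and> A (Suc j) = {Inf (A (Suc j))<..<Sup (A (Suc j))}"
    and Ai: "A i = {Inf (A i)<..<Sup (A i)}"
    and ik: "i < k" and S: "sum \<eta> {i..<k} \<le> S" and \<epsilon>: "\<epsilon> > 0" and space: "has_space X \<epsilon> (B k) (A k)"
  shows "has_space X (exp (exp (- S) * ln (1 + \<epsilon>\<^sup>2 / (1 + 2 * \<epsilon>))) - 1) (B i) (A i)"
proof -
  have le: "Inf (A j) \<le> Inf (B j)" "Sup (B j) \<le> Sup (A j)" if "j \<le> k" for j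
  proof -
    have "closure (B j) \<subseteq> {Inf (A j)..Sup (A j)}"
      using BA[OF that] rel_interval_bounds(4)[OF A[OF that]] by (intro closure_minimal) auto
    then show "Inf (A j) \<le> Inf (B j)" "Sup (B j) \<le> Sup (A j)" using rel_interval_bounds(6,7)[OF B[OF that]] by auto
  qed
  have lt: "Inf (B j) < Sup (B j)" if "j \<le> k" for j by (rule rel_interval_bounds(2)[OF B[OF that]])
  have prod: "gap_log (A j) (B j) \<le> exp (sum \<eta> {i..<j}) * gap_log (A i) (B i)" if "i \<le> j" "j \<le> k" for j
    using that
  proof (induction j rule: dec_induct)
    case (step j)
    have "gap_log (A (Suc j)) (B (Suc j)) \<le> exp (\<eta> j) * gap_log (A j) (B j)"
      using assms(4)[of j] step by simp
    also have "\<dots> \<le> exp (\<eta> j) * (exp (sum \<eta> {i..<j}) * gap_log (A i) (B i))"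
      using step by (intro mult_left_mono) auto
    also have "\<dots> = exp (sum \<eta> {i..<Suc j}) * gap_log (A i) (B i)"
      using step by (simp add: exp_add mult_ac)
    finally show ?case .
  qed simp
  define r where "r = \<epsilon>\<^sup>2 / (1 + 2 * \<epsilon>)"
  have r: "r > 0" using \<epsilon> by (simp add: r_def add_pos_pos)
  obtain j where "k = Suc j" "i \<le> j" using ik by (metis less_imp_Suc_add le_add1 add_Suc_right)
  then have k: "Inf (A k) \<in> X" "Sup (A k) \<in> X" "A k = {Inf (A k)<..<Sup (A k)}" using step[of j] by auto
  have "Inf (A k) \<notin> A k" "Sup (A k) \<notin> A k" by (subst k(3), simp)+
  then have "Inf (A k) \<notin> scale_interval (1 + 2 * \<epsilon>) (B k)" "Sup (A k) \<notin> scale_interval (1 + 2 * \<epsilon>) (B k)"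
    using space k(1,2) unfolding has_space_def by blast+
  moreover have "0 < \<epsilon> * (Sup (B k) - Inf (B k))" using \<epsilon> lt[of k] by simp
  ultimately have "\<epsilon> * (Sup (B k) - Inf (B k)) \<le> Inf (B k) - Inf (A k)" "\<epsilon> * (Sup (B k) - Inf (B k)) \<le> Sup (A k) - Sup (B k)"
    using le[of k] lt[of k] unfolding scale_interval_eq by auto
  then have "ln (1 + r) \<le> gap_log (A k) (B k)" unfolding r_def using cross_log_ge[OF \<epsilon>] lt by simp
  also have "\<dots> \<le> exp (sum \<eta> {i..<k}) * gap_log (A i) (B i)" using prod ik by simp
  finally have 1: "ln (1 + r) \<le> exp (sum \<eta> {i..<k}) * gap_log (A i) (B i)" .
  have "ln (1 + r) > 0" using r by simp
  with 1 have g0: "gap_log (A i) (B i) > 0" by (metis exp_gt_zero less_le_trans zero_less_mult_pos)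
  have "exp (sum \<eta> {i..<k}) * gap_log (A i) (B i) \<le> exp S * gap_log (A i) (B i)"
    using S g0 by (intro mult_right_mono) auto
  with 1 have "ln (1 + r) \<le> exp S * gap_log (A i) (B i)" by linarith
  then have "exp (- S) * ln (1 + r) \<le> exp (- S) * (exp S * gap_log (A i) (B i))" by (intro mult_left_mono) auto
  also have "\<dots> = gap_log (A i) (B i)" by (simp add: exp_minus)
  finally have 2: "exp (- S) * ln (1 + r) \<le> gap_log (A i) (B i)" .
  define \<delta> where "\<delta> = exp (exp (- S) * ln (1 + r)) - 1"
  have \<delta>: "\<delta> \<ge> 0" "ln (1 + \<delta>) = exp (- S) * ln (1 + r)" using r by (auto simp: \<delta>_def)
  have "i \<le> k" using ik by simp
  note sp = space_of_cross_log[OF le(1)[OF this] lt[OF this] le(2)[OF this] 2[folded \<delta>(2)] \<delta>(1)]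
  have "scale_interval (1 + 2 * \<delta>) (B i) \<subseteq> {Inf (A i)<..<Sup (A i)}"
    unfolding scale_interval_eq using sp by auto
  then have "has_space X \<delta> (B i) (A i)" unfolding has_space_def using Ai by auto
  then show ?thesis by (simp add: \<delta>_def r_def)
qed

end

text \<open>The first term of the maximum is a bound for small \<open>\<epsilon>\<close>, using \<open>(1 + t) ^ n \<le> 2 ^ n\<close> for \<open>t \<le> 1\<close>. The
  second one tends to infinity; it comes from \<open>\<epsilon> \<le> C * (1 + t) ^ Suc n\<close> and \<open>ln (1 + t) \<le> t\<close>.\<close>

lemma one_step_loss:
  assumes C: "C > 0"
  shows "\<exists>\<rho>::real \<Rightarrow> real. (\<forall>\<epsilon>>0. \<rho> \<epsilon> > 0) \<and> filterlim \<rho> at_top at_top \<and>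
    (\<forall>\<epsilon>>0. \<forall>t\<ge>0. \<epsilon> \<le> C * (t * (1 + t) ^ n) \<longrightarrow> \<rho> \<epsilon> \<le> t)"
proof (intro exI conjI allI impI)
  let ?\<rho> = "\<lambda>\<epsilon>. max (min 1 (\<epsilon> / (C * 2 ^ n))) (ln (\<epsilon> / C) / real (Suc n))"
  show "0 < ?\<rho> \<epsilon>" if "\<epsilon> > 0" for \<epsilon>
    using that C by (simp add: less_max_iff_disj)
  have "filterlim (\<lambda>\<epsilon>. ln (inverse C * \<epsilon>) * inverse (real (Suc n))) at_top at_top"
    using C by (intro filterlim_at_top_mult_tendsto_pos[OF tendsto_const] filterlim_compose[OF ln_at_top]
      filterlim_tendsto_pos_mult_at_top[OF tendsto_const] filterlim_ident) auto
  then show "filterlim ?\<rho> at_top at_top"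
    by (rule filterlim_at_top_mono) (simp add: divide_inverse mult.commute)
  fix \<epsilon> t :: real assume \<epsilon>: "\<epsilon> > 0" and t: "t \<ge> 0" and le: "\<epsilon> \<le> C * (t * (1 + t) ^ n)"
  have "min 1 (\<epsilon> / (C * 2 ^ n)) \<le> t"
  proof (cases "t \<le> 1")
    case True
    have "(1 + t) ^ n \<le> 2 ^ n" using True t by (intro power_mono) auto
    then have "C * (t * (1 + t) ^ n) \<le> C * (t * 2 ^ n)" using C t by (intro mult_left_mono) auto
    with le have "\<epsilon> \<le> t * (C * 2 ^ n)" by (simp add: mult_ac)
    then show ?thesis using C by (simp add: min_le_iff_disj pos_divide_le_eq)
  qed simp
  moreover have "ln (\<epsilon> / C) / real (Suc n) \<le> t"
  proof -
    have "\<epsilon> / C \<le> t * (1 + t) ^ n" using le C by (simp add: pos_divide_le_eq mult.commute)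
    also have "\<dots> \<le> (1 + t) * (1 + t) ^ n" using t by (intro mult_right_mono) auto
    finally have "ln (\<epsilon> / C) \<le> ln ((1 + t) ^ Suc n)" using \<epsilon> C t by (intro ln_mono) auto
    also have "\<dots> = real (Suc n) * ln (1 + t)" by (rule ln_realpow)
    also have "\<dots> \<le> real (Suc n) * t" using t by (intro mult_left_mono ln_add_one_self_le_self) auto
    finally show ?thesis by (simp add: pos_divide_le_eq mult.commute)
  qed
  ultimately show "?\<rho> \<epsilon> \<le> t" by simp
qed

lemma run_loss_at_top:
  assumes c: "c > 0"
  shows "filterlim (\<lambda>\<epsilon>::real. exp (c * ln (1 + \<epsilon>\<^sup>2 / (1 + 2 * \<epsilon>))) - 1) at_top at_top"
proof -
  have "filterlim (\<lambda>\<epsilon>::real. inverse 3 * \<epsilon>) at_top at_top"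
    by (intro filterlim_tendsto_pos_mult_at_top[OF tendsto_const] filterlim_ident) auto
  moreover have "eventually (\<lambda>\<epsilon>::real. inverse 3 * \<epsilon> \<le> 1 + \<epsilon>\<^sup>2 / (1 + 2 * \<epsilon>)) at_top"
    using eventually_ge_at_top[of 1]
  proof eventually_elim
    case (elim \<epsilon>)
    have "\<epsilon> / 3 \<le> \<epsilon>\<^sup>2 / (1 + 2 * \<epsilon>)"
      using elim by (simp add: pos_le_divide_eq power2_eq_square distrib_left)
    then show ?case by (simp add: inverse_eq_divide)
  qed
  ultimately have "filterlim (\<lambda>\<epsilon>::real. 1 + \<epsilon>\<^sup>2 / (1 + 2 * \<epsilon>)) at_top at_top" by (rule filterlim_at_top_mono)
  from filterlim_compose[OF ln_at_top this]
  have "filterlim (\<lambda>\<epsilon>::real. c * ln (1 + \<epsilon>\<^sup>2 / (1 + 2 * \<epsilon>))) at_top at_top"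
    by (rule filterlim_tendsto_pos_mult_at_top[OF tendsto_const c])
  from filterlim_compose[OF exp_at_top this]
  have "filterlim (\<lambda>\<epsilon>::real. - 1 + exp (c * ln (1 + \<epsilon>\<^sup>2 / (1 + 2 * \<epsilon>)))) at_top at_top"
    by (rule filterlim_tendsto_add_at_top[OF tendsto_const])
  then show ?thesis by simp
qed

lemma iterated_loss:
  fixes g :: "real \<Rightarrow> real"
  assumes pos: "\<And>\<epsilon>. \<epsilon> > 0 \<Longrightarrow> g \<epsilon> > 0" and lim: "filterlim g at_top at_top"
  shows "\<epsilon> > 0 \<Longrightarrow> (g ^^ k) \<epsilon> > 0" "filterlim (g ^^ k) at_top at_top"
proof -
  show "(g ^^ k) \<epsilon> > 0" if "\<epsilon> > 0" using that by (induction k) (auto intro: pos)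
  show "filterlim (g ^^ k) at_top at_top"
  proof (induction k)
    case 0 then show ?case by (simp add: filterlim_ident id_def)
  next
    case (Suc k) then show ?case using filterlim_compose[OF lim] by (simp add: o_def)
  qed
qed

definition real_chain :: "real set \<Rightarrow> real set \<Rightarrow> (nat \<Rightarrow> real \<Rightarrow> real) \<Rightarrow> nat \<Rightarrow> (nat \<Rightarrow> real set) \<Rightarrow> (nat \<Rightarrow> real set) \<Rightarrow> bool" where
  "real_chain X I h m A B \<longleftrightarrow>
    (\<forall>j\<le>m. rel_interval X I (A j) \<and> rel_interval X I (B j) \<and> B j \<subseteq> A j) \<and>
    (\<forall>j<m. pullback_step X (h j) (A j) (B j) (A (Suc j)) (B (Suc j)))"

text \<open>Steps whose interval avoids \<open>Z\<close> are diffeomorphisms with summable distortion. At most \<open>N * M\<close> steps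
  are of the other kind, since each point of \<open>Z\<close> lies in at most \<open>N\<close> of the intervals. Induction on
  their number, starting from the end of the chain: a run costs one application of \<open>g\<close>, and so does
  a single step of the other kind.\<close>

lemma real_chain_space:
  assumes X: "is_interval X" and lohi: "lo < hi" "{lo..hi} \<subseteq> X" and C: "C > 0"
    and \<rho>1: "\<And>\<epsilon> t. \<epsilon> > 0 \<Longrightarrow> t \<ge> 0 \<Longrightarrow> \<epsilon> \<le> C * (t * (1 + t) ^ n) \<Longrightarrow> \<rho>1 \<epsilon> \<le> t"
    and g_def: "\<And>\<epsilon>. g \<epsilon> = min \<epsilon> (min (\<rho>1 \<epsilon>) (exp (exp (- (2 ^ M * (2 * real N * C))) * ln (1 + \<epsilon>\<^sup>2 / (1 + 2 * \<epsilon>))) - 1))"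
    and gpos: "\<And>\<epsilon>. \<epsilon> > 0 \<Longrightarrow> g \<epsilon> > 0"
    and D: "deriv_seq {lo..hi} D"
    and growth: "growth_bound lo hi C n (D 0)"
    and pieces: "piecewise lo hi M (D 1) (\<lambda>J. distortion_bound D J C)"
    and chain: "real_chain X {lo..hi} (\<lambda>j t. D 0 t - s j) m A B"
    and N: "\<And>t. card {j\<in>{0..m}. t \<in> A j} \<le> N"
    and \<epsilon>: "\<epsilon> > 0" and space: "has_space X \<epsilon> (B m) (A m)"
  shows "has_space X ((g ^^ (Suc (2 * (N * M)))) \<epsilon>) (B 0) (A 0)"
proof -
  obtain Z where Z: "finite Z" "card Z \<le> M" "{lo, hi} \<subseteq> Z" "{t\<in>{lo..hi}. D 1 t = 0} \<subseteq> Z"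
    and dist: "\<And>J. is_interval J \<Longrightarrow> J \<subseteq> {lo..hi} \<Longrightarrow> J \<inter> Z = {} \<Longrightarrow> distortion_bound D J C"
    using pieces unfolding piecewise_def by blast
  have A: "rel_interval X {lo..hi} (A j)" and B: "rel_interval X {lo..hi} (B j)" and BA: "B j \<subseteq> A j" if "j \<le> m" for j
    using chain that by (auto simp: real_chain_def)
  have step: "pullback_step X (\<lambda>t. D 0 t - s j) (A j) (B j) (A (Suc j)) (B (Suc j))" if "j < m" for j
    using chain that by (auto simp: real_chain_def)
  have cont: "continuous_on {lo..hi} (\<lambda>t. D 0 t - s j)" for j
    by (intro continuous_intros deriv_seq_continuous[OF D])
  have gle: "g \<epsilon> \<le> \<epsilon>" "g \<epsilon> \<le> \<rho>1 \<epsilon>" for \<epsilon> by (auto simp: g_def)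
  have gitpos: "(g ^^ k) \<epsilon> > 0" for k using \<epsilon> by (induction k) (auto intro: gpos)
  have gmono: "(g ^^ l) \<epsilon> \<le> (g ^^ k) \<epsilon>" if "k \<le> l" for k l
    using that by (induction l rule: dec_induct) (auto intro: order_trans[OF gle(1)])
  define good where "good = {j\<in>{0..<m}. A j \<inter> Z = {}}"
  have int: "A j \<noteq> {} \<and> is_interval (A j) \<and> A j \<subseteq> {lo..hi} \<and> A j \<inter> Z = {}" if "j \<in> good" for j
    using that A[of j] by (auto simp: good_def rel_interval_def)
  have Ngood: "card {j\<in>good. t \<in> A j} \<le> N" for t
  proof -
    have "card {j\<in>good. t \<in> A j} \<le> card {j\<in>{0..m}. t \<in> A j}" by (intro card_mono) (auto simp: good_def)
    then show ?thesis using N[of t] by linarith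
  qed
  have "finite good" by (simp add: good_def)
  from distortion_sum[OF this Z(1) less_imp_le[OF C] dist int Ngood] obtain \<eta> where
    \<eta>: "\<And>j. j \<in> good \<Longrightarrow> 0 \<le> \<eta> j" and
    ker: "\<And>j. j \<in> good \<Longrightarrow> distortion_at_most D (A j) (\<eta> j)" and
    sum: "sum \<eta> good \<le> 2 ^ card Z * (2 * N * C)" by blast
  have "2 ^ card Z * (2 * N * C) \<le> 2 ^ M * (2 * N * C)"
    using Z(2) C by (intro mult_right_mono power_increasing) auto
  with sum have sum': "sum \<eta> good \<le> 2 ^ M * (2 * real N * C)" by simp
  have openA: "A j = {Inf (A j)<..<Sup (A j)}" if "j \<in> good" for j
    by (rule rel_interval_open[OF X lohi A]) (use that Z(3) in \<open>auto simp: good_def\<close>)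
  have diffeo: "cross_log (Inf (A (Suc j))) (Inf (B (Suc j))) (Sup (B (Suc j))) (Sup (A (Suc j))) \<le>
        exp (\<eta> j) * cross_log (Inf (A j)) (Inf (B j)) (Sup (B j)) (Sup (A j)) \<and>
      Inf (A (Suc j)) \<in> X \<and> Sup (A (Suc j)) \<in> X \<and> A (Suc j) = {Inf (A (Suc j))<..<Sup (A (Suc j))}"
    if j: "j \<in> good" for j
  proof -
    have jm: "j < m" "j \<le> m" "Suc j \<le> m" and disj: "A j \<inter> Z = {}" using j by (auto simp: good_def)
    have subA: "A j \<subseteq> {lo..hi}" and nin: "lo \<notin> A j" "hi \<notin> A j" using A[OF jm(2)] disj Z(3) by (auto simp: rel_interval_def)
    have isi: "is_interval (A (Suc j))" "is_interval (B (Suc j))" using A[OF jm(3)] B[OF jm(3)] by (auto simp: rel_interval_def)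
    have memA: "x \<in> A j \<longleftrightarrow> Inf (A j) < x \<and> x < Sup (A j)" for x by (subst openA[OF j]) simp
    have bds: "{Inf (A j)..Sup (A j)} \<subseteq> {lo..hi}" using rel_interval_bounds[OF X lohi A[OF jm(2)]] by auto
    have der: "((\<lambda>t. D 0 t - s j) has_real_derivative D 1 x) (at x)" if "x \<in> A j" for x
    proof -
      have "(D 0 has_real_derivative D (Suc 0) x) (at x)"
        by (rule deriv_seq_at[OF D bds]) (use that memA in auto)
      then have "((\<lambda>t. D 0 t - s j) has_real_derivative D (Suc 0) x - 0) (at x)" by (intro DERIV_diff DERIV_const)
      then show ?thesis by simp
    qed
    have nz: "D 1 x \<noteq> 0" if "x \<in> A j" for x using disj Z(4) subA that by blast
    have ker': "\<bar>D 1 x * D 1 y\<bar> * (y - x)\<^sup>2 \<le> exp (\<eta> j) * ((D 0 y - s j) - (D 0 x - s j))\<^sup>2"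
      if "x \<in> A j" "y \<in> A j" "x < y" for x y using ker[OF j] that by (simp add: distortion_at_most_def)
    note * = diffeo_step[OF X lohi A[OF jm(2)] B[OF jm(2)] BA[OF jm(2)] isi step[OF jm(1)] cont nin der
        continuous_on_subset[OF deriv_seq_continuous[OF D] subA] nz ker']
    show ?thesis by (intro conjI *)
  qed
  have run: "has_space X (g \<delta>) (B i) (A i)"
    if ik: "i \<le> k" "k \<le> m" and gd: "{i..<k} \<subseteq> good" and \<delta>: "\<delta> > 0" and sp: "has_space X \<delta> (B k) (A k)" for i k \<delta>
  proof -
    have le: "Inf (B i) \<le> Sup (B i)" using rel_interval_bounds(2)[OF X lohi B[of i]] ik by simp
    show ?thesis
    proof (cases "i = k")
      case True
      then show ?thesis using has_space_mono[OF sp gle(1)] le by simp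
    next
      case False
      then have lt: "i < k" using ik by simp
      have "sum \<eta> {i..<k} \<le> sum \<eta> good" using gd \<eta> \<open>finite good\<close> by (intro sum_mono2) auto
      then have S: "sum \<eta> {i..<k} \<le> 2 ^ M * (2 * real N * C)" using sum' by linarith
      have "i \<in> good" using gd lt by auto
      have "has_space X (exp (exp (- (2 ^ M * (2 * real N * C))) * ln (1 + \<delta>\<^sup>2 / (1 + 2 * \<delta>))) - 1) (B i) (A i)"
      proof (rule diffeo_run[where A = A and B = B and k = k and i = i and \<eta> = \<eta>, OF X lohi _ _ _ _ openA[OF \<open>i \<in> good\<close>] lt S \<delta> sp])
        fix j assume "j \<le> k"
        then show "rel_interval X {lo..hi} (A j)" "rel_interval X {lo..hi} (B j)" "B j \<subseteq> A j" using A B BA ik by auto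
      next
        fix j assume "i \<le> j" "j < k"
        then have "j \<in> good" using gd by auto
        then show "gap_log (A (Suc j)) (B (Suc j)) \<le> exp (\<eta> j) * gap_log (A j) (B j) \<and>
          Inf (A (Suc j)) \<in> X \<and> Sup (A (Suc j)) \<in> X \<and> A (Suc j) = {Inf (A (Suc j))<..<Sup (A (Suc j))}"
          by (rule diffeo)
      qed
      then show ?thesis by (rule has_space_mono[OF _ _ le]) (simp add: g_def)
    qed
  qed
  have single: "has_space X (g \<delta>) (B j) (A j)"
    if j: "j < m" and \<delta>: "\<delta> > 0" and sp: "has_space X \<delta> (B (Suc j)) (A (Suc j))" for j \<delta>
  proof -
    have jm: "j \<le> m" "Suc j \<le> m" using j by auto
    have "has_space X (\<rho>1 \<delta>) (B j) (A j)"
    proof (rule one_step_space[OF X lohi A[OF jm(1)] B[OF jm(1)] BA[OF jm(1)] B[OF jm(2)] step[OF j] cont _ sp])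
      show "growth_bound lo hi C n (\<lambda>t. D 0 t - s j)" using growth by (simp add: growth_bound_def osc_le_def)
    qed (rule \<rho>1[OF \<delta>])
    moreover have "Inf (B j) \<le> Sup (B j)" using rel_interval_bounds(2)[OF X lohi B[OF jm(1)]] by simp
    ultimately show ?thesis by (rule has_space_mono[OF _ gle(2)])
  qed
  have bound: "has_space X ((g ^^ (Suc (2 * e))) \<epsilon>) (B i) (A i)" if "i \<le> m" "card ({i..<m} - good) = e" for i e
    using that
  proof (induction e arbitrary: i)
    case 0
    then have "{i..<m} \<subseteq> good" by simp
    from run[OF 0(1) order.refl this \<epsilon> space] show ?case
      by (simp only: mult_0_right funpow.simps o_apply id_apply)
  next
    case (Suc e)
    have fin: "finite ({i..<m} - good)" by simp
    have ne: "{i..<m} - good \<noteq> {}"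
    proof
      assume "{i..<m} - good = {}"
      then have "card ({i..<m} - good) = 0" by (simp only: card.empty)
      with Suc.prems(2) show False by simp
    qed
    define j where "j = Min ({i..<m} - good)"
    have j: "j \<in> {i..<m} - good" unfolding j_def by (rule Min_in[OF fin ne])
    have below: "{i..<j} \<subseteq> good"
    proof
      fix k assume k: "k \<in> {i..<j}"
      show "k \<in> good"
      proof (rule ccontr)
        assume "k \<notin> good"
        then have "k \<in> {i..<m} - good" using k j by auto
        then have "j \<le> k" unfolding j_def by (rule Min_le[OF fin])
        then show False using k by simp
      qed
    qed
    have "{i..<m} - good = insert j ({Suc j..<m} - good)"
      using j below by (auto simp: subset_eq)
    then have "card ({Suc j..<m} - good) = e" using Suc.prems(2) by simp
    then have "has_space X ((g ^^ (Suc (2 * e))) \<epsilon>) (B (Suc j)) (A (Suc j))" using Suc.IH j by auto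
    from single[OF _ gitpos this] have "has_space X (g ((g ^^ (Suc (2 * e))) \<epsilon>)) (B j) (A j)" using j by auto
    from run[OF _ _ below gpos[OF gitpos] this] have "has_space X (g (g ((g ^^ (Suc (2 * e))) \<epsilon>))) (B i) (A i)"
      using j by auto
    then show ?case by simp
  qed
  have "card ({0..<m} - good) \<le> card (\<Union>z\<in>Z. {j\<in>{0..m}. z \<in> A j})"
    using Z(1) by (intro card_mono) (auto simp: good_def)
  also have "\<dots> \<le> (\<Sum>z\<in>Z. card {j\<in>{0..m}. z \<in> A j})" by (rule card_UN_le[OF Z(1)])
  also have "\<dots> \<le> (\<Sum>z\<in>Z. N)" by (intro sum_mono N)
  also have "\<dots> \<le> N * M" using Z(2) by simp
  finally have "Suc (2 * card ({0..<m} - good)) \<le> Suc (2 * (N * M))" by simp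
  from gmono[OF this] bound[OF _ refl, of 0] show ?thesis
    using rel_interval_bounds(2)[OF X lohi B[of 0]] by (intro has_space_mono[OF bound[OF _ refl, of 0]]) auto
qed

lemma real_chain_uniform_space:
  assumes X: "is_interval X" and lohi: "lo < hi" "{lo..hi} \<subseteq> X" and E: "deriv_seq {lo..hi} E"
    and ex: "\<forall>p\<in>{lo..hi}. \<exists>d\<ge>1. E d p \<noteq> 0"
  shows "\<exists>n. \<exists>\<rho>::real \<Rightarrow> nat \<Rightarrow> real. (\<forall>\<epsilon>>0. \<forall>N. \<rho> \<epsilon> N > 0) \<and> (\<forall>N. filterlim (\<lambda>\<epsilon>. \<rho> \<epsilon> N) at_top at_top) \<and>
    (\<forall>D s m A B N \<epsilon>. deriv_seq {lo..hi} D \<longrightarrow> close_seq {lo..hi} n D E \<longrightarrow>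
      real_chain X {lo..hi} (\<lambda>j t. D 0 t - s j) m A B \<longrightarrow> (\<forall>t. card {j\<in>{0..m}. t \<in> A j} \<le> N) \<longrightarrow>
      \<epsilon> > 0 \<longrightarrow> has_space X \<epsilon> (B m) (A m) \<longrightarrow> has_space X (\<rho> \<epsilon> N) (B 0) (A 0))"
proof -
  obtain n M C where C: "C > 0" and ctl: "\<forall>D. deriv_seq {lo..hi} D \<longrightarrow> close_seq {lo..hi} n D E \<longrightarrow>
    growth_bound lo hi C n (D 0) \<and>
    piecewise lo hi M (D 1) (\<lambda>J. distortion_bound D J C)"
    using uniform_distortion[OF lohi(1) E ex] by (elim exE conjE) (rule that)
  obtain \<rho>1 :: "real \<Rightarrow> real" where \<rho>1: "\<And>\<epsilon>. \<epsilon> > 0 \<Longrightarrow> \<rho>1 \<epsilon> > 0" "filterlim \<rho>1 at_top at_top"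
    "\<And>\<epsilon> t. \<epsilon> > 0 \<Longrightarrow> t \<ge> 0 \<Longrightarrow> \<epsilon> \<le> C * (t * (1 + t) ^ n) \<Longrightarrow> \<rho>1 \<epsilon> \<le> t"
    using one_step_loss[OF C, of n] by blast
  define run where "run N \<epsilon> = exp (exp (- (2 ^ M * (2 * real N * C))) * ln (1 + \<epsilon>\<^sup>2 / (1 + 2 * \<epsilon>))) - 1" for N and \<epsilon> :: real
  define g where "g N \<epsilon> = min \<epsilon> (min (\<rho>1 \<epsilon>) (run N \<epsilon>))" for N \<epsilon>
  have run: "run N \<epsilon> > 0" if "\<epsilon> > 0" for N \<epsilon>
  proof -
    have "1 < 1 + \<epsilon>\<^sup>2 / (1 + 2 * \<epsilon>)" using that by (simp add: add_pos_pos)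
    then have "ln (1 + \<epsilon>\<^sup>2 / (1 + 2 * \<epsilon>)) > 0" by simp
    then show ?thesis by (simp add: run_def)
  qed
  have gpos: "g N \<epsilon> > 0" if "\<epsilon> > 0" for N \<epsilon> using run[OF that] \<rho>1(1)[OF that] that by (simp add: g_def)
  have glim: "filterlim (g N) at_top at_top" for N
  proof -
    have "filterlim (run N) at_top at_top" unfolding run_def by (rule run_loss_at_top) simp
    with \<rho>1(2) show ?thesis unfolding g_def filterlim_at_top
      by (auto intro!: eventually_conj eventually_ge_at_top)
  qed
  show ?thesis
  proof (rule exI[of _ n], rule exI[of _ "\<lambda>\<epsilon> N. (g N ^^ (Suc (2 * (N * M)))) \<epsilon>"], intro conjI allI impI)
    show "(g N ^^ (Suc (2 * (N * M)))) \<epsilon> > 0" if "\<epsilon> > 0" for \<epsilon> N by (rule iterated_loss(1)[OF gpos glim that])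
    show "filterlim (\<lambda>\<epsilon>. (g N ^^ (Suc (2 * (N * M)))) \<epsilon>) at_top at_top" for N by (rule iterated_loss(2)[OF gpos glim])
    fix D s m A B N \<epsilon>
    assume D: "deriv_seq {lo..hi} D" "close_seq {lo..hi} n D E" and chain: "real_chain X {lo..hi} (\<lambda>j t. D 0 t - s j) m A B"
      and N: "\<forall>t. card {j\<in>{0..m}. t \<in> A j} \<le> N" and \<epsilon>: "(\<epsilon>::real) > 0" and sp: "has_space X \<epsilon> (B m) (A m)"
    note c = mp[OF mp[OF spec[OF ctl] D(1)] D(2)]
    show "has_space X ((g N ^^ (Suc (2 * (N * M)))) \<epsilon>) (B 0) (A 0)"
      by (rule real_chain_space[OF X lohi C \<rho>1(3) g_def[unfolded run_def] gpos D(1) conjunct1[OF c] conjunct2[OF c] chain N[rule_format] \<epsilon> sp])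
  qed
qed

section \<open>Coordinates and lifts\<close>

lemma deriv_seq_nth_deriv: "smooth_real X h \<Longrightarrow> deriv_seq X (\<lambda>k. nth_deriv X k h)"
  unfolding deriv_seq_def smooth_real_def differentiable_on_def
  by (simp add: has_real_derivative_iff_has_vector_derivative vector_derivative_works[symmetric])

lemma has_real_derivative_unique_within:
  fixes X :: "real set"
  assumes X: "is_interval X" "{lo..hi} \<subseteq> X" "lo < hi" and t: "t \<in> X"
    and d: "(f has_real_derivative a) (at t within X)" "(f has_real_derivative b) (at t within X)"
  shows "a = b"
proof -
  have "connected X" using X(1) by (simp add: is_interval_connected)
  moreover have "lo \<in> X" "hi \<in> X" using X(2,3) by auto
  then have "\<not> (\<exists>a. X = {a})" using X(3) by auto
  ultimately have "t islimpt X" using connected_imp_perfect t by blast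
  then have "at t within X \<noteq> bot" by (simp add: trivial_limit_within)
  then show ?thesis
    using d vector_derivative_unique_within unfolding has_real_derivative_iff_has_vector_derivative by blast
qed

lemma deriv_seq_constant:
  assumes X: "is_interval X" "{lo..hi} \<subseteq> X" "lo < hi" and G: "deriv_seq X G" and c: "\<And>t. t \<in> X \<Longrightarrow> G 0 t = c"
  shows "t \<in> X \<Longrightarrow> G (Suc k) t = 0"
proof (induction k arbitrary: t)
  case 0
  have "(G 0 has_real_derivative 0) (at t within X)"
    by (rule has_field_derivative_transform_within[OF DERIV_const zero_less_one 0]) (simp add: c)
  with deriv_seqD[OF G 0] show ?case by (rule has_real_derivative_unique_within[OF X 0])
next
  case (Suc k)
  have "(G (Suc k) has_real_derivative 0) (at t within X)"
    by (rule has_field_derivative_transform_within[OF DERIV_const[of 0] zero_less_one Suc.prems]) (simp add: Suc.IH)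
  with deriv_seqD[OF G Suc.prems] show ?case by (rule has_real_derivative_unique_within[OF X Suc.prems])
qed

lemma deriv_seq_unique:
  assumes X: "is_interval X" "{lo..hi} \<subseteq> X" "lo < hi" and D: "deriv_seq X D" "deriv_seq X E"
    and c: "\<And>t. t \<in> X \<Longrightarrow> D 0 t - E 0 t = c" and t: "t \<in> X" and k: "k \<ge> 1"
  shows "D k t = E k t"
proof -
  obtain j where "k = Suc j" using k by (cases k) auto
  then show ?thesis using deriv_seq_constant[OF X deriv_seq_diff[OF D] c t, of j] by simp
qed

text \<open>Two coordinates belong to the same point if and only if they differ by an element of this
  discrete group. It permits a common treatment of the interval and the circle.\<close>

definition periods :: "one_manifold \<Rightarrow> real set" where
  "periods M = (case M of Interval a b \<Rightarrow> {0} | Circle \<Rightarrow> range (\<lambda>k::int. 2 * pi * k))"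

lemma periods_zero: "0 \<in> periods M"
  by (auto simp: periods_def split: one_manifold.split intro: image_eqI[of _ _ 0])

lemma periods_diff:
  assumes "s \<in> periods M" "t \<in> periods M" shows "s - t \<in> periods M"
proof (cases M)
  case Circle
  then obtain j k :: int where "s = 2 * pi * j" "t = 2 * pi * k" using assms by (auto simp: periods_def)
  then have "s - t = 2 * pi * of_int (j - k)" by (simp add: right_diff_distrib)
  then have "s - t \<in> range (\<lambda>k::int. 2 * pi * k)" by (rule range_eqI)
  then show ?thesis using Circle by (simp add: periods_def)
qed (use assms in \<open>simp add: periods_def\<close>)

lemma coord_map_eq_iff: "coord_map M x = coord_map M y \<longleftrightarrow> x - y \<in> periods M"
proof (cases M)
  case Circle
  have "cis x = cis y \<longleftrightarrow> sin x = sin y \<and> cos x = cos y" by (auto simp: complex_eq_iff)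
  also have "\<dots> \<longleftrightarrow> (\<exists>n::int. x = y + 2 * pi * n)" by (rule sin_cos_eq_iff)
  also have "\<dots> \<longleftrightarrow> x - y \<in> periods Circle" by (auto simp: periods_def algebra_simps)
  finally show ?thesis using Circle by simp
qed (simp add: periods_def)

lemma coord_dom_shift: "x \<in> coord_dom M \<Longrightarrow> s \<in> periods M \<Longrightarrow> x - s \<in> coord_dom M"
  by (cases M) (auto simp: periods_def)

lemma coord_map_shift: "s \<in> periods M \<Longrightarrow> coord_map M (x - s) = coord_map M x"
  using periods_diff[OF periods_zero] unfolding coord_map_eq_iff by (metis diff_0 diff_diff_eq2 add_diff_cancel_left' diff_add_cancel minus_diff_eq diff_minus_eq_add uminus_add_conv_diff)

lemma periods_discrete:
  "\<exists>e>0. \<forall>s\<in>periods M. s \<noteq> 0 \<longrightarrow> e \<le> \<bar>s\<bar>"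
proof (cases M)
  case Circle
  have "2 * pi \<le> \<bar>2 * pi * real_of_int k\<bar>" if "2 * pi * real_of_int k \<noteq> 0" for k
  proof -
    have "1 \<le> \<bar>k\<bar>" using that by auto
    then have "2 * pi * 1 \<le> 2 * pi * \<bar>real_of_int k\<bar>" by (intro mult_left_mono) auto
    then show ?thesis by (simp add: abs_mult)
  qed
  then show ?thesis using Circle by (intro exI[of _ "2 * pi"]) (auto simp: periods_def)
qed (auto simp: periods_def intro: exI[of _ 1])

lemma closed_coord_dom: "closed (coord_dom M)" by (cases M) auto

lemma is_interval_coord_dom: "is_interval (coord_dom M)" by (cases M) auto

lemma continuous_coord_map: "continuous_on S (coord_map M)"
  by (cases M) (auto intro!: continuous_intros)

lemma openin_coord_dom_shift:
  assumes A: "openin (top_of_set (coord_dom M)) A" and s: "s \<in> periods M"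
  shows "openin (top_of_set (coord_dom M)) {x \<in> coord_dom M. x - s \<in> A}"
proof -
  have "openin (top_of_set (coord_dom M)) (coord_dom M \<inter> (\<lambda>x. x - s) -` A)"
    by (rule continuous_openin_preimage[OF _ _ A]) (use coord_dom_shift s in \<open>auto intro!: continuous_intros\<close>)
  then show ?thesis by (simp add: Int_def)
qed

text \<open>By injectivity, the translates of \<open>A\<close> by distinct periods are disjoint. They are open and cover
  the connected set \<open>S\<close>, so one of them contains it.\<close>

lemma connected_lift_in_interval:
  assumes A: "openin (top_of_set (coord_dom M)) A" and inj: "inj_on (coord_map M) A"
    and S: "connected S" "S \<subseteq> coord_dom M" and sub: "coord_map M ` S \<subseteq> coord_map M ` A"
  shows "\<exists>s\<in>periods M. \<forall>t\<in>S. t - s \<in> A"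
proof (cases "S = {}")
  case False
  have ex: "\<exists>s\<in>periods M. t - s \<in> A" if t: "t \<in> S" for t
  proof -
    obtain a where a: "a \<in> A" "coord_map M t = coord_map M a" using sub t by blast
    then show ?thesis by (intro bexI[of _ "t - a"]) (auto simp: coord_map_eq_iff)
  qed
  have uniq: "s = s'" if "t - s \<in> A" "t - s' \<in> A" "s \<in> periods M" "s' \<in> periods M" for t s s'
  proof -
    have "coord_map M (t - s) = coord_map M (t - s')" using that(3,4) by (simp add: coord_map_shift)
    from inj_onD[OF inj this that(1,2)] show ?thesis by simp
  qed
  obtain t0 where t0: "t0 \<in> S" using False by blast
  obtain s0 where s0: "s0 \<in> periods M" "t0 - s0 \<in> A" using ex[OF t0] by blast
  define U where "U s = S \<inter> {x \<in> coord_dom M. x - s \<in> A}" for s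
  have op: "openin (top_of_set S) (U s)" if sp: "s \<in> periods M" for s
  proof -
    obtain V where V: "open V" "{x \<in> coord_dom M. x - s \<in> A} = coord_dom M \<inter> V"
      using openin_coord_dom_shift[OF A sp] by (meson openin_open)
    then have "U s = S \<inter> V" using S(2) by (auto simp: U_def)
    then show ?thesis using V(1) by (auto simp: openin_open)
  qed
  have "S - U s0 = (\<Union>s\<in>periods M - {s0}. U s)"
  proof (intro equalityI subsetI)
    fix t assume t: "t \<in> S - U s0"
    then obtain s where "s \<in> periods M" "t - s \<in> A" using ex by blast
    moreover then have "t \<in> U s" using t S(2) by (auto simp: U_def)
    ultimately show "t \<in> (\<Union>s\<in>periods M - {s0}. U s)" using t by blast
  next
    fix t assume "t \<in> (\<Union>s\<in>periods M - {s0}. U s)"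
    then obtain s where s: "s \<in> periods M" "s \<noteq> s0" "t \<in> S" "t - s \<in> A" by (auto simp: U_def)
    then have "t - s0 \<notin> A" using uniq[OF s(4) _ s(1) s0(1)] by blast
    then show "t \<in> S - U s0" using s(3) by (simp add: U_def)
  qed
  moreover have "openin (top_of_set S) (\<Union>s\<in>periods M - {s0}. U s)" by (intro openin_Union) (use op in auto)
  ultimately have "openin (top_of_set S) (S - U s0)" by simp
  then have "closedin (top_of_set S) (U s0)" by (simp add: closedin_def U_def)
  with op[OF s0(1)] S(1) have "U s0 = {} \<or> U s0 = S" unfolding connected_clopen by blast
  moreover have "t0 \<in> U s0" using t0 s0 S(2) by (auto simp: U_def)
  ultimately have "U s0 = S" by blast
  then show ?thesis using s0(1) by (intro bexI[of _ s0]) (auto simp: U_def)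
qed (use periods_zero in auto)

lemma period_valued_constant:
  assumes cont: "continuous_on (coord_dom M) h" and p: "\<And>x. x \<in> coord_dom M \<Longrightarrow> h x \<in> periods M"
  shows "\<exists>c. \<forall>x\<in>coord_dom M. h x = c"
proof -
  obtain e where e: "e > 0" "\<And>s. s \<in> periods M \<Longrightarrow> s \<noteq> 0 \<Longrightarrow> e \<le> \<bar>s\<bar>" using periods_discrete by blast
  have "h constant_on coord_dom M"
  proof (rule continuous_discrete_range_constant[OF _ cont])
    show "connected (coord_dom M)" using is_interval_coord_dom by (rule is_interval_connected)
    fix x assume x: "x \<in> coord_dom M"
    show "\<exists>e>0. \<forall>y. y \<in> coord_dom M \<and> h y \<noteq> h x \<longrightarrow> e \<le> norm (h y - h x)"
      using e periods_diff[OF p p[OF x]] by (intro exI[of _ e]) auto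
  qed
  then show ?thesis by (auto simp: constant_on_def)
qed

lemma smooth_lift_deriv_seq: "smooth_lift M f F \<Longrightarrow> deriv_seq (coord_dom M) (\<lambda>k. nth_deriv (coord_dom M) k F)"
  by (auto simp: smooth_lift_def intro: deriv_seq_nth_deriv)

lemma lifts_differ_by_constant:
  assumes F: "smooth_lift M f F" and F': "smooth_lift M f F'"
  shows "\<exists>c. \<forall>t\<in>coord_dom M. F t - F' t = c"
proof (rule period_valued_constant)
  show "F t - F' t \<in> periods M" if "t \<in> coord_dom M" for t
    using F F' that unfolding smooth_lift_def by (metis coord_map_eq_iff)
  show "continuous_on (coord_dom M) (\<lambda>t. F t - F' t)"
    using smooth_lift_deriv_seq[OF F, THEN deriv_seq_continuous, of 0] smooth_lift_deriv_seq[OF F', THEN deriv_seq_continuous, of 0]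
    by (intro continuous_on_diff) simp_all
qed

lemma shift_deriv_seq:
  assumes D: "deriv_seq (coord_dom M) D" and s: "s \<in> periods M"
  shows "deriv_seq (coord_dom M) (\<lambda>k t. D k (t - s))"
proof (cases M)
  case (Interval a b)
  then show ?thesis using D s by (simp add: periods_def)
next
  case Circle
  show ?thesis
    unfolding deriv_seq_def
  proof (intro allI ballI)
    fix k t
    have "(D k has_real_derivative D (Suc k) (t - s)) (at (t - s))" using deriv_seqD[OF D, of "t - s" k] Circle by simp
    moreover have "((\<lambda>t. t - s) has_real_derivative 1) (at t)" by (auto intro!: derivative_eq_intros)
    ultimately have "((\<lambda>t. D k (t - s)) has_real_derivative D (Suc k) (t - s) * 1) (at t)" by (rule DERIV_chain2)
    then show "((\<lambda>t. D k (t - s)) has_real_derivative D (Suc k) (t - s)) (at t within coord_dom M)" using Circle by simp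
  qed
qed

text \<open>The definitions of critical and non-flat points allow different lifts and different coordinates
  of the same point. Lifts, and their translates by periods, differ by constants, so that all of
  them have the same derivatives.\<close>

lemma nonflat_derivative:
  assumes X: "{lo..hi} \<subseteq> coord_dom M" "lo < hi" and nf: "\<forall>c. critical_point M f c \<longrightarrow> non_flat M f c"
    and F: "smooth_lift M f F" and t: "t \<in> coord_dom M"
  shows "\<exists>d\<ge>1. nth_deriv (coord_dom M) d F t \<noteq> 0"
proof (cases "nth_deriv (coord_dom M) 1 F t = 0")
  case True
  then have "critical_point M f (coord_map M t)" unfolding critical_point_def using F t by blast
  then obtain F' t' d where F': "smooth_lift M f F'" and t': "t' \<in> coord_dom M" "coord_map M t = coord_map M t'"
    and d: "d \<ge> 2" "nth_deriv (coord_dom M) d F' t' \<noteq> 0" using nf unfolding non_flat_def by blast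
  define s where "s = t - t'"
  have s: "s \<in> periods M" using t'(2) by (simp add: s_def coord_map_eq_iff)
  obtain c where c: "\<And>x. x \<in> coord_dom M \<Longrightarrow> F' x - F x = c" using lifts_differ_by_constant[OF F' F] by blast
  have "nth_deriv (coord_dom M) d F' t' = nth_deriv (coord_dom M) d F t'"
    by (rule deriv_seq_unique[OF is_interval_coord_dom X smooth_lift_deriv_seq[OF F'] smooth_lift_deriv_seq[OF F] _ t'(1)])
       (use c d in auto)
  moreover have "nth_deriv (coord_dom M) d F (t - s) = nth_deriv (coord_dom M) d F t"
  proof -
    have DG: "deriv_seq (coord_dom M) (\<lambda>k x. nth_deriv (coord_dom M) k F (x - s))"
      by (rule shift_deriv_seq[OF smooth_lift_deriv_seq[OF F] s])
    have p: "F (x - s) - F x \<in> periods M" if x: "x \<in> coord_dom M" for x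
    proof -
      have "coord_map M (F (x - s)) = f (coord_map M (x - s))"
        using F coord_dom_shift[OF x s] by (simp add: smooth_lift_def)
      also have "\<dots> = coord_map M (F x)" using F x s by (simp add: smooth_lift_def coord_map_shift)
      finally show ?thesis by (simp add: coord_map_eq_iff)
    qed
    have cont: "continuous_on (coord_dom M) (\<lambda>x. F (x - s) - F x)"
      using deriv_seq_continuous[OF DG, of 0] deriv_seq_continuous[OF smooth_lift_deriv_seq[OF F], of 0]
      by (intro continuous_on_diff) simp_all
    obtain c' where "\<And>x. x \<in> coord_dom M \<Longrightarrow> F (x - s) - F x = c'" using period_valued_constant[OF cont p] by blast
    then show ?thesis
      by (intro deriv_seq_unique[OF is_interval_coord_dom X DG smooth_lift_deriv_seq[OF F] _ t]) (use d in auto)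
  qed
  ultimately show ?thesis using d by (intro exI[of _ d]) (auto simp: s_def)
qed auto

text \<open>If a boundary point \<open>t\<close> of \<open>A\<close> were mapped into \<open>A'\<close>, then \<open>T\<close> together with the image of \<open>t\<close> would be
  a larger connected subset of the preimage. It is strictly larger: on the circle, the image of \<open>t\<close> cannot
  already be the image of another point of \<open>A\<close>, since \<open>A\<close> is open and its coordinates are injective.\<close>

lemma pullback_of_component:
  assumes G: "smooth_lift M g G" and A: "interval_coord M A T" and A': "interval_coord M A' T'"
    and comp: "T \<in> components (points M \<inter> g -` T')"
  shows "\<exists>s\<in>periods M. (\<forall>t\<in>A. G t - s \<in> A') \<and> (\<forall>t\<in>closure A - A. G t - s \<in> coord_dom M - A')"
proof -
  have G': "\<And>t. t \<in> coord_dom M \<Longrightarrow> G t \<in> coord_dom M" "\<And>t. t \<in> coord_dom M \<Longrightarrow> g (coord_map M t) = coord_map M (G t)"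
    using G by (auto simp: smooth_lift_def)
  have contG: "continuous_on (coord_dom M) G" using deriv_seq_continuous[OF smooth_lift_deriv_seq[OF G], of 0] by simp
  have a: "A \<noteq> {}" "is_interval A" "openin (top_of_set (coord_dom M)) A" "inj_on (coord_map M) A" "T = coord_map M ` A"
    using A by (auto simp: interval_coord_def)
  have a': "openin (top_of_set (coord_dom M)) A'" "inj_on (coord_map M) A'" "T' = coord_map M ` A'"
    using A' by (auto simp: interval_coord_def)
  have sub: "A \<subseteq> coord_dom M" using a(3) openin_imp_subset by blast
  have gT: "g z \<in> T'" if "z \<in> T" for z using in_components_subset[OF comp] that by blast
  have "connected (G ` A)"
    by (rule connected_continuous_image[OF continuous_on_subset[OF contG sub]]) (use a(2) in \<open>rule is_interval_connected\<close>)
  moreover have "coord_map M ` G ` A \<subseteq> coord_map M ` A'"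
  proof
    fix z assume "z \<in> coord_map M ` G ` A"
    then obtain t where t: "t \<in> A" "z = coord_map M (G t)" by blast
    then have "z = g (coord_map M t)" using G'(2) sub by auto
    then show "z \<in> coord_map M ` A'" using gT t(1) a(5) a'(3) by auto
  qed
  moreover have "G ` A \<subseteq> coord_dom M" using G'(1) sub by blast
  ultimately obtain s where s: "s \<in> periods M" "\<And>t. t \<in> A \<Longrightarrow> G t - s \<in> A'"
    using connected_lift_in_interval[OF a'(1,2)] by (metis imageI)
  have "G t - s \<in> coord_dom M - A'" if t: "t \<in> closure A - A" for t
  proof
    have tX: "t \<in> coord_dom M" using t closure_minimal[OF sub closed_coord_dom] by blast
    show "G t - s \<in> coord_dom M" by (rule coord_dom_shift[OF G'(1)[OF tX] s(1)])
    show "G t - s \<notin> A'"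
    proof
      assume bad: "G t - s \<in> A'"
      let ?W = "coord_map M ` insert t A"
      have "connected (insert t A)"
        by (rule connected_intermediate_closure[of A]) (use t closure_subset[of A] a(2) is_interval_connected in auto)
      then have conn: "connected ?W" by (rule connected_continuous_image[OF continuous_coord_map])
      have "?W \<subseteq> points M \<inter> g -` T'"
      proof
        fix z assume "z \<in> ?W"
        then obtain x where x: "x \<in> insert t A" "z = coord_map M x" by blast
        have xX: "x \<in> coord_dom M" using x(1) tX sub by blast
        have "G x - s \<in> A'" using x(1) bad s(2) by blast
        then have "coord_map M (G x - s) \<in> T'" using a'(3) by blast
        then have "g z \<in> T'" using G'(2)[OF xX] x(2) coord_map_shift[OF s(1)] by simp
        then show "z \<in> points M \<inter> g -` T'" using xX x(2) by (auto simp: points_def)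
      qed
      moreover have "T \<inter> ?W \<noteq> {}" using a(1,5) by blast
      ultimately have "?W \<subseteq> T" using components_maximal[OF comp conn] by blast
      then obtain b where b: "b \<in> A" "coord_map M t = coord_map M b" using a(5) by blast
      then have p: "t - b \<in> periods M" by (simp add: coord_map_eq_iff)
      \<comment> \<open>a neighbourhood of \<open>t\<close> is a translate of a part of \<open>A\<close>, contradicting injectivity\<close>
      obtain V where V: "open V" "{x \<in> coord_dom M. x - (t - b) \<in> A} = coord_dom M \<inter> V"
        using openin_coord_dom_shift[OF a(3) p] by (meson openin_open)
      have "t \<in> {x \<in> coord_dom M. x - (t - b) \<in> A}" using tX b(1) by simp
      then have "t \<in> V" unfolding V(2) by (rule IntD2)
      then have "V \<inter> closure A \<noteq> {}" using t by blast
      then obtain x where x: "x \<in> V" "x \<in> A" using open_Int_closure_eq_empty[OF V(1), of A] by auto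
      then have "x - (t - b) \<in> A" using V(2) sub by blast
      from inj_onD[OF a(4) coord_map_shift[OF p] this x(2)] have "t = b" by simp
      then show False using b(1) t by blast
    qed
  qed
  then show ?thesis using s by blast
qed

lemma interval_coord_shift:
  assumes "interval_coord M A T" "s \<in> periods M"
  shows "interval_coord M ((\<lambda>t. t - s) ` A) T"
proof -
  have a: "A \<noteq> {}" "is_interval A" "openin (top_of_set (coord_dom M)) A" "inj_on (coord_map M) A" "T = coord_map M ` A"
    using assms(1) by (auto simp: interval_coord_def)
  have sub: "A \<subseteq> coord_dom M" using a(3) openin_imp_subset by blast
  have s': "- s \<in> periods M" using periods_diff[OF periods_zero assms(2)] by simp
  have "(\<lambda>t. t - s) ` A = {x \<in> coord_dom M. x - (- s) \<in> A}"
  proof (intro equalityI subsetI)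
    fix x assume "x \<in> (\<lambda>t. t - s) ` A"
    then show "x \<in> {x \<in> coord_dom M. x - (- s) \<in> A}" using sub coord_dom_shift[OF _ assms(2)] by auto
  next
    fix x assume "x \<in> {x \<in> coord_dom M. x - (- s) \<in> A}"
    then have "x + s \<in> A" by simp
    then show "x \<in> (\<lambda>t. t - s) ` A" by (rule rev_image_eqI) simp
  qed
  then have "openin (top_of_set (coord_dom M)) ((\<lambda>t. t - s) ` A)" using openin_coord_dom_shift[OF a(3) s'] by simp
  moreover have "is_interval ((\<lambda>t. t - s) ` A)"
    using a(2) unfolding is_interval_1
  proof (intro ballI allI impI)
    fix x y z assume int: "\<forall>a\<in>A. \<forall>b\<in>A. \<forall>x. a \<le> x \<and> x \<le> b \<longrightarrow> x \<in> A"
      and xy: "x \<in> (\<lambda>t. t - s) ` A" "y \<in> (\<lambda>t. t - s) ` A" and z: "x \<le> z \<and> z \<le> y"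
    then obtain a b where ab: "a \<in> A" "x = a - s" "b \<in> A" "y = b - s" by blast
    then have "a \<le> z + s \<and> z + s \<le> b" using z by linarith
    then have "z + s \<in> A" using int ab(1,3) by blast
    then show "z \<in> (\<lambda>t. t - s) ` A" by (rule rev_image_eqI) simp
  qed
  moreover have "inj_on (coord_map M) ((\<lambda>t. t - s) ` A)"
  proof (rule inj_onI)
    fix x y assume "x \<in> (\<lambda>t. t - s) ` A" "y \<in> (\<lambda>t. t - s) ` A" "coord_map M x = coord_map M y"
    then obtain a b where "a \<in> A" "x = a - s" "b \<in> A" "y = b - s" "coord_map M a = coord_map M b"
      using coord_map_shift[OF assms(2)] by auto
    then show "x = y" using a(4) by (auto dest: inj_onD)
  qed
  moreover have "coord_map M ` (\<lambda>t. t - s) ` A = T"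
    unfolding image_image coord_map_shift[OF assms(2)] a(5) ..
  ultimately show ?thesis using a(1) by (simp add: interval_coord_def)
qed

text \<open>A compact interval that contains a coordinate representation of every interval of the
  manifold. On the circle the length of a representation is at most \<open>2 * pi\<close>, and one of its points can be
  moved into \<open>{2 * pi..<4 * pi}\<close>.\<close>

fun window :: "one_manifold \<Rightarrow> real \<times> real" where
  "window (Interval a b) = (a, b)"
| "window Circle = (0, 6 * pi)"

lemma interval_coord_in_window:
  assumes T: "interval_in M T"
  shows "\<exists>A. interval_coord M A T \<and> A \<subseteq> {fst (window M)..snd (window M)}"
proof -
  obtain A where A: "interval_coord M A T" using T by (auto simp: interval_in_def)
  have a: "A \<noteq> {}" "is_interval A" "openin (top_of_set (coord_dom M)) A" "inj_on (coord_map M) A"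
    using A by (auto simp: interval_coord_def)
  show ?thesis
  proof (cases M)
    case (Interval p q)
    then have "A \<subseteq> {p..q}" using openin_imp_subset[OF a(3)] by simp
    then show ?thesis using A Interval by auto
  next
    case Circle
    obtain a0 where a0: "a0 \<in> A" using a(1) by blast
    define s where "s = 2 * pi * real_of_int (\<lfloor>a0 / (2 * pi)\<rfloor> - 1)"
    have s: "s \<in> periods M" unfolding s_def periods_def Circle one_manifold.case by (rule rangeI)
    define k where "k = real_of_int \<lfloor>a0 / (2 * pi)\<rfloor>"
    have "k \<le> a0 / (2 * pi)" "a0 / (2 * pi) < k + 1" unfolding k_def by linarith+
    then have "k * (2 * pi) \<le> a0" "a0 < (k + 1) * (2 * pi)" by (simp_all only: pos_le_divide_eq pos_divide_less_eq pi_gt_zero zero_less_mult_iff zero_less_numeral simp_thms)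
    moreover have "s = k * (2 * pi) - 2 * pi" by (simp add: s_def k_def algebra_simps)
    ultimately have r: "2 * pi \<le> a0 - s" "a0 - s < 4 * pi" by (simp_all add: distrib_right)
    have short: "\<bar>x - a0\<bar> < 2 * pi" if x: "x \<in> A" for x
    proof (rule ccontr)
      assume neg: "\<not> \<bar>x - a0\<bar> < 2 * pi"
      define y where "y = min x a0"
      have "y \<in> A" "y + 2 * pi \<in> A"
        using neg x a0 interval_Icc_subset[OF a(2) x a0] interval_Icc_subset[OF a(2) a0 x]
        by (auto simp: y_def min_def subset_eq split: if_splits)
      moreover have "coord_map M (y + 2 * pi) = coord_map M y" using Circle by (simp add: cis_mult[symmetric])
      ultimately have "y + 2 * pi = y" using inj_onD[OF a(4)] by blast
      then show False by simp
    qed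
    have "(\<lambda>t. t - s) ` A \<subseteq> {0..6 * pi}"
    proof
      fix y assume "y \<in> (\<lambda>t. t - s) ` A"
      then obtain x where "x \<in> A" "y = x - s" by blast
      with short[of x] r show "y \<in> {0..6 * pi}" by (auto simp: abs_less_iff)
    qed
    then show ?thesis using interval_coord_shift[OF A s] Circle by auto
  qed
qed

lemma interval_coord_subset:
  assumes A: "interval_coord M A T" and J: "interval_in M J" "J \<subseteq> T"
  shows "\<exists>B. interval_coord M B J \<and> B \<subseteq> A"
proof -
  obtain B where B: "interval_coord M B J" using J(1) by (auto simp: interval_in_def)
  have "\<exists>s\<in>periods M. \<forall>t\<in>B. t - s \<in> A"
  proof (rule connected_lift_in_interval)
    show "openin (top_of_set (coord_dom M)) A" "inj_on (coord_map M) A" using A by (simp_all add: interval_coord_def)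
    show "connected B" using B by (simp add: interval_coord_def is_interval_connected)
    show "B \<subseteq> coord_dom M" using B unfolding interval_coord_def by (blast dest: openin_imp_subset)
    show "coord_map M ` B \<subseteq> coord_map M ` A" using A B J(2) by (simp add: interval_coord_def)
  qed
  then obtain s where "s \<in> periods M" "\<forall>t\<in>B. t - s \<in> A" by blast
  then show ?thesis using interval_coord_shift[OF B] by (intro exI[of _ "(\<lambda>t. t - s) ` B"]) auto
qed

lemma interval_coord_unique:
  assumes B: "interval_coord M B J" and B': "interval_coord M B' J"
  shows "\<exists>s\<in>periods M. B = (\<lambda>t. t - s) ` B'"
proof -
  have inj: "inj_on (coord_map M) B" using B by (simp add: interval_coord_def)
  have "\<exists>s\<in>periods M. \<forall>t\<in>B'. t - s \<in> B"
  proof (rule connected_lift_in_interval)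
    show "openin (top_of_set (coord_dom M)) B" "inj_on (coord_map M) B" using B by (simp_all add: interval_coord_def)
    show "connected B'" using B' by (simp add: interval_coord_def is_interval_connected)
    show "B' \<subseteq> coord_dom M" using B' unfolding interval_coord_def by (blast dest: openin_imp_subset)
    show "coord_map M ` B' \<subseteq> coord_map M ` B" using B B' by (simp add: interval_coord_def)
  qed
  then obtain s where s: "s \<in> periods M" "\<And>t. t \<in> B' \<Longrightarrow> t - s \<in> B" by blast
  have "b \<in> (\<lambda>t. t - s) ` B'" if b: "b \<in> B" for b
  proof -
    have "coord_map M b \<in> coord_map M ` B'" using B B' b by (auto simp: interval_coord_def)
    then obtain b' where b': "b' \<in> B'" "coord_map M b = coord_map M b'" by blast
    then have "b = b' - s" using inj_onD[OF inj _ b s(2)[OF b'(1)]] coord_map_shift[OF s(1)] by simp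
    then show ?thesis using b'(1) by blast
  qed
  then show ?thesis using s by blast
qed

lemma scale_interval_shift:
  assumes "B \<noteq> {}" "bdd_below B" "bdd_above B"
  shows "scale_interval l ((\<lambda>t. t - s) ` B) = (\<lambda>t. t - s) ` scale_interval l B"
proof -
  have i: "Inf ((\<lambda>t. t - s) ` B) = Inf B - s"
  proof (rule cInf_eq_non_empty)
    fix y assume "\<And>x. x \<in> (\<lambda>t. t - s) ` B \<Longrightarrow> y \<le> x"
    then have "y \<le> x - s" if "x \<in> B" for x using that by blast
    then have "y + s \<le> Inf B" by (intro cInf_greatest assms(1)) (simp add: le_diff_eq)
    then show "y \<le> Inf B - s" by simp
  qed (use assms in \<open>auto intro: cInf_lower\<close>)
  have u: "Sup ((\<lambda>t. t - s) ` B) = Sup B - s"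
  proof (rule cSup_eq_non_empty)
    fix y assume "\<And>x. x \<in> (\<lambda>t. t - s) ` B \<Longrightarrow> x \<le> y"
    then have "x - s \<le> y" if "x \<in> B" for x using that by blast
    then have "Sup B \<le> y + s" by (intro cSup_least assms(1)) (simp add: diff_le_eq)
    then show "Sup B - s \<le> y" by simp
  qed (use assms in \<open>auto intro: cSup_upper\<close>)
  define c r where "c = (Inf B + Sup B) / 2" and "r = l * ((Sup B - Inf B) / 2)"
  have "scale_interval l ((\<lambda>t. t - s) ` B) = {c - s - r<..<c - s + r}"
    unfolding scale_interval_def i u Let_def c_def r_def by (simp add: field_simps)
  also have "\<dots> = (\<lambda>t. t - s) ` {c - r<..<c + r}"
  proof (intro equalityI subsetI)
    fix x assume "x \<in> {c - s - r<..<c - s + r}"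
    then have "x + s \<in> {c - r<..<c + r}" by auto
    then show "x \<in> (\<lambda>t. t - s) ` {c - r<..<c + r}" by (rule rev_image_eqI) simp
  qed auto
  finally show ?thesis by (simp add: scale_interval_def Let_def c_def r_def)
qed

section \<open>Chains on the manifold\<close>

lemma rel_intervalI:
  assumes "interval_coord M A T" "A \<subseteq> I"
  shows "rel_interval (coord_dom M) I A"
  using assms by (simp add: interval_coord_def rel_interval_def)

lemma intersection_multiplicity_coord:
  assumes A: "\<And>j. j \<le> m \<Longrightarrow> interval_coord M (A j) (T j)" and N: "intersection_multiplicity m T \<le> N"
  shows "card {j\<in>{0..m}. t \<in> A j} \<le> N"
proof -
  let ?K = "{j\<in>{0..m}. t \<in> A j}"
  let ?F = "{card K | K. K \<subseteq> {0..m} \<and> (\<Inter>k\<in>K. T k) \<noteq> {}}"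
  have "coord_map M t \<in> (\<Inter>k\<in>?K. T k)" using A by (auto simp: interval_coord_def)
  then have "card ?K \<in> ?F" by blast
  moreover have "?F \<subseteq> card ` Pow {0..m}" by blast
  then have "finite ?F" by (rule finite_subset) simp
  ultimately have "card ?K \<le> Max ?F" by (intro Max_ge)
  then show ?thesis using N by (simp add: intersection_multiplicity_def)
qed

text \<open>The translation \<open>s j\<close> by which the image of \<open>A j\<close> has to be moved into \<open>A (Suc j)\<close> also moves the
  image of \<open>B j\<close> into \<open>B (Suc j)\<close>, because \<open>A (Suc j)\<close> is mapped injectively to the manifold.\<close>

lemma lifted_chain:
  assumes G: "smooth_lift M g G" and J: "interval_chain M g m J" and T: "interval_chain M g m T"
    and JT: "\<And>k. k \<le> m \<Longrightarrow> J k \<subseteq> T k"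
  shows "\<exists>A B s. (\<forall>k\<le>m. interval_coord M (A k) (T k) \<and> interval_coord M (B k) (J k)) \<and>
    real_chain (coord_dom M) {fst (window M)..snd (window M)} (\<lambda>j t. G t - s j) m A B"
proof -
  let ?I = "{fst (window M)..snd (window M)}"
  have "\<exists>A B. interval_coord M A (T k) \<and> A \<subseteq> ?I \<and> interval_coord M B (J k) \<and> B \<subseteq> A" if k: "k \<le> m" for k
  proof -
    have "interval_in M (T k)" "interval_in M (J k)" using T J k by (auto simp: interval_chain_def)
    then show ?thesis using interval_coord_in_window interval_coord_subset[OF _ _ JT[OF k]] by metis
  qed
  then obtain A B where A: "\<And>k. k \<le> m \<Longrightarrow> interval_coord M (A k) (T k)" "\<And>k. k \<le> m \<Longrightarrow> A k \<subseteq> ?I"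
    and B: "\<And>k. k \<le> m \<Longrightarrow> interval_coord M (B k) (J k)" "\<And>k. k \<le> m \<Longrightarrow> B k \<subseteq> A k" by metis
  have "\<exists>s. pullback_step (coord_dom M) (\<lambda>t. G t - s) (A j) (B j) (A (Suc j)) (B (Suc j))" if j: "j < m" for j
  proof -
    have jm: "j \<le> m" "Suc j \<le> m" using j by auto
    have "T j \<in> components (points M \<inter> g -` T (Suc j))" "J j \<in> components (points M \<inter> g -` J (Suc j))"
      using T J j by (auto simp: interval_chain_def)
    then obtain s s' where
      s: "s \<in> periods M" "\<forall>t\<in>A j. G t - s \<in> A (Suc j)" "\<forall>t\<in>closure (A j) - A j. G t - s \<in> coord_dom M - A (Suc j)"
      and s': "s' \<in> periods M" "\<forall>t\<in>B j. G t - s' \<in> B (Suc j)" "\<forall>t\<in>closure (B j) - B j. G t - s' \<in> coord_dom M - B (Suc j)"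
      using pullback_of_component[OF G A(1)[OF jm(1)] A(1)[OF jm(2)]] pullback_of_component[OF G B(1)[OF jm(1)] B(1)[OF jm(2)]]
      by metis
    have "s = s'"
    proof -
      obtain b where b: "b \<in> B j" using B(1)[OF jm(1)] by (auto simp: interval_coord_def)
      have 1: "G b - s \<in> A (Suc j)" using s(2) B(2)[OF jm(1)] b by blast
      have 2: "G b - s' \<in> A (Suc j)" using s'(2) B(2)[OF jm(2)] b by blast
      have "inj_on (coord_map M) (A (Suc j))" using A(1)[OF jm(2)] by (simp add: interval_coord_def)
      from inj_onD[OF this _ 1 2] show ?thesis using coord_map_shift s(1) s'(1) by simp
    qed
    then show ?thesis using s s' by (intro exI[of _ s]) (auto simp: pullback_step_def)
  qed
  then obtain s where s: "\<And>j. j < m \<Longrightarrow> pullback_step (coord_dom M) (\<lambda>t. G t - s j) (A j) (B j) (A (Suc j)) (B (Suc j))"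
    by metis
  have "rel_interval (coord_dom M) ?I (A k) \<and> rel_interval (coord_dom M) ?I (B k)" if "k \<le> m" for k
    using rel_intervalI[OF A(1)[OF that] A(2)[OF that]] rel_intervalI[OF B(1)[OF that]] A(2)[OF that] B(2)[OF that] by blast
  then have "real_chain (coord_dom M) ?I (\<lambda>j t. G t - s j) m A B" using s B(2) by (simp add: real_chain_def)
  then show ?thesis using A(1) B(1) by blast
qed

text \<open>On the circle, the scaled neighbourhood lies in an arc and hence does not wrap around: its
  connected coordinate set lies in one translate of \<open>A\<close>, which is \<open>A\<close> itself since both contain \<open>B\<close>.\<close>

lemma has_space_of_scaled_nbhd:
  assumes A: "interval_coord M A T" and B: "interval_coord M B J" and BA: "B \<subseteq> A"
    and bd: "Inf B < Sup B" "B \<subseteq> {Inf B..Sup B}" and \<epsilon>: "\<epsilon> > 0" and sub: "scaled_nbhd M \<epsilon> J \<subseteq> T"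
  shows "has_space (coord_dom M) \<epsilon> B A"
proof -
  let ?S = "scale_interval (1 + 2 * \<epsilon>) B \<inter> coord_dom M"
  have inj: "inj_on (coord_map M) A" and op: "openin (top_of_set (coord_dom M)) A" and T: "T = coord_map M ` A"
    using A by (auto simp: interval_coord_def)
  have img: "coord_map M ` ?S \<subseteq> coord_map M ` A" using sub B unfolding scaled_nbhd_def T by blast
  have "is_interval ?S"
    unfolding scale_interval_eq by (intro is_interval_Int is_interval_coord_dom) (simp add: is_interval_oo)
  then have "connected ?S" by (rule is_interval_connected)
  from connected_lift_in_interval[OF op inj this _ img] obtain s where s: "s \<in> periods M" "\<And>t. t \<in> ?S \<Longrightarrow> t - s \<in> A" by blast
  obtain b where b: "b \<in> B" using B by (auto simp: interval_coord_def)
  have "0 < \<epsilon> * (Sup B - Inf B)" using \<epsilon> bd(1) by simp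
  moreover have "Inf B \<le> b" "b \<le> Sup B" using bd(2) b by auto
  ultimately have "b \<in> scale_interval (1 + 2 * \<epsilon>) B" unfolding scale_interval_eq by simp
  moreover have "b \<in> coord_dom M" using b BA openin_imp_subset[OF op] by blast
  ultimately have "b - s \<in> A" using s(2) by blast
  from inj_onD[OF inj coord_map_shift[OF s(1)] this] have "s = 0" using b BA by auto
  then show ?thesis using s(2) by (auto simp: has_space_def)
qed

lemma scaled_nbhd_of_has_space:
  assumes A: "interval_coord M A T" and B: "interval_coord M B J"
    and bd: "bdd_below B" "bdd_above B" and sp: "has_space (coord_dom M) \<epsilon> B A"
  shows "scaled_nbhd M \<epsilon> J \<subseteq> T"
proof
  fix z assume "z \<in> scaled_nbhd M \<epsilon> J"
  then obtain B' x where B': "interval_coord M B' J" and x: "x \<in> scale_interval (1 + 2 * \<epsilon>) B'" "x \<in> coord_dom M" "z = coord_map M x"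
    unfolding scaled_nbhd_def by blast
  obtain s where s: "s \<in> periods M" "B' = (\<lambda>t. t - s) ` B" using interval_coord_unique[OF B' B] by blast
  have "B \<noteq> {}" using B by (simp add: interval_coord_def)
  from x(1) obtain y where y: "y \<in> scale_interval (1 + 2 * \<epsilon>) B" "x = y - s"
    unfolding s(2) scale_interval_shift[OF \<open>B \<noteq> {}\<close> bd] by blast
  have ms: "- s \<in> periods M" using periods_diff[OF periods_zero s(1)] by simp
  have "y \<in> coord_dom M" using coord_dom_shift[OF x(2) ms] y(2) by simp
  then have "y \<in> A" using sp y(1) by (auto simp: has_space_def)
  moreover have "z = coord_map M y" using x(3) y(2) coord_map_shift[OF s(1)] by simp
  ultimately show "z \<in> T" using A by (auto simp: interval_coord_def)
qed

theorem theorem4p6: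
  fixes M :: one_manifold and f :: "complex \<Rightarrow> complex"
  assumes "(\<exists>a b. a < b \<and> M = Interval a b) \<or> M = Circle"
    and "f \<in> smooth_self_maps M"
    and "\<forall>c. critical_point M f c \<longrightarrow> non_flat M f c"
  shows "\<exists>(\<F> :: (complex \<Rightarrow> complex) set) (\<rho> :: real \<Rightarrow> nat \<Rightarrow> real).
    openin (smooth_topology M) \<F> \<and> f \<in> \<F> \<and>
    (\<forall>\<epsilon>>0. \<forall>N. \<rho> \<epsilon> N > 0) \<and>
    (\<forall>g\<in>\<F>. \<forall>\<epsilon>>0. \<forall>N m J T.
       interval_chain M g m J \<longrightarrow> interval_chain M g m T \<longrightarrow>
       (\<forall>k\<le>m. J k \<subseteq> T k) \<longrightarrow>
       intersection_multiplicity m T \<le> N \<longrightarrow>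
       scaled_nbhd M \<epsilon> (J m) \<subseteq> T m \<longrightarrow>
       scaled_nbhd M (\<rho> \<epsilon> N) (J 0) \<subseteq> T 0) \<and>
    (\<forall>N. filterlim (\<lambda>\<epsilon>. \<rho> \<epsilon> N) at_top at_top)"
proof -
  let ?X = "coord_dom M"
  define lo hi where "lo = fst (window M)" and "hi = snd (window M)"
  have lohi: "lo < hi" "{lo..hi} \<subseteq> ?X" using assms(1) by (auto simp: lo_def hi_def)
  obtain F where F: "smooth_lift M f F" using assms(2) by (auto simp: smooth_self_maps_def)
  let ?E = "\<lambda>k. nth_deriv ?X k F"
  have E: "deriv_seq {lo..hi} ?E" by (rule deriv_seq_subset[OF smooth_lift_deriv_seq[OF F] lohi(2)])
  have ex: "\<forall>p\<in>{lo..hi}. \<exists>d\<ge>1. ?E d p \<noteq> 0" using nonflat_derivative[OF lohi(2,1) assms(3) F] lohi(2) by blast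
  from real_chain_uniform_space[OF is_interval_coord_dom lohi E ex] obtain n \<rho> where
    \<rho>: "\<forall>\<epsilon>>0. \<forall>N. \<rho> \<epsilon> N > 0" "\<forall>N. filterlim (\<lambda>\<epsilon>. \<rho> \<epsilon> N) at_top at_top" and
    main: "\<forall>D s m A B N \<epsilon>. deriv_seq {lo..hi} D \<longrightarrow> close_seq {lo..hi} n D ?E \<longrightarrow>
      real_chain ?X {lo..hi} (\<lambda>j t. D 0 t - s j) m A B \<longrightarrow> (\<forall>t. card {j\<in>{0..m}. t \<in> A j} \<le> N) \<longrightarrow>
      \<epsilon> > 0 \<longrightarrow> has_space ?X \<epsilon> (B m) (A m) \<longrightarrow> has_space ?X (\<rho> \<epsilon> N) (B 0) (A 0)"
    by (elim exE conjE) (rule that)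
  define \<F> where "\<F> = smooth_ball M f n (1 / (real n + 1))"
  show ?thesis
  proof (rule exI[of _ \<F>], rule exI[of _ \<rho>], intro conjI \<rho> ballI allI impI)
    show "openin (smooth_topology M) \<F>"
      unfolding smooth_topology_def \<F>_def
      by (intro topology_generated_by_Basis CollectI exI[of _ f] exI[of _ n] exI[of _ "1 / (real n + 1)"] conjI refl assms(2)) auto
    show "f \<in> \<F>" unfolding \<F>_def smooth_ball_def using F assms(2) by (intro CollectI conjI exI[of _ F]) auto
    fix g \<epsilon> N m J T
    assume g: "g \<in> \<F>" and \<epsilon>: "\<epsilon> > (0::real)" and J: "interval_chain M g m J" and T: "interval_chain M g m T"
      and JT: "\<forall>k\<le>m. J k \<subseteq> T k" and N: "intersection_multiplicity m T \<le> N" and nb: "scaled_nbhd M \<epsilon> (J m) \<subseteq> T m"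
    obtain F' G where F': "smooth_lift M f F'" and G: "smooth_lift M g G"
      and near: "\<And>j t. j \<le> n \<Longrightarrow> t \<in> ?X \<Longrightarrow> \<bar>nth_deriv ?X j G t - nth_deriv ?X j F' t\<bar> < 1 / (real n + 1)"
      using g unfolding \<F>_def smooth_ball_def by blast
    let ?D = "\<lambda>k. nth_deriv ?X k G"
    obtain c where c: "\<And>t. t \<in> ?X \<Longrightarrow> F' t - F t = c" using lifts_differ_by_constant[OF F' F] by blast
    have same: "nth_deriv ?X j F' t = nth_deriv ?X j F t" if "t \<in> ?X" "j \<ge> 1" for j t
      by (rule deriv_seq_unique[OF is_interval_coord_dom lohi(2,1) smooth_lift_deriv_seq[OF F'] smooth_lift_deriv_seq[OF F] _ that])
         (use c in auto)
    have close: "close_seq {lo..hi} n ?D ?E"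
      unfolding close_seq_def
    proof (intro ballI)
      fix j t assume j: "j \<in> {1..n}" and t: "t \<in> {lo..hi}"
      have tX: "t \<in> ?X" using t lohi(2) by blast
      show "\<bar>?D j t - ?E j t\<bar> < 1 / (real n + 1)" using near[of j t] same[OF tX, of j] tX j by simp
    qed
    have D: "deriv_seq {lo..hi} ?D" by (rule deriv_seq_subset[OF smooth_lift_deriv_seq[OF G] lohi(2)])
    from lifted_chain[OF G J T] JT obtain A B s where
      AB: "\<And>k. k \<le> m \<Longrightarrow> interval_coord M (A k) (T k) \<and> interval_coord M (B k) (J k)" and
      chain: "real_chain ?X {lo..hi} (\<lambda>j t. G t - s j) m A B" unfolding lo_def hi_def by blast
    have B: "rel_interval ?X {lo..hi} (B k)" "B k \<subseteq> A k" if "k \<le> m" for k using chain that by (auto simp: real_chain_def)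
    note bm = rel_interval_bounds[OF is_interval_coord_dom lohi B(1)[OF order.refl]]
    have sp: "has_space ?X \<epsilon> (B m) (A m)"
      by (rule has_space_of_scaled_nbhd[OF _ _ B(2) bm(2,4) \<epsilon> nb]) (use AB in auto)
    have mult: "\<forall>t. card {j\<in>{0..m}. t \<in> A j} \<le> N" using intersection_multiplicity_coord[OF _ N] AB by blast
    have chain': "real_chain ?X {lo..hi} (\<lambda>j t. ?D 0 t - s j) m A B" using chain by simp
    have "has_space ?X (\<rho> \<epsilon> N) (B 0) (A 0)"
      using main D close chain' mult \<epsilon> sp by blast
    moreover have "B 0 \<subseteq> {lo..hi}" using B(1)[of 0] by (simp add: rel_interval_def)
    then have "bdd_below (B 0)" "bdd_above (B 0)" by (auto intro: bdd_below_mono bdd_above_mono)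
    ultimately show "scaled_nbhd M (\<rho> \<epsilon> N) (J 0) \<subseteq> T 0"
      using AB[of 0] by (intro scaled_nbhd_of_has_space) auto
  qed
qed

end
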